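(* Let $\mathbf{k}$ be a field of any characteristic, let $d\ge 2$, and let $V_1,\dots,V_d$ be finite-dimensional $\mathbf{k}$-vector spaces. Set $C_d=\max(2+\theta_{d-2},\,2^{d-2}-1)$, where $\theta_n$ is the number of ordered collections $(I_1,\dots,I_p)$, $p\ge 1$, of pairwise disjoint nonempty subsets of $[1,n]$ whose union $I_1\sqcup\dots\sqcup I_p$ is a proper subset of $[1,n]$ (so in particular $C_3=2$, $C_4=4$, $C_5=14$). (i) Let $P:V_1\times\dots\times V_d\to\mathbf{k}$ be a polylinear form, and let $g'(P)$ denote the codimension in $V_2\times\dots\times V_d$ of the Zariski closure of the set of $\mathbf{k}$-points of $Z_P$ (so $g(P)\le g'(P)$, and $g(P)=g'(P)$ if $\mathbf{k}$ is algebraically closed). Then $$\mathrm{rk}^S(P)\le C_d\cdot g'(P).$$ (ii) Assume $\mathbf{k}$ is algebraically closed. Then for every collection $\overline{P}=(P_1,\dots,P_s)$ of polylinear forms on $V_1\times\dots\times V_d$ one has $$\mathrm{rk}^S(\overline{P})\le C_d\cdot (g(\overline{P})+s-1).$$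
   Context: Vector spaces are regarded as affine spaces over $\mathbf{k}$; a polylinear form is one that is linear in each argument; $[1,n]=\{1,\dots,n\}$. Schmidt rank of a polylinear form: $P\ne 0$ has Schmidt rank $1$ if there is a partition $[1,d]=I\sqcup J$ into two nonempty parts and polylinear forms $P_I$ on $\prod_{a\in I}V_a$ and $P_J$ on $\prod_{a\in J}V_a$ with $P=P_I\cdot P_J$. In general $\mathrm{rk}^S(P)$ is the smallest $r\ge 0$ such that $P=\sum_{i=1}^r P_i$ with each $P_i$ of Schmidt rank $1$ (so $\mathrm{rk}^S(0)=0$). For a collection $\overline P=(P_1,\dots,P_s)$, $s\ge1$, $\mathrm{rk}^S(\overline P)$ is the minimum of $\mathrm{rk}^S(c_1P_1+\dots+c_sP_s)$ over $(c_1,\dots,c_s)\in\mathbf{k}^s\setminus\{0\}$. $Z_P\subset V_2\times\dots\times V_d$ is the closed subvariety of all $(v_2,\dots,v_d)$ such that $P(v_1,v_2,\dots,v_d)=0$ for all $v_1\in V_1$, and $g(P)=\mathrm{codim}_{V_2\times\dots\times V_d}Z_P$. For a collection $\overline P=(P_1,\dots,P_s)$, $Z_{\overline P}\subset V_2\times\dots\times V_d$ is the locus of $(v_2,\dots,v_d)$ for which the linear map $V_1\to\mathbf{k}^s$, $v_1\mapsto (P_i(v_1,v_2,\dots,v_d))_{1\le i\le s}$, has rank $<s$, and $g(\overline P)=\mathrm{codim}_{V_2\times\dots\times V_d}Z_{\overline P}$. *)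

theory Defs
  imports
    "HOL-Algebra.Ideal"
    "HOL-Computational_Algebra.Polynomial"
    "HOL-Library.Extended_Nat"
    "HOL-Library.Function_Algebras"
begin

text \<open>
  Throughout, \<open>V a\<close> (\<open>a = 1, \<dots>, d\<close>) are finite-dimensional subspaces of one vector space \<open>'v\<close> with
  scalar multiplication \<open>scale\<close>. Every finite family of vector spaces is of this form, inside its
  direct sum. The product of the \<open>V a\<close> over \<open>a \<in> A\<close> is \<open>PiE A V\<close>. A form on it is a function whose
  values outside \<open>PiE A V\<close> are irrelevant.
\<close>

definition fin_dim_subspace :: "('k::field \<Rightarrow> 'v::ab_group_add \<Rightarrow> 'v) \<Rightarrow> 'v set \<Rightarrow> bool" where
  "fin_dim_subspace scale U \<longleftrightarrow>
     module.subspace scale U \<and> (\<exists>B. finite B \<and> module.span scale B = U)"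

definition algebraically_closed_field :: "'k::field itself \<Rightarrow> bool" where
  "algebraically_closed_field _ \<longleftrightarrow> (\<forall>p :: 'k poly. degree p > 0 \<longrightarrow> (\<exists>x. poly p x = 0))"


section \<open>Polylinear forms and Schmidt rank\<close>

definition polylinear_form ::
  "('k::field \<Rightarrow> 'v::ab_group_add \<Rightarrow> 'v) \<Rightarrow> nat set \<Rightarrow> (nat \<Rightarrow> 'v set) \<Rightarrow> ((nat \<Rightarrow> 'v) \<Rightarrow> 'k) \<Rightarrow> bool" where
  "polylinear_form scale A V P \<longleftrightarrow>
     (\<forall>v \<in> PiE A V. \<forall>a \<in> A. \<forall>x \<in> V a. \<forall>y \<in> V a. \<forall>c.
        P (v(a := x + y)) = P (v(a := x)) + P (v(a := y)) \<and>
        P (v(a := scale c x)) = c * P (v(a := x)))"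

definition schmidt_rank_one ::
  "('k::field \<Rightarrow> 'v::ab_group_add \<Rightarrow> 'v) \<Rightarrow> nat \<Rightarrow> (nat \<Rightarrow> 'v set) \<Rightarrow> ((nat \<Rightarrow> 'v) \<Rightarrow> 'k) \<Rightarrow> bool" where
  "schmidt_rank_one scale d V P \<longleftrightarrow>
     (\<exists>v \<in> PiE {1..d} V. P v \<noteq> 0) \<and>
     (\<exists>I J PI PJ. I \<noteq> {} \<and> J \<noteq> {} \<and> I \<inter> J = {} \<and> I \<union> J = {1..d} \<and>
        polylinear_form scale I V PI \<and> polylinear_form scale J V PJ \<and>
        (\<forall>v \<in> PiE {1..d} V. P v = PI (restrict v I) * PJ (restrict v J)))"

text \<open>For \<open>d \<ge> 2\<close> every polylinear form is a sum of forms of Schmidt rank one, so the minimum exists.\<close>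

definition schmidt_rank ::
  "('k::field \<Rightarrow> 'v::ab_group_add \<Rightarrow> 'v) \<Rightarrow> nat \<Rightarrow> (nat \<Rightarrow> 'v set) \<Rightarrow> ((nat \<Rightarrow> 'v) \<Rightarrow> 'k) \<Rightarrow> nat" where
  "schmidt_rank scale d V P =
     (LEAST r. \<exists>Q. (\<forall>i<r. schmidt_rank_one scale d V (Q i)) \<and>
                   (\<forall>v \<in> PiE {1..d} V. P v = (\<Sum>i<r. Q i v)))"

definition schmidt_rank_coll ::
  "('k::field \<Rightarrow> 'v::ab_group_add \<Rightarrow> 'v) \<Rightarrow> nat \<Rightarrow> (nat \<Rightarrow> 'v set) \<Rightarrow>
   nat \<Rightarrow> (nat \<Rightarrow> (nat \<Rightarrow> 'v) \<Rightarrow> 'k) \<Rightarrow> nat" where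
  "schmidt_rank_coll scale d V s P =
     (INF c \<in> {c :: nat \<Rightarrow> 'k. \<exists>i \<in> {1..s}. c i \<noteq> 0}.
        schmidt_rank scale d V (\<lambda>v. \<Sum>i\<in>{1..s}. c i * P i v))"


section \<open>The degeneracy loci\<close>

definition Z_form :: "nat \<Rightarrow> (nat \<Rightarrow> 'v set) \<Rightarrow> ((nat \<Rightarrow> 'v) \<Rightarrow> 'k::field) \<Rightarrow> (nat \<Rightarrow> 'v) set" where
  "Z_form d V P = {v \<in> PiE {2..d} V. \<forall>x \<in> V 1. P (v(1 := x)) = 0}"

text \<open>\<open>'k\<^sup>s\<close> is realized as the functions \<open>nat \<Rightarrow> 'k\<close> vanishing outside \<open>{1..s}\<close>.\<close>

definition Z_coll ::
  "nat \<Rightarrow> (nat \<Rightarrow> 'v set) \<Rightarrow> nat \<Rightarrow> (nat \<Rightarrow> (nat \<Rightarrow> 'v) \<Rightarrow> 'k::field) \<Rightarrow> (nat \<Rightarrow> 'v) set" where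
  "Z_coll d V s P =
     {v \<in> PiE {2..d} V.
        vector_space.dim (\<lambda>(c :: 'k) (f :: nat \<Rightarrow> 'k) i. c * f i)
          ((\<lambda>x i. if i \<in> {1..s} then P i (v(1 := x)) else 0) ` V 1) < s}"


section \<open>Codimension of the Zariski closure of a set of rational points\<close>

text \<open>
  Polynomial functions on \<open>PiE A V\<close>. A linear functional on the subspace \<open>V a\<close> is the same as the
  restriction of one on the ambient space.
\<close>

inductive_set poly_functions ::
  "('k::field \<Rightarrow> 'v::ab_group_add \<Rightarrow> 'v) \<Rightarrow> nat set \<Rightarrow> ((nat \<Rightarrow> 'v) \<Rightarrow> 'k) set"
  for scale A where
  const: "(\<lambda>_. c) \<in> poly_functions scale A"
| linear: "a \<in> A \<Longrightarrow> Vector_Spaces.linear scale (*) l \<Longrightarrow> (\<lambda>w. l (w a)) \<in> poly_functions scale A"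
| add: "f \<in> poly_functions scale A \<Longrightarrow> g \<in> poly_functions scale A \<Longrightarrow>
    (\<lambda>w. f w + g w) \<in> poly_functions scale A"
| mult: "f \<in> poly_functions scale A \<Longrightarrow> g \<in> poly_functions scale A \<Longrightarrow>
    (\<lambda>w. f w * g w) \<in> poly_functions scale A"

text \<open>
  For a set \<open>S\<close> of rational points of the affine space \<open>W = PiE A V\<close>, let \<open>I(S)\<close> be the ideal of all
  polynomials vanishing on \<open>S\<close>. The Zariski closure of \<open>S\<close> in \<open>W\<close> (as a scheme over \<open>'k\<close>, reduced) is
  the spectrum of \<open>'k[W] / I(S)\<close>, and this quotient is the ring of restrictions to \<open>S\<close> of polynomial
  functions. This holds over every field, including finite ones: two polynomials which differ only
  by an element vanishing on \<open>S\<close> are identified anyway. If \<open>'k\<close> is algebraically closed and \<open>S\<close> is a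
  closed subvariety, it is the usual coordinate ring of \<open>S\<close>. Note that over other fields the dimension
  of the closure cannot be read off from the topology that \<open>S\<close> carries as a set of rational points.
\<close>

definition closure_ring ::
  "('k::field \<Rightarrow> 'v::ab_group_add \<Rightarrow> 'v) \<Rightarrow> nat set \<Rightarrow> (nat \<Rightarrow> 'v) set \<Rightarrow> ((nat \<Rightarrow> 'v) \<Rightarrow> 'k) ring" where
  "closure_ring scale A S =
     \<lparr>partial_object.carrier = (\<lambda>f. restrict f S) ` poly_functions scale A,
      monoid.mult = (\<lambda>f g. \<lambda>w\<in>S. f w * g w),
      monoid.one = (\<lambda>w\<in>S. 1),
      ring.zero = (\<lambda>w\<in>S. 0),
      ring.add = (\<lambda>f g. \<lambda>w\<in>S. f w + g w)\<rparr>"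

definition krull_dim :: "('a, 'm) ring_scheme \<Rightarrow> enat" where
  "krull_dim R = Sup {enat n | n. \<exists>p :: nat \<Rightarrow> 'a set.
     (\<forall>i\<le>n. primeideal (p i) R) \<and> (\<forall>i<n. p i \<subset> p (Suc i))}"

text \<open>
  The ambient dimension is that of \<open>PiE A V\<close> as an affine space, hence the linear dimension (over a
  finite field the rational points themselves would give \<open>0\<close>). Below, \<open>S\<close> always contains the
  origin, and the dimension of the closure is at most the ambient one, so the subtraction is not
  truncated.
\<close>

definition codim_closure ::
  "('k::field \<Rightarrow> 'v::ab_group_add \<Rightarrow> 'v) \<Rightarrow> nat set \<Rightarrow> (nat \<Rightarrow> 'v set) \<Rightarrow> (nat \<Rightarrow> 'v) set \<Rightarrow> enat" where
  "codim_closure scale A V S =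
     enat (\<Sum>a\<in>A. vector_space.dim scale (V a)) - krull_dim (closure_ring scale A S)"


section \<open>The constant\<close>

definition theta :: "nat \<Rightarrow> nat" where
  "theta n = card {Is :: nat set list.
     Is \<noteq> [] \<and> (\<forall>I \<in> set Is. I \<noteq> {} \<and> I \<subseteq> {1..n}) \<and>
     sorted_wrt disjnt Is \<and> \<Union>(set Is) \<subset> {1..n}}"

definition C_const :: "nat \<Rightarrow> nat" where
  "C_const d = max (2 + theta (d - 2)) (2 ^ (d - 2) - 1)"

end

theory Submission
  imports Defs
begin

text \<open>
  Both parts say that a form which degenerates on a large locus is a short sum of split products. The
  proof writes down such a sum at a generic point of the locus and then specialises it to a rational
  point. The bound obtained is \<open>2 ^ (d - 2)\<close> times the codimension, and \<open>2 ^ (d - 2) \<le> C_const d\<close> because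
  every nonempty proper subset of \<open>{1..d-2}\<close> is already a collection counted by \<open>theta\<close>
  (\<open>power_le_C_const\<close>).

  \<^bold>\<open>The generic point.\<close> Let \<open>p 0 \<subset> \<dots> \<subset> p m\<close> be a chain of primes in the ring of the locus. The sets
  \<open>{f \<noteq> 0}\<close> for \<open>f\<close> outside \<open>p 0\<close> have the finite intersection property, so an ultrafilter contains them
  (\<open>chain_generic_ultrafilter\<close>). It serves as a generic point of a component of the locus: a function
  vanishes there if it is zero on a large set. Every statement about finitely many functions which
  holds at the generic point holds at some rational point of the locus. Elements of
  \<open>p (i + 1) - p i\<close>, one for each \<open>i\<close>, are algebraically independent at it.

  \<^bold>\<open>Counting.\<close> List the coordinates of the generic point: first the parameters of a linear combination,
  then the slots \<open>2..d-1\<close> (the base), then slot \<open>d\<close> (the fibre). A coordinate is algebraic if it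
  satisfies a polynomial relation over the preceding ones. Comparing the growth of the spaces of
  polynomials of bounded degree gives \<open>m\<close> as a lower bound for the number of the others
  (\<open>independent_card_le\<close>). For a single form the number of algebraic coordinates is therefore at most
  the codimension, and \<open>s - 1\<close> parameters add at most \<open>s - 1\<close> to it.

  \<^bold>\<open>The decomposition.\<close> Let \<open>w\<close> be the generic point. The bilinear form \<open>P(x, w\<^sub>2, \<dots>, w\<^sub>d\<^sub>-\<^sub>1, y)\<close> in \<open>x\<close>
  and \<open>y\<close> is zero at \<open>y = w\<^sub>d\<close> for all \<open>x\<close>. Gaussian elimination turns every nonzero column into an
  algebraic coordinate of the fibre, so this form is a sum of at most \<open>b\<close> products of a form in \<open>x\<close>
  and a form in \<open>y\<close>, where \<open>b\<close> is the number of algebraic fibre coordinates (\<open>elimination\<close>). The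
  remaining slots are freed one at a time by differentiation. There is a set \<open>J\<close> of base coordinates,
  not larger than the number of algebraic ones, such that derivations at the generic point may be
  prescribed on the coordinates outside \<open>J\<close> (\<open>frame_exists\<close>). Apply the derivation which moves the
  slot \<open>t\<close> in the direction of a vector \<open>\<tau>\<close>, to an identity which writes
  \<open>P(x, \<tau>\<^sub>2, \<dots>, \<tau>\<^sub>t\<^sub>-\<^sub>1, w\<^sub>t, \<dots>, w\<^sub>d\<^sub>-\<^sub>1, y)\<close> as a sum of \<open>c\<close> products. On the left this yields the same
  form with \<open>\<tau>\<close> in place of \<open>w\<^sub>t\<close>, and for every coordinate in \<open>J\<close> a correction which is a product of
  a form in \<open>\<tau>\<close> alone and a form in the other variables. On the right each product gives two by the
  Leibniz rule. So \<open>c\<close> becomes at most \<open>2 * c + card J\<close> (\<open>differentiation\<close>), and after \<open>d - 2\<close> steps the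
  form \<open>P\<close> itself is a sum of at most \<open>2 ^ (d - 2) * (b + card J)\<close> split products
  (\<open>generic_decomposition\<close>). The coefficients are polynomials in \<open>w\<close>, up to a common denominator, and
  \<open>w\<close> can be replaced by a rational point at which the denominator is nonzero (\<open>specialise\<close>).

  The characteristic does not enter: at an inseparable coordinate there are more derivations than
  transcendental coordinates, never fewer.

  For a collection, each rational point \<open>v\<close> of the locus has a nonzero \<open>c(v)\<close> with
  \<open>\<Sum>i. c(v)\<^sub>i * P\<^sub>i(x, v) = 0\<close> for all \<open>x\<close>. One entry of \<open>c\<close> is nonzero at the generic point and can be
  scaled to \<open>1\<close>; the other \<open>s - 1\<close> entries are the parameters. The argument above, with derivations
  that kill the parameters, decomposes the combination for some rational value of \<open>c\<close>. A single form
  is the case \<open>s = 1\<close>.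
\<close>

section \<open>Ultrafilters\<close>

locale ultrafilter =
  fixes U :: "'p filter"
  assumes proper: "U \<noteq> bot"
    and ultra: "eventually P U \<or> eventually (\<lambda>s. \<not> P s) U"
begin

lemma not_eventually_iff: "\<not> eventually P U \<longleftrightarrow> eventually (\<lambda>s. \<not> P s) U"
proof
  assume "eventually (\<lambda>s. \<not> P s) U"
  show "\<not> eventually P U"
  proof
    assume "eventually P U"
    with \<open>eventually (\<lambda>s. \<not> P s) U\<close> have "eventually (\<lambda>_. False) U"
      by eventually_elim simp
    then show False
      using proper by (simp add: trivial_limit_def)
  qed
qed (use ultra in blast)

lemma eventually_bex_finite:
  assumes "finite I" "eventually (\<lambda>s. \<exists>i\<in>I. Q i s) U"
  shows "\<exists>i\<in>I. eventually (Q i) U"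
proof (rule ccontr)
  assume "\<not> ?thesis"
  then have "\<forall>i\<in>I. eventually (\<lambda>s. \<not> Q i s) U"
    by (simp add: not_eventually_iff)
  then have "eventually (\<lambda>s. \<forall>i\<in>I. \<not> Q i s) U"
    using assms(1) by (simp add: eventually_ball_finite_distrib)
  with assms(2) show False
    using not_eventually_iff[of "\<lambda>s. \<exists>i\<in>I. Q i s"] by simp
qed

lemma eventually_ex: "eventually P U \<Longrightarrow> \<exists>s. P s"
  using proper eventually_happens' by blast

end

lemma ultrafilter_principal: "ultrafilter (principal {s})"
  by standard (auto simp: principal_eq_bot_iff eventually_principal)

text \<open>
  By Zorn's lemma there is a largest family with the finite intersection property; being largest, it
  decides every set.
\<close>

lemma ultrafilter_exists:
  assumes fip: "\<And>F. finite F \<Longrightarrow> F \<subseteq> \<A> \<Longrightarrow> \<Inter>F \<noteq> {}"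
  obtains U where "ultrafilter U" "\<And>A. A \<in> \<A> \<Longrightarrow> eventually (\<lambda>s. s \<in> A) U"
proof -
  define FIP where "FIP = (\<lambda>\<M> :: 'a set set. \<forall>F. finite F \<longrightarrow> F \<subseteq> \<M> \<longrightarrow> \<Inter>F \<noteq> {})"
  have "\<exists>\<M>\<in>{\<M>. \<A> \<subseteq> \<M> \<and> FIP \<M>}. \<forall>X\<in>{\<M>. \<A> \<subseteq> \<M> \<and> FIP \<M>}. \<M> \<subseteq> X \<longrightarrow> X = \<M>"
  proof (rule subset_Zorn_nonempty)
    show "{\<M>. \<A> \<subseteq> \<M> \<and> FIP \<M>} \<noteq> {}"
      using fip by (auto simp: FIP_def)
  next
    fix \<C> assume \<C>: "\<C> \<noteq> {}" "subset.chain {\<M>. \<A> \<subseteq> \<M> \<and> FIP \<M>} \<C>"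
    have "\<A> \<subseteq> \<Union>\<C>"
      using \<C> unfolding subset.chain_def by blast
    moreover have "FIP (\<Union>\<C>)"
      unfolding FIP_def
    proof safe
      fix F assume F: "finite F" "F \<subseteq> \<Union>\<C>" "\<Inter>F = {}"
      obtain M where "M \<in> \<C>" "F \<subseteq> M"
        using finite_subset_Union_chain[OF F(1,2) \<C>] by blast
      moreover from this(1) have "FIP M"
        using \<C>(2) unfolding subset.chain_def by blast
      ultimately show False
        using F(1,3) unfolding FIP_def by blast
    qed
    ultimately show "\<Union>\<C> \<in> {\<M>. \<A> \<subseteq> \<M> \<and> FIP \<M>}"
      by simp
  qed
  then obtain \<M> where \<M>: "\<A> \<subseteq> \<M>" "FIP \<M>"
    and max: "\<And>X. \<A> \<subseteq> X \<Longrightarrow> FIP X \<Longrightarrow> \<M> \<subseteq> X \<Longrightarrow> X = \<M>"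
    by auto
  define U where "U = (INF A\<in>\<M>. principal A)"
  have ev: "eventually P U \<longleftrightarrow> (\<exists>F. finite F \<and> F \<subseteq> \<M> \<and> \<Inter>F \<subseteq> Collect P)" for P
  proof -
    have "eventually P (INF A\<in>F. principal A) \<longleftrightarrow> \<Inter>F \<subseteq> Collect P" if "finite F" for F :: "'a set set"
      using INF_principal_finite[OF that, of "\<lambda>A. A"] by (auto simp: eventually_principal)
    moreover have "eventually P U \<longleftrightarrow>
        (\<exists>F\<subseteq>\<M>. finite F \<and> eventually P (INF A\<in>F. principal A))"
      unfolding U_def by (rule eventually_INF)
    ultimately show ?thesis
      by metis
  qed
  have "ultrafilter U"
  proof
    show "U \<noteq> bot"
      using \<M>(2) by (auto simp: trivial_limit_def ev FIP_def)
    show "eventually P U \<or> eventually (\<lambda>s. \<not> P s) U" for P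
    proof (cases "FIP (insert (Collect P) \<M>)")
      case True
      then have "Collect P \<in> \<M>"
        using max[of "insert (Collect P) \<M>"] \<M>(1) by auto
      then have "eventually P U"
        unfolding ev by (intro exI[of _ "{Collect P}"]) auto
      then show ?thesis ..
    next
      case False
      then obtain F where F: "finite F" "F \<subseteq> insert (Collect P) \<M>" "\<Inter>F = {}"
        by (auto simp: FIP_def)
      then have "eventually (\<lambda>s. \<not> P s) U"
        unfolding ev by (intro exI[of _ "F - {Collect P}"]) auto
      then show ?thesis ..
    qed
  qed
  moreover have "eventually (\<lambda>s. s \<in> A) U" if "A \<in> \<A>" for A
    unfolding ev using that \<M>(1) by (intro exI[of _ "{A}"]) auto
  ultimately show thesis
    by (rule that)
qed


section \<open>Polynomials in the coordinates of a generic point\<close>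

inductive_set pol :: "(nat \<Rightarrow> 'p \<Rightarrow> 'k::field) \<Rightarrow> nat \<Rightarrow> ('p \<Rightarrow> 'k) set" for x n where
  const: "(\<lambda>_. c) \<in> pol x n"
| var: "i < n \<Longrightarrow> x i \<in> pol x n"
| add: "f \<in> pol x n \<Longrightarrow> g \<in> pol x n \<Longrightarrow> (\<lambda>s. f s + g s) \<in> pol x n"
| mult: "f \<in> pol x n \<Longrightarrow> g \<in> pol x n \<Longrightarrow> (\<lambda>s. f s * g s) \<in> pol x n"

lemma pol_mono: "f \<in> pol x m \<Longrightarrow> m \<le> n \<Longrightarrow> f \<in> pol x n"
  by (induction rule: pol.induct) (auto intro: pol.intros)

lemma pol_uminus: "f \<in> pol x n \<Longrightarrow> (\<lambda>s. - f s) \<in> pol x n"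
  using pol.mult[OF pol.const[of "-1"], of f] by simp

lemma pol_diff: "f \<in> pol x n \<Longrightarrow> g \<in> pol x n \<Longrightarrow> (\<lambda>s. f s - g s) \<in> pol x n"
  using pol.add[OF _ pol_uminus, of f x n g] by simp

lemma pol_sum: "(\<And>i. i \<in> I \<Longrightarrow> f i \<in> pol x n) \<Longrightarrow> (\<lambda>s. \<Sum>i\<in>I. f i s) \<in> pol x n"
  by (induction I rule: infinite_finite_induct) (auto intro: pol.intros)

lemma pol_power: "f \<in> pol x n \<Longrightarrow> (\<lambda>s. f s ^ j) \<in> pol x n"
  by (induction j) (auto intro: pol.intros)

lemmas pol_closed = pol.intros pol_uminus pol_diff pol_sum pol_power


section \<open>Tangent vector fields\<close>

text \<open>
  The pairs \<open>(f, X f)\<close> where \<open>X\<close> is the derivation with \<open>X (x i) = \<xi> i\<close>; in other words the subring of the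
  dual numbers generated by the constants and the \<open>x i + \<epsilon> \<xi> i\<close>. This is a relation, because \<open>X f\<close> may
  depend on the expression of \<open>f\<close> as a polynomial in the \<open>x i\<close> as long as nothing is known about \<open>\<xi>\<close>.
\<close>

inductive_set tangent_pairs ::
  "(nat \<Rightarrow> 'p \<Rightarrow> 'k::field) \<Rightarrow> (nat \<Rightarrow> 'p \<Rightarrow> 'k) \<Rightarrow> nat \<Rightarrow> (('p \<Rightarrow> 'k) \<times> ('p \<Rightarrow> 'k)) set"
  for x \<xi> n where
  const: "(\<lambda>_. c, \<lambda>_. 0) \<in> tangent_pairs x \<xi> n"
| var: "i < n \<Longrightarrow> (x i, \<xi> i) \<in> tangent_pairs x \<xi> n"
| add: "(f, f') \<in> tangent_pairs x \<xi> n \<Longrightarrow> (g, g') \<in> tangent_pairs x \<xi> n \<Longrightarrow>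
    (\<lambda>s. f s + g s, \<lambda>s. f' s + g' s) \<in> tangent_pairs x \<xi> n"
| mult: "(f, f') \<in> tangent_pairs x \<xi> n \<Longrightarrow> (g, g') \<in> tangent_pairs x \<xi> n \<Longrightarrow>
    (\<lambda>s. f s * g s, \<lambda>s. f' s * g s + f s * g' s) \<in> tangent_pairs x \<xi> n"

lemma tangent_pairs_exist:
  assumes "f \<in> pol x n"
  shows "\<exists>f'. (f, f') \<in> tangent_pairs x \<xi> n"
  using assms
proof induction
  case (const c)
  show ?case
    by (rule exI) (rule tangent_pairs.const)
next
  case (var i)
  show ?case
    by (rule exI) (rule tangent_pairs.var[OF var])
next
  case (add f g)
  then show ?case
    by (elim exE) (rule exI, rule tangent_pairs.add)
next
  case (mult f g)
  then show ?case
    by (elim exE) (rule exI, rule tangent_pairs.mult)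
qed

lemma tangent_pairs_pol:
  assumes "(f, f') \<in> tangent_pairs x \<xi> n"
  shows "f \<in> pol x n"
  using assms by induction (auto intro: pol.intros)

lemma tangent_pairs_pol_snd:
  assumes "(f, f') \<in> tangent_pairs x \<xi> n" "n \<le> m" "\<And>i. i < n \<Longrightarrow> \<xi> i \<in> pol x m"
  shows "f' \<in> pol x m"
  using assms
  by induction (auto intro!: pol.intros intro: pol_mono[OF tangent_pairs_pol])

lemma tangent_pairs_cong:
  assumes "(f, f') \<in> tangent_pairs x \<xi> n" "\<And>i. i < n \<Longrightarrow> \<xi> i = \<eta> i"
  shows "(f, f') \<in> tangent_pairs x \<eta> n"
  using assms by induction (auto intro: tangent_pairs.intros)

lemma tangent_pairs_uminus:
  "(f, f') \<in> tangent_pairs x \<xi> n \<Longrightarrow> (\<lambda>s. - f s, \<lambda>s. - f' s) \<in> tangent_pairs x \<xi> n"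
  using tangent_pairs.mult[OF tangent_pairs.const[of "-1"], of f f' x \<xi> n] by simp

lemma tangent_pairs_sum:
  "(\<And>i. i \<in> I \<Longrightarrow> (f i, f' i) \<in> tangent_pairs x \<xi> n) \<Longrightarrow>
    (\<lambda>s. \<Sum>i\<in>I. f i s, \<lambda>s. \<Sum>i\<in>I. f' i s) \<in> tangent_pairs x \<xi> n"
proof (induction I rule: infinite_finite_induct)
  case (insert i I)
  then show ?case
    using tangent_pairs.add[of "f i" "f' i" x \<xi> n "\<lambda>s. \<Sum>i\<in>I. f i s" "\<lambda>s. \<Sum>i\<in>I. f' i s"] by simp
qed (auto intro: tangent_pairs.const)

lemma tangent_pairs_constant:
  assumes "f \<in> pol x m" "m \<le> n" "\<And>l. l < m \<Longrightarrow> \<xi> l = (\<lambda>_. 0)"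
  shows "(f, \<lambda>_. 0) \<in> tangent_pairs x \<xi> n"
  using assms(1)
proof induction
  case (const c)
  show ?case by (rule tangent_pairs.const)
next
  case (var i)
  then show ?case
    using tangent_pairs.var[of i n x \<xi>] assms(2,3) by simp
next
  case (add f g)
  then show ?case
    using tangent_pairs.add[OF add.IH] by simp
next
  case (mult f g)
  then show ?case
    using tangent_pairs.mult[OF mult.IH] by simp
qed

text \<open>
  Derivations may be combined with arbitrary functions as coefficients. The two summands of \<open>f'\<close> are
  obtained from the same expression of \<open>f\<close>, which is why they cannot be chosen in advance.
\<close>

lemma tangent_pairs_combine:
  assumes "(f, f') \<in> tangent_pairs x (\<lambda>i s. a s * \<xi> i s + b s * \<eta> i s) n"
  shows "\<exists>f1 f2. (f, f1) \<in> tangent_pairs x \<xi> n \<and> (f, f2) \<in> tangent_pairs x \<eta> n \<and>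
    f' = (\<lambda>s. a s * f1 s + b s * f2 s)"
  using assms
proof induction
  case (const c)
  then show ?case
    by (intro exI[of _ "\<lambda>_. 0"]) (auto intro: tangent_pairs.const)
next
  case (var i)
  then show ?case
    by (intro exI[of _ "\<xi> i"] exI[of _ "\<eta> i"]) (auto intro: tangent_pairs.var)
next
  case (add f f' g g')
  then obtain f1 f2 g1 g2 where
    "(f, f1) \<in> tangent_pairs x \<xi> n" "(f, f2) \<in> tangent_pairs x \<eta> n" "f' = (\<lambda>s. a s * f1 s + b s * f2 s)"
    "(g, g1) \<in> tangent_pairs x \<xi> n" "(g, g2) \<in> tangent_pairs x \<eta> n" "g' = (\<lambda>s. a s * g1 s + b s * g2 s)"
    by blast
  then show ?case
    by (intro exI[of _ "\<lambda>s. f1 s + g1 s"] exI[of _ "\<lambda>s. f2 s + g2 s"])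
      (auto intro: tangent_pairs.add simp: algebra_simps)
next
  case (mult f f' g g')
  then obtain f1 f2 g1 g2 where
    "(f, f1) \<in> tangent_pairs x \<xi> n" "(f, f2) \<in> tangent_pairs x \<eta> n" "f' = (\<lambda>s. a s * f1 s + b s * f2 s)"
    "(g, g1) \<in> tangent_pairs x \<xi> n" "(g, g2) \<in> tangent_pairs x \<eta> n" "g' = (\<lambda>s. a s * g1 s + b s * g2 s)"
    by blast
  then show ?case
    by (intro exI[of _ "\<lambda>s. f1 s * g s + f s * g1 s"] exI[of _ "\<lambda>s. f2 s * g s + f s * g2 s"])
      (auto intro: tangent_pairs.mult simp: algebra_simps)
qed

context ultrafilter
begin

text \<open>
  The ultrafilter is treated as a point with values in an ultrapower of \<open>'k\<close>: \<open>null f\<close> says that \<open>f\<close>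
  is zero at this point. Working with classes of functions instead would need a type that depends
  on the ultrafilter.
\<close>

definition null :: "('p \<Rightarrow> 'k::field) \<Rightarrow> bool" where
  "null f \<longleftrightarrow> eventually (\<lambda>s. f s = 0) U"

lemma not_null_iff: "\<not> null f \<longleftrightarrow> eventually (\<lambda>s. f s \<noteq> 0) U"
  by (simp add: null_def not_eventually_iff)

lemma null_mult_iff: "null (\<lambda>s. f s * g s) \<longleftrightarrow> null f \<or> null g"
proof
  assume fg: "null (\<lambda>s. f s * g s)"
  show "null f \<or> null g"
  proof (rule ccontr)
    assume "\<not> ?thesis"
    then have "eventually (\<lambda>s. f s \<noteq> 0) U" "eventually (\<lambda>s. g s \<noteq> 0) U"
      by (auto simp: not_null_iff)
    then have "eventually (\<lambda>s. f s * g s \<noteq> 0) U"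
      by eventually_elim simp
    then show False
      using fg not_null_iff by blast
  qed
qed (auto simp: null_def elim: eventually_mono)

lemma not_null_one [simp]: "\<not> null (\<lambda>_. 1)"
  using proper by (simp add: null_def)

lemma null_zero [simp]: "null (\<lambda>_. 0)"
  by (simp add: null_def)

lemma null_mult_left: "null f \<Longrightarrow> null (\<lambda>s. g s * f s)"
  by (simp add: null_mult_iff)

lemma null_add:
  assumes "null f" "null g"
  shows "null (\<lambda>s. f s + g s)"
  using assms unfolding null_def by eventually_elim simp

lemma null_diff:
  assumes "null f" "null g"
  shows "null (\<lambda>s. f s - g s)"
  using assms unfolding null_def by eventually_elim simp

lemma null_sum: "(\<And>i. i \<in> I \<Longrightarrow> null (f i)) \<Longrightarrow> null (\<lambda>s. \<Sum>i\<in>I. f i s)"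
  by (induction I rule: infinite_finite_induct) (auto intro: null_add)

text \<open>
  Exactly the condition under which the derivation is well defined on the field generated by the
  coordinates of the point.
\<close>

definition tangent_field :: "(nat \<Rightarrow> 'p \<Rightarrow> 'k::field) \<Rightarrow> (nat \<Rightarrow> 'p \<Rightarrow> 'k) \<Rightarrow> nat \<Rightarrow> bool" where
  "tangent_field x \<xi> n \<longleftrightarrow> (\<forall>f f'. (f, f') \<in> tangent_pairs x \<xi> n \<longrightarrow> null f \<longrightarrow> null f')"

lemma tangent_fieldD:
  "tangent_field x \<xi> n \<Longrightarrow> (f, f') \<in> tangent_pairs x \<xi> n \<Longrightarrow> null f \<Longrightarrow> null f'"
  by (auto simp: tangent_field_def)

lemma tangent_field_unique:
  assumes "tangent_field x \<xi> n" "(f, f') \<in> tangent_pairs x \<xi> n" "(g, g') \<in> tangent_pairs x \<xi> n"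
    and "null (\<lambda>s. f s - g s)"
  shows "null (\<lambda>s. f' s - g' s)"
  using tangent_fieldD[OF assms(1) tangent_pairs.add[OF assms(2) tangent_pairs_uminus[OF assms(3)]]] assms(4)
  by simp

lemma tangent_field_cong:
  "tangent_field x \<xi> n \<Longrightarrow> (\<And>i. i < n \<Longrightarrow> \<xi> i = \<eta> i) \<Longrightarrow> tangent_field x \<eta> n"
  unfolding tangent_field_def using tangent_pairs_cong[of _ _ x \<eta> n \<xi>] by fastforce

lemma tangent_field_combine:
  assumes "tangent_field x \<xi> n" "tangent_field x \<eta> n"
  shows "tangent_field x (\<lambda>i s. a s * \<xi> i s + b s * \<eta> i s) n"
  unfolding tangent_field_def
proof (intro allI impI)
  fix f f' assume "(f, f') \<in> tangent_pairs x (\<lambda>i s. a s * \<xi> i s + b s * \<eta> i s) n" "null f"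
  from tangent_pairs_combine[OF this(1)]
  obtain f1 f2 where "(f, f1) \<in> tangent_pairs x \<xi> n" "(f, f2) \<in> tangent_pairs x \<eta> n"
    and f': "f' = (\<lambda>s. a s * f1 s + b s * f2 s)"
    by blast
  then have "null f1" "null f2"
    using assms \<open>null f\<close> by (auto intro: tangent_fieldD)
  then show "null f'"
    unfolding null_def f' by eventually_elim simp
qed

lemma tangent_field_zero: "tangent_field x (\<lambda>_ _. 0) n"
proof -
  have "f' = (\<lambda>_. 0)" if "(f, f') \<in> tangent_pairs x (\<lambda>_ _. 0) n" for f f'
    using that by induction auto
  then show ?thesis
    unfolding tangent_field_def by (metis null_zero)
qed

text \<open>
  Over the field generated by the coordinates before \<open>x n\<close>; denominators are cleared, so the leading
  coefficient is only required to be nonzero at the point.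
\<close>

definition algebraic :: "(nat \<Rightarrow> 'p \<Rightarrow> 'k::field) \<Rightarrow> nat \<Rightarrow> bool" where
  "algebraic x n \<longleftrightarrow> (\<exists>\<nu> F. (\<forall>i\<le>\<nu>. F i \<in> pol x n) \<and> \<not> null (F \<nu>) \<and>
     null (\<lambda>s. \<Sum>i\<le>\<nu>. F i s * x n s ^ i))"

end

section \<open>Extending tangent fields by one coordinate\<close>

text \<open>
  Polynomials in \<open>x n\<close> over the functions of the preceding coordinates, together with the polynomials
  obtained by deriving the coefficients. A polynomial with varying coefficients is stored as a
  function of the point, so that at each point it has coefficients in a field.
\<close>

definition poly_pairs ::
  "(nat \<Rightarrow> 'p \<Rightarrow> 'k::field) \<Rightarrow> (nat \<Rightarrow> 'p \<Rightarrow> 'k) \<Rightarrow> nat \<Rightarrow> (('p \<Rightarrow> 'k poly) \<times> ('p \<Rightarrow> 'k poly)) set"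
  where "poly_pairs x \<xi> n = {(Q, Q'). (\<exists>D. \<forall>s. degree (Q s) \<le> D \<and> degree (Q' s) \<le> D) \<and>
     (\<forall>i. (\<lambda>s. coeff (Q s) i, \<lambda>s. coeff (Q' s) i) \<in> tangent_pairs x \<xi> n)}"

text \<open>
  The chain rule for the derivative of \<open>Q(x n)\<close>.
\<close>

definition poly_deriv ::
  "(nat \<Rightarrow> 'p \<Rightarrow> 'k::field) \<Rightarrow> (nat \<Rightarrow> 'p \<Rightarrow> 'k) \<Rightarrow> nat \<Rightarrow> ('p \<Rightarrow> 'k poly) \<Rightarrow> ('p \<Rightarrow> 'k poly) \<Rightarrow> 'p \<Rightarrow> 'k"
  where "poly_deriv x \<xi> n Q Q' s = poly (Q' s) (x n s) + poly (pderiv (Q s)) (x n s) * \<xi> n s"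

lemma poly_pairsI:
  assumes "\<And>s. degree (Q s) \<le> D" "\<And>s. degree (Q' s) \<le> D'"
    and "\<And>i. (\<lambda>s. coeff (Q s) i, \<lambda>s. coeff (Q' s) i) \<in> tangent_pairs x \<xi> n"
  shows "(Q, Q') \<in> poly_pairs x \<xi> n"
  unfolding poly_pairs_def using assms
  by (auto intro!: exI[of _ "max D D'"] simp: le_max_iff_disj)

lemma poly_pairs_coeff:
  "(Q, Q') \<in> poly_pairs x \<xi> n \<Longrightarrow> (\<lambda>s. coeff (Q s) i, \<lambda>s. coeff (Q' s) i) \<in> tangent_pairs x \<xi> n"
  by (simp add: poly_pairs_def)

lemma poly_pairs_degree:
  assumes "(Q, Q') \<in> poly_pairs x \<xi> n"
  obtains D where "\<And>s. degree (Q s) \<le> D" "\<And>s. degree (Q' s) \<le> D"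
  using assms by (auto simp: poly_pairs_def)

lemma poly_pairs_monom:
  assumes "(f, f') \<in> tangent_pairs x \<xi> n"
  shows "(\<lambda>s. monom (f s) j, \<lambda>s. monom (f' s) j) \<in> poly_pairs x \<xi> n"
proof (rule poly_pairsI)
  fix i
  show "(\<lambda>s. coeff (monom (f s) j) i, \<lambda>s. coeff (monom (f' s) j) i) \<in> tangent_pairs x \<xi> n"
    using assms by (cases "i = j") (auto intro: tangent_pairs.const)
qed (rule degree_monom_le)+

lemma poly_pairs_add:
  assumes "(P, P') \<in> poly_pairs x \<xi> n" "(Q, Q') \<in> poly_pairs x \<xi> n"
  shows "(\<lambda>s. P s + Q s, \<lambda>s. P' s + Q' s) \<in> poly_pairs x \<xi> n"
proof -
  obtain D E where "\<And>s. degree (P s) \<le> D" "\<And>s. degree (P' s) \<le> D"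
    "\<And>s. degree (Q s) \<le> E" "\<And>s. degree (Q' s) \<le> E"
    using assms by (metis poly_pairs_degree)
  then show ?thesis
    by (intro poly_pairsI[of _ "max D E" _ "max D E"])
      (auto intro!: degree_add_le tangent_pairs.add poly_pairs_coeff assms
        intro: max.coboundedI1 max.coboundedI2)
qed

lemma poly_pairs_mult:
  assumes "(P, P') \<in> poly_pairs x \<xi> n" "(Q, Q') \<in> poly_pairs x \<xi> n"
  shows "(\<lambda>s. P s * Q s, \<lambda>s. P' s * Q s + P s * Q' s) \<in> poly_pairs x \<xi> n"
proof -
  obtain D E where D: "\<And>s. degree (P s) \<le> D" "\<And>s. degree (P' s) \<le> D"
    and E: "\<And>s. degree (Q s) \<le> E" "\<And>s. degree (Q' s) \<le> E"
    using assms by (metis poly_pairs_degree)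
  show ?thesis
  proof (rule poly_pairsI)
    show "degree (P s * Q s) \<le> D + E" for s
      using D E by (meson degree_mult_le add_mono order_trans)
    show "degree (P' s * Q s + P s * Q' s) \<le> D + E" for s
      using D E by (intro degree_add_le) (meson degree_mult_le add_mono order_trans)+
    fix i
    have "(\<lambda>s. \<Sum>j\<le>i. coeff (P s) j * coeff (Q s) (i - j),
           \<lambda>s. \<Sum>j\<le>i. coeff (P' s) j * coeff (Q s) (i - j) + coeff (P s) j * coeff (Q' s) (i - j))
        \<in> tangent_pairs x \<xi> n"
      by (intro tangent_pairs_sum tangent_pairs.mult poly_pairs_coeff assms)
    then show "(\<lambda>s. coeff (P s * Q s) i, \<lambda>s. coeff (P' s * Q s + P s * Q' s) i) \<in> tangent_pairs x \<xi> n"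
      by (simp add: coeff_mult sum.distrib)
  qed
qed

lemma poly_deriv_mult:
  "poly_deriv x \<xi> n (\<lambda>s. P s * Q s) (\<lambda>s. P' s * Q s + P s * Q' s) s =
    poly_deriv x \<xi> n P P' s * poly (Q s) (x n s) + poly (P s) (x n s) * poly_deriv x \<xi> n Q Q' s"
  by (simp add: poly_deriv_def pderiv_mult algebra_simps)

lemma poly_deriv_add:
  "poly_deriv x \<xi> n (\<lambda>s. P s + Q s) (\<lambda>s. P' s + Q' s) s =
    poly_deriv x \<xi> n P P' s + poly_deriv x \<xi> n Q Q' s"
  by (simp add: poly_deriv_def pderiv_add algebra_simps)

lemma tangent_pairs_Suc_expand:
  assumes "(f, f') \<in> tangent_pairs x \<xi> (Suc n)"
  shows "\<exists>Q Q'. (Q, Q') \<in> poly_pairs x \<xi> n \<and> f = (\<lambda>s. poly (Q s) (x n s)) \<and> f' = poly_deriv x \<xi> n Q Q'"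
  using assms
proof induction
  case (const c)
  have "(\<lambda>s. monom c 0, \<lambda>s. monom 0 0) \<in> poly_pairs x \<xi> n"
    by (intro poly_pairs_monom tangent_pairs.const)
  then show ?case
    by (intro exI[of _ "\<lambda>s. monom c 0"] exI[of _ "\<lambda>s. monom 0 0"])
      (auto simp: poly_deriv_def pderiv_monom poly_monom fun_eq_iff)
next
  case (var i)
  show ?case
  proof (cases "i = n")
    case True
    have "(\<lambda>s. monom 1 1, \<lambda>s. monom 0 1) \<in> poly_pairs x \<xi> n"
      by (intro poly_pairs_monom tangent_pairs.const)
    with True show ?thesis
      by (intro exI[of _ "\<lambda>s. monom 1 1"] exI[of _ "\<lambda>s. monom 0 1"])
        (auto simp: poly_deriv_def pderiv_monom poly_monom fun_eq_iff)
  next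
    case False
    then have "(x i, \<xi> i) \<in> tangent_pairs x \<xi> n"
      using var by (intro tangent_pairs.var) simp
    then show ?thesis
      using poly_pairs_monom[of "x i" "\<xi> i" x \<xi> n 0]
      by (intro exI[of _ "\<lambda>s. monom (x i s) 0"] exI[of _ "\<lambda>s. monom (\<xi> i s) 0"])
        (auto simp: poly_deriv_def pderiv_monom poly_monom fun_eq_iff)
  qed
next
  case (add f f' g g')
  then obtain P P' Q Q' where "(P, P') \<in> poly_pairs x \<xi> n" "f = (\<lambda>s. poly (P s) (x n s))" "f' = poly_deriv x \<xi> n P P'"
    "(Q, Q') \<in> poly_pairs x \<xi> n" "g = (\<lambda>s. poly (Q s) (x n s))" "g' = poly_deriv x \<xi> n Q Q'"
    by blast
  then show ?case
    by (intro exI[of _ "\<lambda>s. P s + Q s"] exI[of _ "\<lambda>s. P' s + Q' s"])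
      (simp add: poly_pairs_add poly_deriv_add fun_eq_iff)
next
  case (mult f f' g g')
  then obtain P P' Q Q' where "(P, P') \<in> poly_pairs x \<xi> n" "f = (\<lambda>s. poly (P s) (x n s))" "f' = poly_deriv x \<xi> n P P'"
    "(Q, Q') \<in> poly_pairs x \<xi> n" "g = (\<lambda>s. poly (Q s) (x n s))" "g' = poly_deriv x \<xi> n Q Q'"
    by blast
  then show ?case
    by (intro exI[of _ "\<lambda>s. P s * Q s"] exI[of _ "\<lambda>s. P' s * Q s + P s * Q' s"])
      (simp add: poly_pairs_mult poly_deriv_mult fun_eq_iff)
qed

lemma poly_pairs_exist:
  assumes "\<And>s. degree (F s) \<le> \<nu>" "\<And>i. (\<lambda>s. coeff (F s) i) \<in> pol x n"
  shows "\<exists>F'. (F, F') \<in> poly_pairs x \<xi> n"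
proof -
  have "\<forall>i. \<exists>g. (\<lambda>s. coeff (F s) i, g) \<in> tangent_pairs x \<xi> n"
    using tangent_pairs_exist[OF assms(2)] by blast
  from choice[OF this] obtain g where g: "\<And>i. (\<lambda>s. coeff (F s) i, g i) \<in> tangent_pairs x \<xi> n"
    by blast
  define F' where "F' = (\<lambda>s. \<Sum>i\<le>\<nu>. monom (g i s) i)"
  have F': "coeff (F' s) i = (if i \<le> \<nu> then g i s else 0)" for s i
    by (simp add: F'_def coeff_sum)
  have "(F, F') \<in> poly_pairs x \<xi> n"
  proof (rule poly_pairsI)
    show "degree (F' s) \<le> \<nu>" for s
      unfolding F'_def by (intro degree_sum_le) (auto intro: order_trans[OF degree_monom_le])
    fix i
    have "coeff (F s) i = 0" if "\<not> i \<le> \<nu>" for s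
      using that assms(1)[of s] by (intro coeff_eq_0) simp
    then show "(\<lambda>s. coeff (F s) i, \<lambda>s. coeff (F' s) i) \<in> tangent_pairs x \<xi> n"
      using g[of i] by (cases "i \<le> \<nu>") (auto simp: F' intro: tangent_pairs.const)
  qed (rule assms)
  then show ?thesis by blast
qed

lemma poly_value_in_pol:
  assumes "\<And>s. degree (Q s) \<le> D" "\<And>i. (\<lambda>s. coeff (Q s) i) \<in> pol x m" "n < m"
  shows "(\<lambda>s. poly (Q s) (x n s)) \<in> pol x m"
proof -
  have "poly (Q s) (x n s) = (\<Sum>i\<le>D. coeff (Q s) i * x n s ^ i)" for s
    unfolding poly_altdef using assms(1)[of s]
    by (intro sum.mono_neutral_left) (auto simp: coeff_eq_0)
  then show ?thesis
    using assms(2,3) by (auto intro!: pol_closed)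
qed

lemma poly_deriv_in_pol:
  assumes "(Q, Q') \<in> poly_pairs x \<xi> n" "\<And>l. l < n \<Longrightarrow> \<xi> l \<in> pol x m" "\<xi> n \<in> pol x m" "n < m"
  shows "poly_deriv x \<xi> n Q Q' \<in> pol x m"
proof -
  obtain D where D: "\<And>s. degree (Q s) \<le> D" "\<And>s. degree (Q' s) \<le> D"
    using assms(1) by (rule poly_pairs_degree) blast
  have "(\<lambda>s. coeff (Q s) i) \<in> pol x m" for i
    using tangent_pairs_pol[OF poly_pairs_coeff[OF assms(1)]] less_imp_le[OF assms(4)] by (rule pol_mono)
  moreover have "degree (pderiv (Q s)) \<le> D" for s
  proof (rule degree_le, intro allI impI)
    fix i assume "i > D"
    then have "coeff (Q s) (Suc i) = 0"
      using D(1)[of s] by (intro coeff_eq_0) simp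
    then show "coeff (pderiv (Q s)) i = 0"
      by (simp add: coeff_pderiv)
  qed
  ultimately have 1: "(\<lambda>s. poly (pderiv (Q s)) (x n s)) \<in> pol x m"
    by (intro poly_value_in_pol[of _ D] assms) (auto simp: coeff_pderiv intro!: pol_closed)
  have "(\<lambda>s. coeff (Q' s) i) \<in> pol x m" for i
    using tangent_pairs_pol_snd[OF poly_pairs_coeff[OF assms(1)], of m i] assms(2,4) by auto
  then have 2: "(\<lambda>s. poly (Q' s) (x n s)) \<in> pol x m"
    using D(2) by (intro poly_value_in_pol[of _ D] assms)
  show ?thesis
    unfolding poly_deriv_def[abs_def] by (intro pol.intros 1 2 assms)
qed

context ultrafilter
begin

text \<open>
  Same relations as in \<open>algebraic\<close>, with a polynomial instead of a family of coefficients and without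
  condition on the leading coefficient.
\<close>

definition relation :: "(nat \<Rightarrow> 'p \<Rightarrow> 'k::field) \<Rightarrow> nat \<Rightarrow> nat \<Rightarrow> ('p \<Rightarrow> 'k poly) \<Rightarrow> bool" where
  "relation x n \<nu> F \<longleftrightarrow> (\<forall>s. degree (F s) \<le> \<nu>) \<and> (\<forall>i. (\<lambda>s. coeff (F s) i) \<in> pol x n) \<and>
     null (\<lambda>s. poly (F s) (x n s))"

lemma relation_trivial:
  assumes "\<And>\<mu> G. \<mu> \<le> \<nu> \<Longrightarrow> relation x n \<mu> G \<Longrightarrow> null (\<lambda>s. coeff (G s) \<mu>)" "relation x n \<nu> F"
  shows "null (\<lambda>s. coeff (F s) i)"
  using assms
proof (induction \<nu> arbitrary: F i)
  case 0
  then have "null (\<lambda>s. coeff (F s) 0)"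
    by blast
  moreover have "coeff (F s) i = 0" if "i > 0" for s
    using that 0(2) by (auto simp: relation_def intro: coeff_eq_0)
  ultimately show ?case
    by (cases "i = 0") auto
next
  case (Suc \<nu>)
  define G where "G = (\<lambda>s. F s - monom (coeff (F s) (Suc \<nu>)) (Suc \<nu>))"
  have lead: "null (\<lambda>s. coeff (F s) (Suc \<nu>))"
    using Suc.prems by blast
  have G: "coeff (G s) i = (if i = Suc \<nu> then 0 else coeff (F s) i)" for i s
    by (simp add: G_def)
  have "relation x n \<nu> G"
    unfolding relation_def
  proof (intro conjI allI)
    fix s
    have "degree (F s) \<le> Suc \<nu>"
      using Suc.prems(2) by (simp add: relation_def)
    then have "coeff (G s) i = 0" if "i > \<nu>" for i
      using that by (cases "i = Suc \<nu>") (auto simp: G intro: coeff_eq_0)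
    then show "degree (G s) \<le> \<nu>"
      by (simp add: degree_le)
  next
    show "(\<lambda>s. coeff (G s) i) \<in> pol x n" for i
      using Suc.prems(2) by (cases "i = Suc \<nu>") (auto simp: relation_def G intro: pol.const)
    have "null (\<lambda>s. poly (F s) (x n s))"
      using Suc.prems(2) by (simp add: relation_def)
    with lead show "null (\<lambda>s. poly (G s) (x n s))"
      unfolding null_def by eventually_elim (simp add: G_def)
  qed
  then have "null (\<lambda>s. coeff (G s) i)"
    using Suc.IH[of G i] Suc.prems(1) by simp
  then show ?case
    using lead by (cases "i = Suc \<nu>") (auto simp: G)
qed

lemma algebraic_iff_relation:
  "algebraic x n \<longleftrightarrow> (\<exists>\<nu> F. relation x n \<nu> F \<and> \<not> null (\<lambda>s. coeff (F s) \<nu>))"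
proof
  assume "algebraic x n"
  then obtain \<nu> F where F: "\<And>i. i \<le> \<nu> \<Longrightarrow> F i \<in> pol x n" "\<not> null (F \<nu>)"
    "null (\<lambda>s. \<Sum>i\<le>\<nu>. F i s * x n s ^ i)"
    unfolding algebraic_def by blast
  define G where "G = (\<lambda>s. \<Sum>i\<le>\<nu>. monom (F i s) i)"
  have G: "coeff (G s) i = (if i \<le> \<nu> then F i s else 0)" for s i
    by (simp add: G_def coeff_sum)
  have "degree (G s) \<le> \<nu>" for s
    unfolding G_def by (intro degree_sum_le) (auto intro: order_trans[OF degree_monom_le])
  moreover have "(\<lambda>s. coeff (G s) i) \<in> pol x n" for i
    using F(1) by (cases "i \<le> \<nu>") (auto simp: G intro: pol.const)
  ultimately have "relation x n \<nu> G \<and> \<not> null (\<lambda>s. coeff (G s) \<nu>)"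
    using F(2,3) by (simp add: relation_def G) (simp add: G_def poly_sum poly_monom)
  then show "\<exists>\<nu> F. relation x n \<nu> F \<and> \<not> null (\<lambda>s. coeff (F s) \<nu>)"
    by blast
next
  assume "\<exists>\<nu> F. relation x n \<nu> F \<and> \<not> null (\<lambda>s. coeff (F s) \<nu>)"
  then obtain \<nu> F where F: "relation x n \<nu> F" "\<not> null (\<lambda>s. coeff (F s) \<nu>)"
    by blast
  have "poly (F s) (x n s) = (\<Sum>i\<le>\<nu>. coeff (F s) i * x n s ^ i)" for s
    unfolding poly_altdef using F(1)
    by (intro sum.mono_neutral_left) (auto simp: relation_def coeff_eq_0)
  then show "algebraic x n"
    unfolding algebraic_def using F
    by (intro exI[of _ \<nu>] exI[of _ "\<lambda>i s. coeff (F s) i"]) (simp add: relation_def)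
qed

lemma poly_deriv_null:
  assumes \<xi>: "tangent_field x \<xi> n" and Q: "(Q, Q') \<in> poly_pairs x \<xi> n"
    and null: "\<And>i. null (\<lambda>s. coeff (Q s) i)"
  shows "null (poly_deriv x \<xi> n Q Q')"
proof -
  obtain D where D: "\<And>s. degree (Q s) \<le> D" "\<And>s. degree (Q' s) \<le> D"
    using Q by (rule poly_pairs_degree) blast
  have "null (\<lambda>s. coeff (Q' s) i)" for i
    using tangent_fieldD[OF \<xi> poly_pairs_coeff[OF Q] null] .
  then have "eventually (\<lambda>s. \<forall>i\<in>{..D}. coeff (Q s) i = 0 \<and> coeff (Q' s) i = 0) U"
    using null by (auto simp: null_def eventually_ball_finite_distrib intro: eventually_conj)
  then show ?thesis
    unfolding null_def
  proof eventually_elim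
    case (elim s)
    have "Q s = 0" "Q' s = 0"
      using elim D[of s] by (metis atMost_iff leading_coeff_0_iff)+
    then show ?case
      by (simp add: poly_deriv_def)
  qed
qed

text \<open>
  A polynomial in \<open>x n\<close> that vanishes at the point has vanishing coefficients, and the derivative of
  those vanishes already. So \<open>\<xi> n\<close> may be anything.
\<close>

lemma tangent_field_extend_transcendental:
  assumes \<xi>: "tangent_field x \<xi> n" and n: "\<not> algebraic x n"
  shows "tangent_field x \<xi> (Suc n)"
  unfolding tangent_field_def
proof (intro allI impI)
  fix f f' assume "(f, f') \<in> tangent_pairs x \<xi> (Suc n)" and f: "null f"
  from tangent_pairs_Suc_expand[OF this(1)] obtain Q Q' where
    Q: "(Q, Q') \<in> poly_pairs x \<xi> n" "f = (\<lambda>s. poly (Q s) (x n s))" "f' = poly_deriv x \<xi> n Q Q'"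
    by blast
  obtain D where D: "\<And>s. degree (Q s) \<le> D"
    using Q(1) by (rule poly_pairs_degree) blast
  have "relation x n D Q"
    using D f Q(2) tangent_pairs_pol[OF poly_pairs_coeff[OF Q(1)]] by (auto simp: relation_def)
  moreover have "null (\<lambda>s. coeff (G s) \<mu>)" if "relation x n \<mu> G" for \<mu> G
    using n that unfolding algebraic_iff_relation by blast
  ultimately have "null (\<lambda>s. coeff (Q s) i)" for i
    using relation_trivial by blast
  then show "null f'"
    unfolding Q(3) using \<xi> Q(1) by (intro poly_deriv_null)
qed

text \<open>
  The only obstruction is the derivative of a relation \<open>F\<close> of minimal degree: any other polynomial \<open>Q\<close>
  with \<open>Q(x n) = 0\<close> is, up to the leading coefficient of \<open>F\<close>, a multiple of \<open>F\<close> plus a polynomial of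
  smaller degree, and by minimality the division ends with vanishing coefficients.
\<close>

lemma tangent_field_extend_algebraic:
  assumes \<xi>: "tangent_field x \<xi> n"
    and F: "relation x n \<nu> F" "\<not> null (\<lambda>s. coeff (F s) \<nu>)"
    and minimal: "\<And>\<mu> G. \<mu> < \<nu> \<Longrightarrow> relation x n \<mu> G \<Longrightarrow> null (\<lambda>s. coeff (G s) \<mu>)"
    and F': "(F, F') \<in> poly_pairs x \<xi> n" "null (poly_deriv x \<xi> n F F')"
  shows "tangent_field x \<xi> (Suc n)"
proof -
  have \<nu>: "\<nu> > 0"
  proof (rule ccontr)
    assume "\<not> \<nu> > 0"
    then have "degree (F s) = 0" for s
      using F(1) by (simp add: relation_def)
    then have "poly (F s) (x n s) = coeff (F s) 0" for s
      by (simp add: poly_altdef)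
    then show False
      using F \<open>\<not> \<nu> > 0\<close> by (simp add: relation_def)
  qed
  have key: "null (poly_deriv x \<xi> n Q Q')"
    if "(Q, Q') \<in> poly_pairs x \<xi> n" "\<And>s. degree (Q s) \<le> D" "null (\<lambda>s. poly (Q s) (x n s))" for D Q Q'
    using that
  proof (induction D arbitrary: Q Q' rule: less_induct)
    case (less D)
    show ?case
    proof (cases "D < \<nu>")
      case True
      have "relation x n D Q"
        using less.prems tangent_pairs_pol[OF poly_pairs_coeff[OF less.prems(1)]] by (auto simp: relation_def)
      moreover have "null (\<lambda>s. coeff (G s) \<mu>)" if "\<mu> \<le> D" "relation x n \<mu> G" for \<mu> G
        using minimal that True by (meson le_less_trans)
      ultimately have "null (\<lambda>s. coeff (Q s) i)" for i
        using relation_trivial by blast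
      then show ?thesis
        using \<xi> less.prems(1) by (intro poly_deriv_null)
    next
      case False
      define c where "c = (\<lambda>s. coeff (Q s) D)"
      define a where "a = (\<lambda>s. coeff (F s) \<nu>)"
      obtain c' a' where c': "(c, c') \<in> tangent_pairs x \<xi> n" and a': "(a, a') \<in> tangent_pairs x \<xi> n"
        using poly_pairs_coeff[OF less.prems(1)] poly_pairs_coeff[OF F'(1)] unfolding c_def a_def by blast
      define A where "A = (\<lambda>s. monom (a s) 0)"
      define A' where "A' = (\<lambda>s. monom (a' s) 0)"
      define M where "M = (\<lambda>s. monom (- c s) (D - \<nu>))"
      define M' where "M' = (\<lambda>s. monom (- c' s) (D - \<nu>))"
      have A: "(A, A') \<in> poly_pairs x \<xi> n" and M: "(M, M') \<in> poly_pairs x \<xi> n"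
        unfolding A_def A'_def M_def M'_def
        by (intro poly_pairs_monom tangent_pairs_uminus a' c')+
      \<comment> \<open>One step of the division of \<open>Q\<close> by \<open>F\<close>.\<close>
      define R where "R = (\<lambda>s. A s * Q s + M s * F s)"
      define R' where "R' = (\<lambda>s. (A' s * Q s + A s * Q' s) + (M' s * F s + M s * F' s))"
      have R: "(R, R') \<in> poly_pairs x \<xi> n"
        unfolding R_def R'_def by (intro poly_pairs_add poly_pairs_mult A M less.prems F')
      have "coeff (R s) i = 0" if "i > D - 1" for i s
      proof (cases "i = D")
        case True
        then show ?thesis
          using False by (simp add: R_def A_def M_def coeff_monom_mult c_def a_def)
      next
        case i: False
        then have "i > D"
          using that by simp
        moreover have "degree (F s) \<le> \<nu>"
          using F(1) by (simp add: relation_def)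
        ultimately have "coeff (Q s) i = 0" "coeff (F s) (i - (D - \<nu>)) = 0"
          using less.prems(2)[of s] False by (auto intro!: coeff_eq_0)
        then show ?thesis
          by (simp add: R_def A_def M_def coeff_monom_mult)
      qed
      then have "degree (R s) \<le> D - 1" for s
        by (simp add: degree_le)
      moreover have zero: "null (\<lambda>s. poly (F s) (x n s))" "null (\<lambda>s. poly (Q s) (x n s))"
        using F less.prems by (auto simp: relation_def)
      then have "null (\<lambda>s. poly (R s) (x n s))"
        unfolding null_def by eventually_elim (simp add: R_def)
      ultimately have "null (poly_deriv x \<xi> n R R')"
        using less.IH[of "D - 1" R R'] R \<nu> False by simp
      then have "null (\<lambda>s. a s * poly_deriv x \<xi> n Q Q' s)"
        using zero F'(2) unfolding null_def
      proof eventually_elim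
        case (elim s)
        then have "poly (A s) (x n s) * poly_deriv x \<xi> n Q Q' s = 0"
          by (simp add: R_def R'_def poly_deriv_add poly_deriv_mult)
        then show ?case
          by (simp add: A_def poly_monom)
      qed
      then show ?thesis
        using F(2) by (simp add: null_mult_iff a_def)
    qed
  qed
  show ?thesis
    unfolding tangent_field_def
  proof (intro allI impI)
    fix f f' assume "(f, f') \<in> tangent_pairs x \<xi> (Suc n)" and f: "null f"
    from tangent_pairs_Suc_expand[OF this(1)] obtain Q Q' where
      Q: "(Q, Q') \<in> poly_pairs x \<xi> n" "f = (\<lambda>s. poly (Q s) (x n s))" "f' = poly_deriv x \<xi> n Q Q'"
      by blast
    obtain D where "\<And>s. degree (Q s) \<le> D"
      using Q(1) by (rule poly_pairs_degree) blast
    then show "null f'"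
      using key Q f by blast
  qed
qed

text \<open>
  The obstruction in \<open>tangent_field_extend_algebraic\<close> is linear in the vector field, so it can be cancelled by
  a combination of two fields.
\<close>

lemma poly_deriv_combine:
  assumes \<xi>: "tangent_field x \<xi> n" and \<eta>: "tangent_field x \<eta> n"
    and F1: "(F, F1) \<in> poly_pairs x \<xi> n" and F2: "(F, F2) \<in> poly_pairs x \<eta> n"
    and F': "(F, F') \<in> poly_pairs x (\<lambda>i s. a s * \<xi> i s + b s * \<eta> i s) n"
  shows "null (\<lambda>s. poly_deriv x (\<lambda>i s. a s * \<xi> i s + b s * \<eta> i s) n F F' s
    - (a s * poly_deriv x \<xi> n F F1 s + b s * poly_deriv x \<eta> n F F2 s))"
proof -
  obtain D1 D2 D3 where D: "\<And>s. degree (F1 s) \<le> D1" "\<And>s. degree (F2 s) \<le> D2" "\<And>s. degree (F' s) \<le> D3"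
    using assms(3-5) by (metis poly_pairs_degree)
  define D where "D = max D1 (max D2 D3)"
  have "null (\<lambda>s. coeff (F' s) i - (a s * coeff (F1 s) i + b s * coeff (F2 s) i))" for i
  proof -
    from tangent_pairs_combine[OF poly_pairs_coeff[OF F', of i]] obtain g1 g2 where
      g: "(\<lambda>s. coeff (F s) i, g1) \<in> tangent_pairs x \<xi> n" "(\<lambda>s. coeff (F s) i, g2) \<in> tangent_pairs x \<eta> n"
      "(\<lambda>s. coeff (F' s) i) = (\<lambda>s. a s * g1 s + b s * g2 s)"
      by blast
    have "null (\<lambda>s. g1 s - coeff (F1 s) i)" "null (\<lambda>s. g2 s - coeff (F2 s) i)"
      using tangent_field_unique[OF \<xi> g(1) poly_pairs_coeff[OF F1]]
        tangent_field_unique[OF \<eta> g(2) poly_pairs_coeff[OF F2]] by auto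
    then show ?thesis
      unfolding null_def
    proof eventually_elim
      case (elim s)
      then show ?case
        using fun_cong[OF g(3), of s] by simp
    qed
  qed
  then have "eventually (\<lambda>s. \<forall>i\<in>{..D}. coeff (F' s) i - (a s * coeff (F1 s) i + b s * coeff (F2 s) i) = 0) U"
    by (simp add: null_def eventually_ball_finite_distrib)
  then show ?thesis
    unfolding null_def
  proof eventually_elim
    case (elim s)
    have "F' s = smult (a s) (F1 s) + smult (b s) (F2 s)"
    proof (rule poly_eqI)
      fix i
      show "coeff (F' s) i = coeff (smult (a s) (F1 s) + smult (b s) (F2 s)) i"
      proof (cases "i \<le> D")
        case False
        then have "coeff (F' s) i = 0" "coeff (F1 s) i = 0" "coeff (F2 s) i = 0"
          using D[of s] unfolding D_def by (metis coeff_eq_0 le_less_trans max_less_iff_conj not_le)+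
        then show ?thesis by simp
      qed (use elim in simp)
    qed
    then show ?case
      by (simp add: poly_deriv_def algebra_simps)
  qed
qed

text \<open>
  The fields \<open>\<xi> i\<close>, for \<open>i\<close> outside \<open>J\<close>, are in echelon form: on the coordinates outside \<open>J\<close> the field
  \<open>\<xi> i\<close> is \<open>\<Delta>\<close> times the \<open>i\<close>-th unit vector. Fields vanish on the first \<open>n0\<close> coordinates, which are
  parameters. Tangency is recorded for the first \<open>m\<close> coordinates only, because a new coordinate is
  added before the fields are corrected.
\<close>

definition frame ::
  "(nat \<Rightarrow> 'p \<Rightarrow> 'k::field) \<Rightarrow> nat \<Rightarrow> nat \<Rightarrow> nat \<Rightarrow> nat set \<Rightarrow> ('p \<Rightarrow> 'k) \<Rightarrow> (nat \<Rightarrow> nat \<Rightarrow> 'p \<Rightarrow> 'k) \<Rightarrow> bool"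
  where "frame x m n0 n J \<Delta> \<xi> \<longleftrightarrow> \<Delta> \<in> pol x n \<and> \<not> null \<Delta> \<and>
    (\<forall>i\<in>{n0..<n} - J. tangent_field x (\<xi> i) m \<and>
      (\<forall>l<m. \<xi> i l \<in> pol x m) \<and> (\<forall>l. \<xi> i l \<in> pol x n) \<and> (\<forall>l<n0. \<xi> i l = (\<lambda>_. 0)) \<and>
      (\<forall>l\<in>{n0..<n} - J. \<xi> i l = (if l = i then \<Delta> else (\<lambda>_. 0))))"

lemma frame_add_coordinate:
  assumes "frame x n n0 n J \<Delta> \<xi>" "J \<subseteq> {n0..<n}" "n0 \<le> n"
  shows "frame x n n0 (Suc n) J \<Delta> (\<lambda>i l. if i = n then if l = n then \<Delta> else (\<lambda>_. 0)
    else if l = n then (\<lambda>_. 0) else \<xi> i l)" (is "frame _ _ _ _ _ _ ?\<eta>")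
  unfolding frame_def
proof (intro conjI ballI)
  show "\<Delta> \<in> pol x (Suc n)" "\<not> null \<Delta>"
    using assms(1) by (auto simp: frame_def intro: pol_mono)
next
  fix i assume i: "i \<in> {n0..<Suc n} - J"
  have *: "\<Delta> \<in> pol x n" "\<And>l. i \<noteq> n \<Longrightarrow> \<xi> i l \<in> pol x n"
    using assms(1) i by (auto simp: frame_def)
  show "\<forall>l<n. ?\<eta> i l \<in> pol x n" "\<forall>l. ?\<eta> i l \<in> pol x (Suc n)"
    using * by (auto intro: pol.const pol_mono[OF _ le_SucI[OF order_refl]])
  show "\<forall>l<n0. ?\<eta> i l = (\<lambda>_. 0)"
    using assms(1,3) i by (auto simp: frame_def)
  show "tangent_field x (?\<eta> i) n"
  proof (cases "i = n")
    case True
    then show ?thesis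
      by (intro tangent_field_cong[OF tangent_field_zero]) auto
  next
    case False
    then have "tangent_field x (\<xi> i) n"
      using assms(1) i by (auto simp: frame_def)
    then show ?thesis
      by (rule tangent_field_cong) (use False in auto)
  qed
  show "?\<eta> i l = (if l = i then \<Delta> else (\<lambda>_. 0))" if "l \<in> {n0..<Suc n} - J" for l
    using assms(1) i that by (auto simp: frame_def)
qed

text \<open>
  Induction on the number of coordinates. A new coordinate \<open>x n\<close> brings one new field, along itself.
  If \<open>x n\<close> is transcendental, all fields stay tangent. If it is algebraic, tangency is one linear
  condition on the fields, the vanishing of the derivative \<open>u\<close> of the minimal relation. Unless the
  condition is void, one pivot \<open>j\<close> is spent to satisfy it, and \<open>j\<close> is put into \<open>J\<close>. In the separable
  case \<open>j = n\<close> is possible; in the inseparable case \<open>u n = 0\<close>, and the pivot is an earlier index or the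
  condition is void.
\<close>

theorem frame_exists:
  assumes "n0 \<le> n"
  shows "\<exists>J \<Delta> \<xi>. J \<subseteq> {n0..<n} \<and> card J \<le> card {i \<in> {n0..<n}. algebraic x i} \<and> frame x n n0 n J \<Delta> \<xi>"
  using assms
proof (induction n rule: dec_induct)
  case base
  show ?case
    by (intro exI[of _ "{}"] exI[of _ "\<lambda>_. 1"]) (simp add: frame_def pol.const)
next
  case (step n)
  then obtain J \<Delta> \<zeta> where J: "J \<subseteq> {n0..<n}" "card J \<le> card {i \<in> {n0..<n}. algebraic x i}"
    and "frame x n n0 n J \<Delta> \<zeta>"
    by blast
  from frame_add_coordinate[OF this(3,1) step(1)] obtain \<xi> where \<xi>: "frame x n n0 (Suc n) J \<Delta> \<xi>"
    by blast
  have J': "J \<subseteq> {n0..<Suc n}"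
    using J(1) by auto
  have card_split: "card {i \<in> {n0..<Suc n}. algebraic x i} =
      card {i \<in> {n0..<n}. algebraic x i} + (if algebraic x n then 1 else 0)"
  proof -
    have "{i \<in> {n0..<Suc n}. algebraic x i} =
      (if algebraic x n then insert n {i \<in> {n0..<n}. algebraic x i} else {i \<in> {n0..<n}. algebraic x i})"
      using step(1) by (auto simp: less_Suc_eq)
    then show ?thesis by simp
  qed
  have keep: ?case if "\<And>i. i \<in> {n0..<Suc n} - J \<Longrightarrow> tangent_field x (\<xi> i) (Suc n)"
  proof (intro exI conjI)
    show "frame x (Suc n) n0 (Suc n) J \<Delta> \<xi>"
      using \<xi> that by (auto simp: frame_def)
    show "card J \<le> card {i \<in> {n0..<Suc n}. algebraic x i}"
      using J(2) card_split by simp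
  qed (rule J')
  show ?case
  proof (cases "algebraic x n")
    case False
    have "tangent_field x (\<xi> i) (Suc n)" if "i \<in> {n0..<Suc n} - J" for i
      using tangent_field_extend_transcendental[OF _ False] \<xi> that by (simp add: frame_def)
    then show ?thesis
      by (rule keep)
  next
    case True
    define \<nu> where "\<nu> = (LEAST \<nu>. \<exists>F. relation x n \<nu> F \<and> \<not> null (\<lambda>s. coeff (F s) \<nu>))"
    have "\<exists>F. relation x n \<nu> F \<and> \<not> null (\<lambda>s. coeff (F s) \<nu>)"
      unfolding \<nu>_def by (rule LeastI_ex) (use True in \<open>simp add: algebraic_iff_relation\<close>)
    then obtain F where F: "relation x n \<nu> F" "\<not> null (\<lambda>s. coeff (F s) \<nu>)"
      by blast
    have minimal: "null (\<lambda>s. coeff (G s) \<mu>)" if "\<mu> < \<nu>" "relation x n \<mu> G" for \<mu> G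
      using not_less_Least[OF that(1)[unfolded \<nu>_def]] that(2) by blast
    have F_deg: "\<And>s. degree (F s) \<le> \<nu>" and F_pol: "\<And>i. (\<lambda>s. coeff (F s) i) \<in> pol x n"
      using F(1) by (auto simp: relation_def)
    have "\<forall>i. \<exists>F'. (F, F') \<in> poly_pairs x (\<xi> i) n"
      using poly_pairs_exist[of F \<nu> x n, OF F_deg F_pol] by blast
    then obtain F' where F': "\<And>i. (F, F' i) \<in> poly_pairs x (\<xi> i) n"
      by metis
    define u where "u i = poly_deriv x (\<xi> i) n F (F' i)" for i
    show ?thesis
    proof (cases "\<forall>i\<in>{n0..<Suc n} - J. null (u i)")
      case True
      have "tangent_field x (\<xi> i) (Suc n)" if "i \<in> {n0..<Suc n} - J" for i
        using tangent_field_extend_algebraic[OF _ F minimal F', of i] \<xi> that True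
        by (simp add: frame_def u_def)
      then show ?thesis
        by (rule keep)
    next
      case False
      then obtain j where j: "j \<in> {n0..<Suc n} - J" "\<not> null (u j)"
        by blast
      \<comment> \<open>The combination of \<open>\<xi> i\<close> and \<open>\<xi> j\<close> on which the obstruction cancels.\<close>
      define \<eta> where "\<eta> i = (\<lambda>l s. u j s * \<xi> i l s + (- u i s) * \<xi> j l s)" for i
      define \<Delta>' where "\<Delta>' = (\<lambda>s. u j s * \<Delta> s)"
      have u_pol: "u i \<in> pol x (Suc n)" if "i \<in> {n0..<Suc n} - J" for i
        unfolding u_def
        by (rule poly_deriv_in_pol[OF F']) (use \<xi> that in \<open>auto simp: frame_def\<close>)
      have "frame x (Suc n) n0 (Suc n) (insert j J) \<Delta>' \<eta>"
        unfolding frame_def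
      proof (intro conjI ballI)
        show "\<Delta>' \<in> pol x (Suc n)"
          unfolding \<Delta>'_def using u_pol[OF j(1)] \<xi> by (auto simp: frame_def intro: pol.mult)
        show "\<not> null \<Delta>'"
          unfolding \<Delta>'_def null_mult_iff using j(2) \<xi> by (simp add: frame_def)
      next
        fix i assume i: "i \<in> {n0..<Suc n} - insert j J"
        have pol: "\<eta> i l \<in> pol x (Suc n)" for l
          unfolding \<eta>_def using u_pol[of i] u_pol[OF j(1)] i j(1) \<xi>
          by (auto simp: frame_def intro!: pol_closed)
        then show "\<forall>l<Suc n. \<eta> i l \<in> pol x (Suc n)" "\<forall>l. \<eta> i l \<in> pol x (Suc n)"
          by auto
        show "\<forall>l<n0. \<eta> i l = (\<lambda>_. 0)"
          using \<xi> i j(1) by (simp add: frame_def \<eta>_def)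
        show "\<eta> i l = (if l = i then \<Delta>' else (\<lambda>_. 0))" if "l \<in> {n0..<Suc n} - insert j J" for l
        proof -
          have "\<xi> i l = (if l = i then \<Delta> else (\<lambda>_. 0))" "\<xi> j l = (\<lambda>_. 0)"
            using \<xi> i j(1) that unfolding frame_def by (metis (no_types) Diff_iff insert_iff)+
          then show ?thesis
            by (simp add: \<eta>_def \<Delta>'_def)
        qed
        have tf: "tangent_field x (\<xi> i) n" "tangent_field x (\<xi> j) n"
          using \<xi> i j(1) by (auto simp: frame_def)
        have "tangent_field x (\<eta> i) n"
          unfolding \<eta>_def by (rule tangent_field_combine[OF tf])
        moreover obtain G where G: "(F, G) \<in> poly_pairs x (\<eta> i) n"
          using poly_pairs_exist[of F \<nu> x n, OF F_deg F_pol] by blast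
        have "null (\<lambda>s. poly_deriv x (\<eta> i) n F G s - (u j s * u i s + (- u i s) * u j s))"
          unfolding u_def \<eta>_def
          by (rule poly_deriv_combine[OF tf F' F' G[unfolded \<eta>_def u_def]])
        then have "null (poly_deriv x (\<eta> i) n F G)"
          by (simp add: mult.commute)
        ultimately show "tangent_field x (\<eta> i) (Suc n)"
          using F minimal G by (intro tangent_field_extend_algebraic)
      qed
      moreover have "card (insert j J) \<le> card {i \<in> {n0..<Suc n}. algebraic x i}"
        using card_split True J(2) finite_subset[OF J(1)] by (simp add: card_insert_if)
      moreover have "insert j J \<subseteq> {n0..<Suc n}"
        using j(1) J' by auto
      ultimately show ?thesis
        by blast
    qed
  qed
qed

end

section \<open>Growth of polynomial functions and transcendence degree\<close>

lemma homogeneous_system_nontrivial: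
  fixes a :: "'i \<Rightarrow> nat \<Rightarrow> 'k::field"
  assumes "finite I" "r < card I"
  shows "\<exists>c. (\<exists>i\<in>I. c i \<noteq> 0) \<and> (\<forall>j<r. (\<Sum>i\<in>I. c i * a i j) = 0)"
  using assms
proof (induction r arbitrary: I a)
  case 0
  then obtain i where "i \<in> I"
    by fastforce
  then show ?case
    by (intro exI[of _ "\<lambda>_. 1"]) auto
next
  case (Suc r)
  show ?case
  proof (cases "\<forall>i\<in>I. a i r = 0")
    case True
    from Suc.IH[of I a] Suc.prems obtain c where
      "\<exists>i\<in>I. c i \<noteq> 0" "\<forall>j<r. (\<Sum>i\<in>I. c i * a i j) = 0"
      by auto
    with True show ?thesis
      by (intro exI[of _ c]) (auto simp: less_Suc_eq)
  next
    case False
    then obtain i0 where i0: "i0 \<in> I" "a i0 r \<noteq> 0"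
      by blast
    define a' where "a' i j = a i j - a i r / a i0 r * a i0 j" for i j
    have "r < card (I - {i0})"
      using Suc.prems i0 by simp
    then obtain c where c: "\<exists>i\<in>I - {i0}. c i \<noteq> 0" "\<forall>j<r. (\<Sum>i\<in>I - {i0}. c i * a' i j) = 0"
      using Suc.IH[of "I - {i0}" a'] Suc.prems by auto
    define c' where "c' = c(i0 := - (\<Sum>i\<in>I - {i0}. c i * a i r / a i0 r))"
    have "(\<Sum>i\<in>I. c' i * a i j) = (\<Sum>i\<in>I - {i0}. c i * a' i j)" for j
    proof -
      have "(\<Sum>i\<in>I. c' i * a i j) = c' i0 * a i0 j + (\<Sum>i\<in>I - {i0}. c' i * a i j)"
        using Suc.prems(1) i0(1) by (simp add: sum.remove)
      also have "(\<Sum>i\<in>I - {i0}. c' i * a i j) = (\<Sum>i\<in>I - {i0}. c i * a i j)"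
        by (intro sum.cong) (auto simp: c'_def)
      also have "c' i0 * a i0 j = - (\<Sum>i\<in>I - {i0}. c i * (a i r / a i0 r * a i0 j))"
        by (simp add: c'_def sum_distrib_right mult.assoc)
      finally show ?thesis
        by (simp add: a'_def right_diff_distrib sum_subtractf)
    qed
    moreover have "a' i r = 0" for i
      using i0(2) by (simp add: a'_def)
    ultimately have "\<forall>j<Suc r. (\<Sum>i\<in>I. c' i * a i j) = 0"
      using c(2) by (auto simp: less_Suc_eq)
    moreover have "\<exists>i\<in>I. c' i \<noteq> 0"
      using c(1) by (auto simp: c'_def)
    ultimately show ?thesis
      by blast
  qed
qed

lemma sum_div_mod:
  fixes F :: "nat \<Rightarrow> nat \<Rightarrow> 'a::comm_monoid_add"
  shows "(\<Sum>i<m. \<Sum>j<r. F i j) = (\<Sum>k<m * r. F (k div r) (k mod r))"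
proof (induction m)
  case (Suc m)
  have "(\<Sum>k<Suc m * r. F (k div r) (k mod r)) =
      (\<Sum>k<m * r. F (k div r) (k mod r)) + (\<Sum>k\<in>{m * r..<m * r + r}. F (k div r) (k mod r))"
    by (subst sum.union_disjoint[symmetric]) (auto intro!: sum.cong)
  also have "(\<Sum>k\<in>{m * r..<m * r + r}. F (k div r) (k mod r)) =
      (\<Sum>j<r. F ((m * r + j) div r) ((m * r + j) mod r))"
    by (rule sum.reindex_bij_witness[of _ "\<lambda>j. m * r + j" "\<lambda>k. k - m * r"]) auto
  also have "\<dots> = (\<Sum>j<r. F m j)"
    by (intro sum.cong) auto
  finally show ?case
    using Suc by simp
qed simp

text \<open>
  Polynomials in the first \<open>n\<close> coordinates of degree at most \<open>D\<close> in each of them.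
\<close>

primrec box :: "(nat \<Rightarrow> 'p \<Rightarrow> 'k::field) \<Rightarrow> nat \<Rightarrow> nat \<Rightarrow> ('p \<Rightarrow> 'k) set" where
  "box x 0 D = {\<lambda>_. c |c. True}"
| "box x (Suc n) D = {\<lambda>s. \<Sum>i\<le>D. g i s * x n s ^ i |g. \<forall>i. g i \<in> box x n D}"

lemma box_zero: "(\<lambda>_. 0) \<in> box x n D"
proof (induction n)
  case (Suc n)
  then show ?case
    by (auto intro!: exI[of _ "\<lambda>_ _. 0"])
qed auto

lemma box_add: "f \<in> box x n D \<Longrightarrow> g \<in> box x n D \<Longrightarrow> (\<lambda>s. f s + g s) \<in> box x n D"
proof (induction n arbitrary: f g)
  case (Suc n)
  then obtain a b where a: "f = (\<lambda>s. \<Sum>i\<le>D. a i s * x n s ^ i)" "\<And>i. a i \<in> box x n D"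
    and b: "g = (\<lambda>s. \<Sum>i\<le>D. b i s * x n s ^ i)" "\<And>i. b i \<in> box x n D"
    by auto
  then have "(\<lambda>s. f s + g s) = (\<lambda>s. \<Sum>i\<le>D. (a i s + b i s) * x n s ^ i)"
    by (simp add: sum.distrib distrib_right)
  then show ?case
    using Suc.IH a(2) b(2) by auto
qed auto

lemma box_sum: "(\<And>i. i \<in> I \<Longrightarrow> f i \<in> box x n D) \<Longrightarrow> (\<lambda>s. \<Sum>i\<in>I. f i s) \<in> box x n D"
  by (induction I rule: infinite_finite_induct) (auto intro: box_zero box_add)

lemma box_monom:
  assumes "h \<in> box x n D" "k \<le> D"
  shows "(\<lambda>s. h s * x n s ^ k) \<in> box x (Suc n) D"
proof -
  define g where "g i = (if i = k then h else (\<lambda>_. 0))" for i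
  have "(\<lambda>s. h s * x n s ^ k) = (\<lambda>s. \<Sum>i\<le>D. g i s * x n s ^ i)"
  proof
    fix s
    have "(\<Sum>i\<le>D. g i s * x n s ^ i) = (\<Sum>i\<in>{k}. g i s * x n s ^ i)"
      using assms(2) by (intro sum.mono_neutral_right) (auto simp: g_def)
    then show "h s * x n s ^ k = (\<Sum>i\<le>D. g i s * x n s ^ i)"
      by (simp add: g_def)
  qed
  moreover have "g i \<in> box x n D" for i
    using assms(1) by (simp add: g_def box_zero)
  ultimately show ?thesis
    by auto
qed

lemma box_Suc: "f \<in> box x n D \<Longrightarrow> f \<in> box x (Suc n) D"
  using box_monom[of f x n D 0] by simp

lemma box_const: "(\<lambda>_. c) \<in> box x n D"
proof (induction n)
  case (Suc n)
  then show ?case by (rule box_Suc)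
qed auto

lemma box_var: "i < n \<Longrightarrow> x i \<in> box x n 1"
proof (induction n)
  case (Suc n)
  show ?case
  proof (cases "i = n")
    case True
    then show ?thesis
      using box_monom[OF box_const[of 1 x n 1], of 1] by simp
  next
    case False
    then show ?thesis
      using Suc by (intro box_Suc) simp
  qed
qed simp

lemma box_mono: "f \<in> box x n D \<Longrightarrow> D \<le> E \<Longrightarrow> f \<in> box x n E"
proof (induction n arbitrary: f)
  case (Suc n)
  then obtain g where g: "f = (\<lambda>s. \<Sum>i\<le>D. g i s * x n s ^ i)" "\<And>i. g i \<in> box x n D"
    by auto
  show ?case
    unfolding g(1) using Suc g(2) by (intro box_sum box_monom) auto
qed simp

lemma box_mult: "f \<in> box x n D \<Longrightarrow> g \<in> box x n E \<Longrightarrow> (\<lambda>s. f s * g s) \<in> box x n (D + E)"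
proof (induction n arbitrary: f g)
  case (Suc n)
  then obtain a b where a: "f = (\<lambda>s. \<Sum>i\<le>D. a i s * x n s ^ i)" "\<And>i. a i \<in> box x n D"
    and b: "g = (\<lambda>s. \<Sum>i\<le>E. b i s * x n s ^ i)" "\<And>i. b i \<in> box x n E"
    by auto
  have "(\<lambda>s. f s * g s) = (\<lambda>s. \<Sum>i\<le>D. \<Sum>j\<le>E. (a i s * b j s) * x n s ^ (i + j))"
    by (simp add: a(1) b(1) sum_product power_add mult_ac)
  also have "\<dots> \<in> box x (Suc n) (D + E)"
    by (intro box_sum box_monom Suc.IH a(2) b(2)) auto
  finally show ?case .
qed auto

lemma box_power: "f \<in> box x n D \<Longrightarrow> (\<lambda>s. f s ^ j) \<in> box x n (j * D)"
proof (induction j)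
  case (Suc j)
  then show ?case
    using box_mult[of f x n D "\<lambda>s. f s ^ j" "j * D"] by simp
qed (simp add: box_const)

lemma box_uminus:
  assumes "f \<in> box x n D"
  shows "(\<lambda>s. - f s) \<in> box x n D"
  using box_mult[OF box_const[of "-1" x n 0] assms] by simp

lemma pol_in_box: "f \<in> pol x n \<Longrightarrow> \<exists>D. f \<in> box x n D"
proof (induction rule: pol.induct)
  case (add f g)
  then obtain D E where "f \<in> box x n D" "g \<in> box x n E"
    by blast
  then have "(\<lambda>s. f s + g s) \<in> box x n (max D E)"
    by (intro box_add) (auto intro: box_mono)
  then show ?case ..
next
  case (mult f g)
  then show ?case
    by (blast intro: box_mult)
next
  case (const c)
  show ?case
    by (intro exI[of _ 0] box_const)
next
  case (var i)
  then show ?case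
    by (intro exI[of _ 1] box_var)
qed

context ultrafilter
begin

text \<open>
  Dimension at most \<open>r\<close> at the point, with denominators cleared: after multiplication by one
  \<open>h\<close> for the whole set, \<open>r\<close> functions span. Multiplication by \<open>h\<close> is injective, so this bounds
  independent families (\<open>spanned_dependent\<close>).
\<close>

definition spanned :: "('p \<Rightarrow> 'k::field) set \<Rightarrow> nat \<Rightarrow> bool" where
  "spanned M r \<longleftrightarrow> (\<exists>h u. \<not> null h \<and> (\<forall>f\<in>M. \<exists>a. null (\<lambda>s. h s * f s - (\<Sum>j<r. a j * u j s))))"

lemma spanned_mono:
  assumes "spanned M r" "r \<le> r'"
  shows "spanned M r'"
proof -
  obtain h u where hu: "\<not> null h" "\<forall>f\<in>M. \<exists>a. null (\<lambda>s. h s * f s - (\<Sum>j<r. a j * u j s))"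
    using assms(1) unfolding spanned_def by blast
  have "\<exists>a. null (\<lambda>s. h s * f s - (\<Sum>j<r'. a j * u j s))" if f: "f \<in> M" for f
  proof -
    obtain a where a: "null (\<lambda>s. h s * f s - (\<Sum>j<r. a j * u j s))"
      using hu(2) f by blast
    have "(\<Sum>j<r'. (if j < r then a j else 0) * u j s) = (\<Sum>j<r. a j * u j s)" for s
      using assms(2) by (intro sum.mono_neutral_cong_right) auto
    with a show ?thesis
      by (intro exI[of _ "\<lambda>j. if j < r then a j else 0"]) simp
  qed
  with hu(1) show ?thesis
    unfolding spanned_def by blast
qed

lemma spanned_dependent:
  assumes "spanned M r" "finite I" "r < card I" "\<And>i. i \<in> I \<Longrightarrow> f i \<in> M"
  shows "\<exists>c. (\<exists>i\<in>I. c i \<noteq> 0) \<and> null (\<lambda>s. \<Sum>i\<in>I. c i * f i s)"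
proof -
  obtain h u where hu: "\<not> null h" "\<forall>f\<in>M. \<exists>a. null (\<lambda>s. h s * f s - (\<Sum>j<r. a j * u j s))"
    using assms(1) unfolding spanned_def by blast
  have "\<forall>i\<in>I. \<exists>a. null (\<lambda>s. h s * f i s - (\<Sum>j<r. a j * u j s))"
    using hu(2) assms(4) by blast
  from bchoice[OF this] obtain a where a: "\<forall>i\<in>I. null (\<lambda>s. h s * f i s - (\<Sum>j<r. a i j * u j s))"
    by blast
  obtain c where c: "\<exists>i\<in>I. c i \<noteq> 0" "\<forall>j<r. (\<Sum>i\<in>I. c i * a i j) = 0"
    using homogeneous_system_nontrivial[OF assms(2,3), of a] by blast
  have "eventually (\<lambda>s. \<forall>i\<in>I. h s * f i s - (\<Sum>j<r. a i j * u j s) = 0) U"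
    using a assms(2) by (simp add: null_def eventually_ball_finite_distrib)
  then have "null (\<lambda>s. h s * (\<Sum>i\<in>I. c i * f i s))"
    unfolding null_def
  proof eventually_elim
    case (elim s)
    have "h s * (\<Sum>i\<in>I. c i * f i s) = (\<Sum>i\<in>I. c i * (h s * f i s))"
      by (simp add: sum_distrib_left mult_ac)
    also have "\<dots> = (\<Sum>i\<in>I. \<Sum>j<r. c i * a i j * u j s)"
      using elim by (intro sum.cong) (auto simp: sum_distrib_left mult_ac)
    also have "\<dots> = (\<Sum>j<r. (\<Sum>i\<in>I. c i * a i j) * u j s)"
      by (subst sum.swap) (simp add: sum_distrib_right)
    also have "\<dots> = 0"
      using c(2) by simp
    finally show ?case .
  qed
  then have "null (\<lambda>s. \<Sum>i\<in>I. c i * f i s)"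
    using hu(1) by (simp add: null_mult_iff)
  with c(1) show ?thesis
    by blast
qed

text \<open>
  Polynomials in \<open>y\<close> of degree below \<open>m\<close> with coefficients in \<open>M\<close> are spanned by the \<open>u j * y ^ i\<close>, numbered here
  by \<open>k = i * r + j\<close>.
\<close>

lemma spanned_polynomials:
  assumes "spanned M r" "\<not> null h'"
    and "\<And>f. f \<in> M' \<Longrightarrow> \<exists>g. (\<forall>i<m. g i \<in> M) \<and> null (\<lambda>s. h' s * f s - (\<Sum>i<m. g i s * y s ^ i))"
  shows "spanned M' (m * r)"
proof -
  obtain h u where hu: "\<not> null h" "\<forall>f\<in>M. \<exists>a. null (\<lambda>s. h s * f s - (\<Sum>j<r. a j * u j s))"
    using assms(1) unfolding spanned_def by blast
  have "\<exists>a. null (\<lambda>s. (h s * h' s) * f s - (\<Sum>k<m * r. a k * (u (k mod r) s * y s ^ (k div r))))"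
    if f: "f \<in> M'" for f
  proof -
    obtain g where g: "\<forall>i<m. g i \<in> M" "null (\<lambda>s. h' s * f s - (\<Sum>i<m. g i s * y s ^ i))"
      using assms(3)[OF f] by blast
    have "\<forall>i\<in>{..<m}. \<exists>a. null (\<lambda>s. h s * g i s - (\<Sum>j<r. a j * u j s))"
      using hu(2) g(1) by blast
    from bchoice[OF this] obtain a where a: "\<forall>i\<in>{..<m}. null (\<lambda>s. h s * g i s - (\<Sum>j<r. a i j * u j s))"
      by blast
    have "eventually (\<lambda>s. \<forall>i\<in>{..<m}. h s * g i s - (\<Sum>j<r. a i j * u j s) = 0) U"
      using a by (simp add: null_def eventually_ball_finite_distrib)
    then have "null (\<lambda>s. (h s * h' s) * f s -
        (\<Sum>k<m * r. a (k div r) (k mod r) * (u (k mod r) s * y s ^ (k div r))))"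
      using g(2) unfolding null_def
    proof eventually_elim
      case (elim s)
      have "(h s * h' s) * f s = h s * (\<Sum>i<m. g i s * y s ^ i)"
        using elim(2) by (simp add: mult.assoc)
      also have "\<dots> = (\<Sum>i<m. (h s * g i s) * y s ^ i)"
        by (simp add: sum_distrib_left mult.assoc)
      also have "\<dots> = (\<Sum>i<m. \<Sum>j<r. a i j * (u j s * y s ^ i))"
        using elim(1) by (intro sum.cong) (auto simp: sum_distrib_right mult.assoc)
      finally show ?case
        by (simp add: sum_div_mod)
    qed
    then show ?thesis
      by (rule exI[of _ "\<lambda>k. a (k div r) (k mod r)"])
  qed
  then have "\<forall>f\<in>M'. \<exists>a. null (\<lambda>s. (h s * h' s) * f s -
      (\<Sum>k<m * r. a k * (u (k mod r) s * y s ^ (k div r))))"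
    by (rule ballI)
  moreover have "\<not> null (\<lambda>s. h s * h' s)"
    using hu(1) assms(2) by (simp add: null_mult_iff)
  ultimately show ?thesis
    unfolding spanned_def
    by (intro exI[of _ "\<lambda>s. h s * h' s"] exI[of _ "\<lambda>k s. u (k mod r) s * y s ^ (k div r)"] conjI)
qed

lemma spanned_transcendental:
  assumes "spanned (box x n D) r"
  shows "spanned (box x (Suc n) D) (Suc D * r)"
proof (rule spanned_polynomials[OF assms not_null_one])
  fix f assume "f \<in> box x (Suc n) D"
  then obtain g where "f = (\<lambda>s. \<Sum>i\<le>D. g i s * x n s ^ i)" "\<forall>i. g i \<in> box x n D"
    by auto
  then show "\<exists>g. (\<forall>i<Suc D. g i \<in> box x n D) \<and> null (\<lambda>s. 1 * f s - (\<Sum>i<Suc D. g i s * x n s ^ i))"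
    by (intro exI[of _ g]) (simp add: lessThan_Suc_atMost)
qed

text \<open>
  The relation expresses the leading coefficient times \<open>x n ^ Suc \<mu>\<close> by lower powers. Used \<open>i\<close> times, it
  brings \<open>x n ^ i\<close> down, and each use raises the degree of the coefficients by \<open>e\<close>.
\<close>

lemma power_reduction:
  assumes F: "\<And>i. i \<le> Suc \<mu> \<Longrightarrow> F i \<in> box x n e"
    and rel: "null (\<lambda>s. \<Sum>i\<le>Suc \<mu>. F i s * x n s ^ i)"
  shows "\<exists>g. (\<forall>b. g b \<in> box x n (e * i)) \<and>
    null (\<lambda>s. F (Suc \<mu>) s ^ i * x n s ^ i - (\<Sum>b<Suc \<mu>. g b s * x n s ^ b))"
proof (induction i)
  case 0
  have "(\<Sum>b<Suc \<mu>. (if b = 0 then 1 else 0) * x n s ^ b) = 1" for s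
    by (subst sum.lessThan_Suc_shift) simp
  then show ?case
    by (intro exI[of _ "\<lambda>b _. if b = 0 then 1 else 0"]) (simp add: box_const)
next
  case (Suc i)
  then obtain g where g: "\<And>b. g b \<in> box x n (e * i)"
    "null (\<lambda>s. F (Suc \<mu>) s ^ i * x n s ^ i - (\<Sum>b<Suc \<mu>. g b s * x n s ^ b))"
    by blast
  define g' where "g' b = (\<lambda>s. (if b = 0 then 0 else F (Suc \<mu>) s * g (b - 1) s)
    + - (if b \<le> \<mu> then F b s * g \<mu> s else 0))" for b
  have "g' b \<in> box x n (e * Suc i)" for b
  proof -
    have "(\<lambda>s. if b = 0 then 0 else F (Suc \<mu>) s * g (b - 1) s) \<in> box x n (e * Suc i)"
      using box_mult[OF F g(1), of "Suc \<mu>" "b - 1"] by (cases "b = 0") (auto simp: box_zero)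
    moreover have "(\<lambda>s. if b \<le> \<mu> then F b s * g \<mu> s else 0) \<in> box x n (e * Suc i)"
      using box_mult[OF F g(1), of b \<mu>] by (cases "b \<le> \<mu>") (auto simp: box_zero)
    ultimately show ?thesis
      unfolding g'_def by (intro box_add box_uminus)
  qed
  moreover have "null (\<lambda>s. F (Suc \<mu>) s ^ Suc i * x n s ^ Suc i - (\<Sum>b<Suc \<mu>. g' b s * x n s ^ b))"
    using g(2) rel unfolding null_def
  proof eventually_elim
    case (elim s)
    let ?L = "F (Suc \<mu>) s" and ?X = "x n s"
    have "?L ^ Suc i * ?X ^ Suc i = ?L * ?X * (\<Sum>b<Suc \<mu>. g b s * ?X ^ b)"
      using elim(1) by (simp add: mult_ac)
    also have "\<dots> = (\<Sum>b<\<mu>. ?L * g b s * ?X ^ Suc b) + g \<mu> s * (?L * ?X ^ Suc \<mu>)"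
      by (simp add: sum_distrib_left distrib_left mult_ac)
    also have "?L * ?X ^ Suc \<mu> = - (\<Sum>b<Suc \<mu>. F b s * ?X ^ b)"
      using elim(2) by (simp add: lessThan_Suc_atMost add_eq_0_iff)
    also have "(\<Sum>b<\<mu>. ?L * g b s * ?X ^ Suc b) =
        (\<Sum>b<Suc \<mu>. (if b = 0 then 0 else ?L * g (b - 1) s) * ?X ^ b)"
      by (subst sum.lessThan_Suc_shift) simp
    also have "\<dots> + g \<mu> s * - (\<Sum>b<Suc \<mu>. F b s * ?X ^ b) = (\<Sum>b<Suc \<mu>. g' b s * ?X ^ b)"
      unfolding g'_def sum_distrib_left sum_negf[symmetric] sum.distrib[symmetric]
      by (intro sum.cong) (auto simp: algebra_simps)
    finally show ?case
      by simp
  qed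
  ultimately show ?case
    by blast
qed

lemma spanned_algebraic:
  assumes "algebraic x n"
  shows "\<exists>e \<nu>. \<forall>D r. spanned (box x n (Suc e * D)) r \<longrightarrow> spanned (box x (Suc n) D) (\<nu> * r)"
proof -
  obtain \<nu> F where F: "\<And>i. i \<le> \<nu> \<Longrightarrow> F i \<in> pol x n" "\<not> null (F \<nu>)"
    "null (\<lambda>s. \<Sum>i\<le>\<nu>. F i s * x n s ^ i)"
    using assms unfolding algebraic_def by blast
  obtain \<mu> where \<mu>: "\<nu> = Suc \<mu>"
    using F(2,3) by (cases \<nu>) auto
  have "\<forall>i. \<exists>D. i \<le> \<nu> \<longrightarrow> F i \<in> box x n D"
    using pol_in_box[OF F(1)] by blast
  from choice[OF this] obtain E where E: "\<And>i. i \<le> \<nu> \<Longrightarrow> F i \<in> box x n (E i)"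
    by blast
  define e where "e = Max (E ` {..\<nu>})"
  have e: "F i \<in> box x n e" if "i \<le> \<nu>" for i
    using E[OF that] that by (auto intro: box_mono simp: e_def)
  have "spanned (box x (Suc n) D) (\<nu> * r)" if sp: "spanned (box x n (Suc e * D)) r" for D r
  proof (rule spanned_polynomials[OF sp])
    show "\<not> null (\<lambda>s. F \<nu> s ^ D)"
      using F(2) unfolding not_null_iff by eventually_elim simp
    fix f assume "f \<in> box x (Suc n) D"
    then obtain a where a: "f = (\<lambda>s. \<Sum>i\<le>D. a i s * x n s ^ i)" "\<And>i. a i \<in> box x n D"
      by auto
    have "\<forall>i. \<exists>g. (\<forall>b. g b \<in> box x n (e * i)) \<and>
      null (\<lambda>s. F \<nu> s ^ i * x n s ^ i - (\<Sum>b<\<nu>. g b s * x n s ^ b))"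
      unfolding \<mu> using power_reduction[of \<mu> F x n e] e F(3) \<mu> by auto
    from choice[OF this] obtain g where g: "\<And>i b. g i b \<in> box x n (e * i)"
      "\<And>i. null (\<lambda>s. F \<nu> s ^ i * x n s ^ i - (\<Sum>b<\<nu>. g i b s * x n s ^ b))"
      by blast
    define G where "G b = (\<lambda>s. \<Sum>i\<le>D. a i s * (F \<nu> s ^ (D - i) * g i b s))" for b
    have "G b \<in> box x n (Suc e * D)" for b
    proof -
      have "(\<lambda>s. a i s * (F \<nu> s ^ (D - i) * g i b s)) \<in> box x n (D + ((D - i) * e + e * i))" for i
        by (intro box_mult a(2) box_power e g(1)) simp
      moreover have "D + ((D - i) * e + e * i) = Suc e * D" if "i \<le> D" for i
        using that by (metis add.commute add_mult_distrib le_add_diff_inverse mult.commute mult_Suc)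
      ultimately show ?thesis
        unfolding G_def by (intro box_sum) (metis atMost_iff)
    qed
    moreover have "null (\<lambda>s. F \<nu> s ^ D * f s - (\<Sum>b<\<nu>. G b s * x n s ^ b))"
    proof -
      have "eventually (\<lambda>s. \<forall>i\<in>{..D}. F \<nu> s ^ i * x n s ^ i - (\<Sum>b<\<nu>. g i b s * x n s ^ b) = 0) U"
        using g(2) by (simp add: null_def eventually_ball_finite_distrib)
      then show ?thesis
        unfolding null_def
      proof eventually_elim
        case (elim s)
        have "F \<nu> s ^ D * f s = (\<Sum>i\<le>D. a i s * F \<nu> s ^ (D - i) * (F \<nu> s ^ i * x n s ^ i))"
          unfolding a(1) sum_distrib_left
        proof (intro sum.cong refl)
          fix i assume "i \<in> {..D}"
          then have "F \<nu> s ^ D = F \<nu> s ^ (D - i) * F \<nu> s ^ i"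
            by (simp flip: power_add)
          then show "F \<nu> s ^ D * (a i s * x n s ^ i) = a i s * F \<nu> s ^ (D - i) * (F \<nu> s ^ i * x n s ^ i)"
            by (simp add: mult_ac)
        qed
        also have "\<dots> = (\<Sum>i\<le>D. \<Sum>b<\<nu>. a i s * (F \<nu> s ^ (D - i) * g i b s) * x n s ^ b)"
          using elim by (intro sum.cong) (auto simp: sum_distrib_left mult_ac)
        also have "\<dots> = (\<Sum>b<\<nu>. G b s * x n s ^ b)"
          by (subst sum.swap) (simp add: G_def sum_distrib_right)
        finally show ?case
          by simp
      qed
    qed
    ultimately show "\<exists>g. (\<forall>i<\<nu>. g i \<in> box x n (Suc e * D)) \<and>
        null (\<lambda>s. F \<nu> s ^ D * f s - (\<Sum>i<\<nu>. g i s * x n s ^ i))"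
      by blast
  qed
  then show ?thesis
    by (intro exI allI impI)
qed

text \<open>
  A transcendental coordinate multiplies the dimension by \<open>Suc D\<close>. An algebraic one multiplies it by
  a constant and enlarges the box of the preceding coordinates by a
  constant factor.
\<close>

lemma box_growth:
  "\<exists>C. \<forall>D. spanned (box x n D) (C * Suc D ^ card {i \<in> {..<n}. \<not> algebraic x i})"
proof (induction n)
  case 0
  have "spanned (box x 0 D) (Suc 0)" for D
    unfolding spanned_def
  proof (intro exI conjI ballI)
    fix f assume "f \<in> box x 0 D"
    then show "null (\<lambda>s. 1 * f s - (\<Sum>j<Suc 0. (\<lambda>_. f undefined) j * (\<lambda>_ _. 1) j s))"
      by auto
  qed simp
  then show ?case
    by (intro exI[of _ 1]) simp
next
  case (Suc n)
  let ?t = "card {i \<in> {..<n}. \<not> algebraic x i}"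
  obtain C where C: "\<And>D. spanned (box x n D) (C * Suc D ^ ?t)"
    using Suc by blast
  show ?case
  proof (cases "algebraic x n")
    case False
    have "{i \<in> {..<Suc n}. \<not> algebraic x i} = insert n {i \<in> {..<n}. \<not> algebraic x i}"
      using False by (auto simp: less_Suc_eq)
    then have t: "card {i \<in> {..<Suc n}. \<not> algebraic x i} = Suc ?t"
      by simp
    have "spanned (box x (Suc n) D) (C * Suc D ^ Suc ?t)" for D
      using spanned_transcendental[OF C, of D] by (simp add: mult_ac)
    then show ?thesis
      unfolding t by blast
  next
    case True
    have t: "{i \<in> {..<Suc n}. \<not> algebraic x i} = {i \<in> {..<n}. \<not> algebraic x i}"
      using True by (auto simp: less_Suc_eq)
    from spanned_algebraic[OF True] obtain e \<nu> where
      "\<forall>D r. spanned (box x n (Suc e * D)) r \<longrightarrow> spanned (box x (Suc n) D) (\<nu> * r)"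
      by (elim exE)
    then have step: "spanned (box x (Suc n) D) (\<nu> * r)" if "spanned (box x n (Suc e * D)) r" for D r
      using that by simp
    have "spanned (box x (Suc n) D) (\<nu> * C * Suc e ^ ?t * Suc D ^ ?t)" for D
    proof (rule spanned_mono[OF step[OF C]])
      have "Suc (Suc e * D) ^ ?t \<le> (Suc e * Suc D) ^ ?t"
        by (intro power_mono) auto
      then have "\<nu> * (C * Suc (Suc e * D) ^ ?t) \<le> \<nu> * (C * (Suc e * Suc D) ^ ?t)"
        by (intro mult_le_mono2)
      then show "\<nu> * (C * Suc (Suc e * D) ^ ?t) \<le> \<nu> * C * Suc e ^ ?t * Suc D ^ ?t"
        by (simp only: power_mult_distrib mult.assoc)
    qed
    then show ?thesis
      unfolding t by blast
  qed
qed

end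

primrec monomial_at :: "(nat \<Rightarrow> 'p \<Rightarrow> 'k::field) \<Rightarrow> nat \<Rightarrow> nat list \<Rightarrow> 'p \<Rightarrow> 'k" where
  "monomial_at y j [] s = 1"
| "monomial_at y j (a # \<alpha>) s = y j s ^ a * monomial_at y (Suc j) \<alpha> s"

lemma monomial_at_cong:
  "(\<And>i. j \<le> i \<Longrightarrow> i < j + length \<alpha> \<Longrightarrow> y i s = z i s) \<Longrightarrow> monomial_at y j \<alpha> s = monomial_at z j \<alpha> s"
  by (induction \<alpha> arbitrary: j) auto

definition exponents :: "nat \<Rightarrow> nat \<Rightarrow> nat list set" where
  "exponents m K = {\<alpha>. set \<alpha> \<subseteq> {..<K} \<and> length \<alpha> = m}"

lemma finite_exponents: "finite (exponents m K)"
  unfolding exponents_def by (rule finite_lists_length_eq) simp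

lemma card_exponents: "card (exponents m K) = K ^ m"
  unfolding exponents_def using card_lists_length_eq[of "{..<K}" m] by simp

lemma monomial_in_box:
  assumes "\<And>i. i < length \<alpha> \<Longrightarrow> y (j + i) \<in> box x n e" "set \<alpha> \<subseteq> {..<Suc D}"
  shows "monomial_at y j \<alpha> \<in> box x n (length \<alpha> * (D * e))"
  using assms
proof (induction \<alpha> arbitrary: j)
  case Nil
  then show ?case
    by (simp add: box_const fun_eq_iff[symmetric] monomial_at.simps(1)[abs_def])
next
  case (Cons a \<alpha>)
  have "monomial_at y (Suc j) \<alpha> \<in> box x n (length \<alpha> * (D * e))"
    using Cons.prems(1)[of "Suc _"] Cons.prems(2) by (intro Cons.IH) auto
  moreover have "(\<lambda>s. y j s ^ a) \<in> box x n (a * e)"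
    using Cons.prems(1)[of 0] by (intro box_power) simp
  then have "(\<lambda>s. y j s ^ a) \<in> box x n (D * e)"
    by (rule box_mono) (use Cons.prems(2) in auto)
  ultimately have "(\<lambda>s. y j s ^ a * monomial_at y (Suc j) \<alpha> s) \<in> box x n (D * e + length \<alpha> * (D * e))"
    by (intro box_mult)
  then show ?case
    by (simp add: monomial_at.simps(2)[abs_def])
qed

text \<open>
  There are \<open>Suc D ^ m\<close> monomials of degree at most \<open>D\<close> in the \<open>y i\<close>, all contained in a box of size
  proportional to \<open>D\<close>, and the dimension of such a box grows only like \<open>D ^ t\<close>, where \<open>t\<close> is the number
  of transcendental coordinates (\<open>box_growth\<close>).
\<close>

theorem (in ultrafilter) independent_card_le:
  assumes y: "\<And>i. i < m \<Longrightarrow> y i \<in> pol x n"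
    and indep: "\<And>K c \<alpha>. null (\<lambda>s. \<Sum>\<alpha>\<in>exponents m K. c \<alpha> * monomial_at y 0 \<alpha> s) \<Longrightarrow>
      \<alpha> \<in> exponents m K \<Longrightarrow> c \<alpha> = 0"
  shows "m \<le> card {i \<in> {..<n}. \<not> algebraic x i}"
proof (rule ccontr)
  define t where "t = card {i \<in> {..<n}. \<not> algebraic x i}"
  assume "\<not> m \<le> card {i \<in> {..<n}. \<not> algebraic x i}"
  then have t: "Suc t \<le> m"
    by (simp add: t_def)
  obtain C where C: "\<And>D. spanned (box x n D) (C * Suc D ^ t)"
    using box_growth[of x n] unfolding t_def by blast
  have "\<forall>i. \<exists>D. i < m \<longrightarrow> y i \<in> box x n D"
    using pol_in_box[OF y] by blast
  from choice[OF this] obtain E where E: "\<And>i. i < m \<Longrightarrow> y i \<in> box x n (E i)"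
    by blast
  define e where "e = Max (E ` {..<m})"
  have e: "y i \<in> box x n e" if "i < m" for i
    using E[OF that] that by (auto intro: box_mono simp: e_def)
  \<comment> \<open>If \<open>m > t\<close>, the count gives \<open>Suc D \<le> C * Suc (m * e) ^ t\<close> for all \<open>D\<close>.\<close>
  define D where "D = C * Suc (m * e) ^ t"
  have "card (exponents m (Suc D)) \<le> C * Suc (m * (D * e)) ^ t"
  proof (rule ccontr)
    assume "\<not> ?thesis"
    then have "C * Suc (m * (D * e)) ^ t < card (exponents m (Suc D))"
      by simp
    moreover have "monomial_at y 0 \<alpha> \<in> box x n (m * (D * e))" if "\<alpha> \<in> exponents m (Suc D)" for \<alpha>
      using that monomial_in_box[of \<alpha> y 0 x n e D] e by (auto simp: exponents_def)
    ultimately obtain c where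
      "\<exists>\<alpha>\<in>exponents m (Suc D). c \<alpha> \<noteq> 0" "null (\<lambda>s. \<Sum>\<alpha>\<in>exponents m (Suc D). c \<alpha> * monomial_at y 0 \<alpha> s)"
      using spanned_dependent[OF C finite_exponents] by blast
    then show False
      using indep by blast
  qed
  also have "Suc (m * (D * e)) ^ t \<le> (Suc (m * e) * Suc D) ^ t"
    by (intro power_mono) (auto simp: algebra_simps)
  then have "C * Suc (m * (D * e)) ^ t \<le> C * (Suc (m * e) * Suc D) ^ t"
    by (rule mult_le_mono2)
  also have "\<dots> = D * Suc D ^ t"
    unfolding D_def power_mult_distrib by (simp only: mult.assoc)
  also have "\<dots> < Suc D ^ Suc t"
    by simp
  also have "\<dots> \<le> Suc D ^ m"
    using t by (intro power_increasing) auto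
  finally show False
    by (simp add: card_exponents)
qed

section \<open>Polylinear forms with varying coefficients\<close>

locale polylinear_forms = vector_space scale
  for scale :: "'k::field \<Rightarrow> 'v::ab_group_add \<Rightarrow> 'v" +
  fixes V :: "nat \<Rightarrow> 'v set"
begin

lemma polylinearD_add:
  "polylinear_form scale A V M \<Longrightarrow> \<tau> \<in> PiE A V \<Longrightarrow> i \<in> A \<Longrightarrow> y \<in> V i \<Longrightarrow> z \<in> V i \<Longrightarrow>
    M (\<tau>(i := y + z)) = M (\<tau>(i := y)) + M (\<tau>(i := z))"
  unfolding polylinear_form_def by blast

lemma polylinearD_scale:
  "polylinear_form scale A V M \<Longrightarrow> \<tau> \<in> PiE A V \<Longrightarrow> i \<in> A \<Longrightarrow> y \<in> V i \<Longrightarrow>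
    M (\<tau>(i := scale c y)) = c * M (\<tau>(i := y))"
  unfolding polylinear_form_def by blast

lemma polylinear_form_zero: "polylinear_form scale A V (\<lambda>_. 0)"
  by (simp add: polylinear_form_def)

lemma polylinear_form_add:
  "polylinear_form scale A V M \<Longrightarrow> polylinear_form scale A V M' \<Longrightarrow>
    polylinear_form scale A V (\<lambda>\<tau>. M \<tau> + M' \<tau>)"
  by (simp add: polylinear_form_def algebra_simps)

lemma polylinear_form_cmult:
  "polylinear_form scale A V M \<Longrightarrow> polylinear_form scale A V (\<lambda>\<tau>. c * M \<tau>)"
  by (simp add: polylinear_form_def algebra_simps)

lemma polylinear_form_product:
  assumes M: "polylinear_form scale A V M" and M': "polylinear_form scale B V M'" and "A \<inter> B = {}"
  shows "polylinear_form scale (A \<union> B) V (\<lambda>\<tau>. M (restrict \<tau> A) * M' (restrict \<tau> B))"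
  unfolding polylinear_form_def
proof (intro ballI allI)
  fix \<tau> i y z c assume \<tau>: "\<tau> \<in> PiE (A \<union> B) V" and i: "i \<in> A \<union> B" and y: "y \<in> V i" "z \<in> V i"
  have A: "restrict \<tau> A \<in> PiE A V" and B: "restrict \<tau> B \<in> PiE B V"
    using \<tau> by auto
  show "M (restrict (\<tau>(i := y + z)) A) * M' (restrict (\<tau>(i := y + z)) B) =
      M (restrict (\<tau>(i := y)) A) * M' (restrict (\<tau>(i := y)) B) +
      M (restrict (\<tau>(i := z)) A) * M' (restrict (\<tau>(i := z)) B) \<and>
      M (restrict (\<tau>(i := scale c y)) A) * M' (restrict (\<tau>(i := scale c y)) B) =
      c * (M (restrict (\<tau>(i := y)) A) * M' (restrict (\<tau>(i := y)) B))"
  proof (cases "i \<in> A")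
    case True
    then have "restrict (\<tau>(i := w)) A = (restrict \<tau> A)(i := w)" "restrict (\<tau>(i := w)) B = restrict \<tau> B" for w
      using assms(3) by (auto simp: restrict_def fun_eq_iff)
    then show ?thesis
      using polylinearD_add[OF M A True y] polylinearD_scale[OF M A True y(1)] by (simp add: algebra_simps)
  next
    case False
    then have iB: "i \<in> B"
      using i by simp
    with False have "restrict (\<tau>(i := w)) B = (restrict \<tau> B)(i := w)" "restrict (\<tau>(i := w)) A = restrict \<tau> A" for w
      by (auto simp: restrict_def fun_eq_iff)
    then show ?thesis
      using polylinearD_add[OF M' B iB y] polylinearD_scale[OF M' B iB y(1)] by (simp add: algebra_simps)
  qed
qed

lemma polylinear_form_fix_slot:
  assumes M: "polylinear_form scale A V M" and i: "i \<in> A" "e \<in> V i"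
  shows "polylinear_form scale (A - {i}) V (\<lambda>\<tau>. M (\<tau>(i := e)))"
  unfolding polylinear_form_def
proof (intro ballI allI)
  fix \<tau> j y z c assume \<tau>: "\<tau> \<in> PiE (A - {i}) V" and j: "j \<in> A - {i}" and y: "y \<in> V j" "z \<in> V j"
  have \<tau>': "\<tau>(i := e) \<in> PiE A V"
    using \<tau> i by (auto simp: PiE_iff extensional_def)
  have "\<tau>(j := w, i := e) = \<tau>(i := e, j := w)" for w
    using j by auto
  then show "M (\<tau>(j := y + z, i := e)) = M (\<tau>(j := y, i := e)) + M (\<tau>(j := z, i := e)) \<and>
      M (\<tau>(j := scale c y, i := e)) = c * M (\<tau>(j := y, i := e))"
    using polylinearD_add[OF M \<tau>' _ y] polylinearD_scale[OF M \<tau>' _ y(1)] j by simp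
qed

lemma polylinear_form_expand:
  assumes M: "polylinear_form scale A V M" and \<tau>: "\<tau> \<in> PiE A V" and i: "i \<in> A"
    and V: "subspace (V i)" and e: "\<And>n. n \<in> I \<Longrightarrow> e n \<in> V i"
  shows "M (\<tau>(i := \<Sum>n\<in>I. scale (c n) (e n))) = (\<Sum>n\<in>I. c n * M (\<tau>(i := e n)))"
  using e
proof (induction I rule: infinite_finite_induct)
  case (insert n I)
  then have "(\<Sum>n\<in>I. scale (c n) (e n)) \<in> V i"
    using V by (intro subspace_sum subspace_scale) auto
  moreover have "scale (c n) (e n) \<in> V i"
    using V insert.prems by (intro subspace_scale) auto
  ultimately show ?case
    using insert polylinearD_add[OF M \<tau> i, of "scale (c n) (e n)"] polylinearD_scale[OF M \<tau> i, of "e n"]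
    by (simp del: fun_upd_apply)
qed (use polylinearD_scale[OF M \<tau> i subspace_0[OF V], of 0] in auto)

lemma polylinear_form_zero_slot:
  assumes "polylinear_form scale A V M" "\<tau> \<in> PiE A V" "i \<in> A" "\<tau> i = 0"
  shows "M \<tau> = 0"
proof -
  have "\<tau> i \<in> V i"
    using assms(2,3) by auto
  from polylinearD_scale[OF assms(1-3) this, of 0] have "M (\<tau>(i := 0)) = 0"
    by simp
  then show ?thesis
    using assms(4) by (metis fun_upd_triv)
qed

text \<open>
  Replaces the basis by the whole space in one slot after the other.
\<close>

lemma polylinear_form_vanishes_on_basis:
  assumes M: "polylinear_form scale A V M" and A: "finite A"
    and V: "\<And>i. i \<in> A \<Longrightarrow> subspace (V i) \<and> span (B i) = V i"
    and zero: "\<And>\<tau>. \<tau> \<in> PiE A B \<Longrightarrow> M \<tau> = 0" and \<tau>: "\<tau> \<in> PiE A V"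
  shows "M \<tau> = 0"
proof -
  have B: "B i \<subseteq> V i" if "i \<in> A" for i
    using V[OF that] span_superset[of "B i"] by simp
  have "\<forall>\<tau>\<in>PiE A (\<lambda>i. if i \<in> C then V i else B i). M \<tau> = 0" if "C \<subseteq> A" for C
    using finite_subset[OF that A] that
  proof (induction C rule: finite_induct)
    case empty
    then show ?case
      using zero by simp
  next
    case (insert i C)
    show ?case
    proof
      fix \<tau> assume \<tau>: "\<tau> \<in> PiE A (\<lambda>j. if j \<in> insert i C then V j else B j)"
      have i: "i \<in> A"
        using insert.prems by simp
      then have \<tau>V: "\<tau> \<in> PiE A V"
        using \<tau> B by (auto simp: PiE_iff split: if_splits)
      have "subspace {y \<in> V i. M (\<tau>(i := y)) = 0}"
        using V[OF i] polylinearD_add[OF M \<tau>V i] polylinearD_scale[OF M \<tau>V i]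
          polylinearD_scale[OF M \<tau>V i subspace_0, of 0]
        by (auto simp: subspace_def)
      moreover have "M (\<tau>(i := y)) = 0" if "y \<in> B i" for y
      proof -
        have "\<tau>(i := y) \<in> PiE A (\<lambda>j. if j \<in> C then V j else B j)"
          using \<tau> that i insert.hyps by (auto simp: PiE_iff extensional_def split: if_splits)
        then show ?thesis
          using insert by auto
      qed
      then have "B i \<subseteq> {y \<in> V i. M (\<tau>(i := y)) = 0}"
        using B[OF i] by auto
      ultimately have "span (B i) \<subseteq> {y \<in> V i. M (\<tau>(i := y)) = 0}"
        by (intro span_minimal)
      then have "M (\<tau>(i := \<tau> i)) = 0"
        using V[OF i] \<tau>V i by blast
      then show "M \<tau> = 0"
        by simp
    qed
  qed
  from this[of A] show ?thesis
    using \<tau> by (simp cong: PiE_cong)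
qed

text \<open>
  The tensor product of \<open>R\<close> with the polylinear forms on the slots \<open>A\<close>. Finite sums of pure tensors
  are convenient since a derivation of \<open>R\<close> acts on them and preserves polylinearity. The form ignores
  the slots outside \<open>A\<close>, so that forms on different sets of slots can be multiplied.
\<close>

inductive_set forms :: "('p \<Rightarrow> 'k) set \<Rightarrow> nat set \<Rightarrow> ('p \<Rightarrow> (nat \<Rightarrow> 'v) \<Rightarrow> 'k) set" for R A where
  zero: "(\<lambda>_ _. 0) \<in> forms R A"
| add: "a \<in> forms R A \<Longrightarrow> f \<in> R \<Longrightarrow> polylinear_form scale A V M \<Longrightarrow>
    (\<lambda>s \<tau>. a s \<tau> + f s * M (restrict \<tau> A)) \<in> forms R A"

lemma forms_single:
  "f \<in> R \<Longrightarrow> polylinear_form scale A V M \<Longrightarrow> (\<lambda>s \<tau>. f s * M (restrict \<tau> A)) \<in> forms R A"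
  using forms.add[OF forms.zero, of f R A M] by simp

lemma forms_add:
  assumes "a \<in> forms R A" "b \<in> forms R A"
  shows "(\<lambda>s \<tau>. a s \<tau> + b s \<tau>) \<in> forms R A"
  using assms(2)
proof induction
  case (add b f M)
  then show ?case
    using forms.add[OF add.IH add.hyps(2,3)] by (simp add: add.assoc)
qed (use assms(1) in simp)

lemma forms_sum: "(\<And>i. i \<in> I \<Longrightarrow> a i \<in> forms R A) \<Longrightarrow> (\<lambda>s \<tau>. \<Sum>i\<in>I. a i s \<tau>) \<in> forms R A"
  by (induction I rule: infinite_finite_induct) (auto intro: forms.zero forms_add)

lemma forms_mono: "a \<in> forms R A \<Longrightarrow> R \<subseteq> R' \<Longrightarrow> a \<in> forms R' A"
  by (induction rule: forms.induct) (auto intro: forms.intros)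

lemma forms_restrict: "a \<in> forms R A \<Longrightarrow> a s (restrict \<tau> A) = a s \<tau>"
  by (induction rule: forms.induct) (auto simp del: restrict_apply)

lemma forms_cong:
  assumes "a \<in> forms R A" "\<And>i. i \<in> A \<Longrightarrow> \<tau> i = \<tau>' i"
  shows "a s \<tau> = a s \<tau>'"
proof -
  have "restrict \<tau> A = restrict \<tau>' A"
    using assms(2) by (auto simp: restrict_def fun_eq_iff)
  then show ?thesis
    using forms_restrict[OF assms(1)] by metis
qed

lemma forms_polylinear: "a \<in> forms R A \<Longrightarrow> polylinear_form scale A V (a s)"
proof (induction rule: forms.induct)
  case (add a f M)
  have "polylinear_form scale A V (\<lambda>\<tau>. M (restrict \<tau> A))"
    unfolding polylinear_form_def
  proof (intro ballI allI)
    fix \<tau> i y z c assume \<tau>: "\<tau> \<in> PiE A V" and i: "i \<in> A" and y: "y \<in> V i" "z \<in> V i"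
    have "restrict (\<tau>(i := w)) A = \<tau>(i := w)" for w
      using \<tau> i by (auto simp: restrict_def fun_eq_iff PiE_iff extensional_def)
    then show "M (restrict (\<tau>(i := y + z)) A) = M (restrict (\<tau>(i := y)) A) + M (restrict (\<tau>(i := z)) A) \<and>
        M (restrict (\<tau>(i := scale c y)) A) = c * M (restrict (\<tau>(i := y)) A)"
      using polylinearD_add[OF add.hyps(3) \<tau> i y] polylinearD_scale[OF add.hyps(3) \<tau> i y(1)] by simp
  qed
  then show ?case
    using add.IH by (intro polylinear_form_add polylinear_form_cmult)
qed (rule polylinear_form_zero)

lemma forms_expand:
  assumes a: "a \<in> forms R A" and \<tau>: "\<And>j. j \<in> A \<Longrightarrow> \<tau> j \<in> V j" and i: "i \<in> A"
    and V: "subspace (V i)" and e: "\<And>n. n \<in> I \<Longrightarrow> e n \<in> V i"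
  shows "a s (\<tau>(i := \<Sum>n\<in>I. scale (c n) (e n))) = (\<Sum>n\<in>I. c n * a s (\<tau>(i := e n)))"
proof -
  have "a s (\<tau>(i := w)) = a s ((restrict \<tau> A)(i := w))" for w
    using a by (rule forms_cong) auto
  moreover have "a s ((restrict \<tau> A)(i := \<Sum>n\<in>I. scale (c n) (e n))) =
      (\<Sum>n\<in>I. c n * a s ((restrict \<tau> A)(i := e n)))"
    by (rule polylinear_form_expand[OF forms_polylinear[OF a] _ i V]) (use \<tau> e in auto)
  ultimately show ?thesis
    by (simp only:)
qed

lemma forms_fix_slot:
  assumes "a \<in> forms R A" "i \<in> A" "e \<in> V i"
  shows "(\<lambda>s \<tau>. a s (\<tau>(i := e))) \<in> forms R (A - {i})"
  using assms(1)
proof induction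
  case (add a f M)
  have "restrict (\<tau>(i := e)) A = (restrict \<tau> (A - {i}))(i := e)" for \<tau>
    using assms(2) by (auto simp: restrict_def fun_eq_iff)
  then show ?case
    using forms.add[OF add.IH add.hyps(2) polylinear_form_fix_slot[OF add.hyps(3) assms(2,3)]]
    by (simp only:)
qed (rule forms.zero)

lemma forms_linear_functional:
  assumes "Vector_Spaces.linear scale (*) l" "(\<lambda>_. 1) \<in> R"
  shows "(\<lambda>s \<tau>. l (\<tau> i)) \<in> forms R {i}"
proof -
  interpret l: Vector_Spaces.linear scale "(*)" l by fact
  have "polylinear_form scale {i} V (\<lambda>\<tau>. l (\<tau> i))"
    by (simp add: polylinear_form_def l.add l.scale)
  from forms_single[OF assms(2) this] show ?thesis
    by simp
qed

context
  fixes x :: "nat \<Rightarrow> 'p \<Rightarrow> 'k" and n :: nat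
begin

abbreviation "pforms \<equiv> forms (pol x n)"

lemma forms_scale:
  assumes "g \<in> pol x n" "a \<in> pforms A"
  shows "(\<lambda>s \<tau>. g s * a s \<tau>) \<in> pforms A"
  using assms(2)
proof induction
  case (add a f M)
  then show ?case
    using forms.add[OF add.IH pol.mult[OF assms(1) add.hyps(2)] add.hyps(3)]
    by (simp add: distrib_left mult.assoc)
qed (use forms.zero in simp)

lemma forms_uminus: "a \<in> pforms A \<Longrightarrow> (\<lambda>s \<tau>. - a s \<tau>) \<in> pforms A"
  using forms_scale[OF pol.const[of "-1"], of a A] by simp

lemma forms_diff: "a \<in> pforms A \<Longrightarrow> b \<in> pforms A \<Longrightarrow> (\<lambda>s \<tau>. a s \<tau> - b s \<tau>) \<in> pforms A"
  using forms_add[of a "pol x n" A "\<lambda>s \<tau>. - b s \<tau>"] forms_uminus[of b A] by simp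

lemma forms_mult:
  assumes a: "a \<in> pforms A" and b: "b \<in> pforms B" and AB: "A \<inter> B = {}"
  shows "(\<lambda>s \<tau>. a s \<tau> * b s \<tau>) \<in> pforms (A \<union> B)"
  using a
proof induction
  case (add a f M)
  have "(\<lambda>s \<tau>. f s * M (restrict \<tau> A) * b s \<tau>) \<in> pforms (A \<union> B)"
    using b
  proof induction
    case (add b g M')
    have "(\<lambda>s \<tau>. f s * g s * (M (restrict (restrict \<tau> (A \<union> B)) A) * M' (restrict (restrict \<tau> (A \<union> B)) B))) \<in> pforms (A \<union> B)"
      using forms_single[OF pol.mult[OF \<open>f \<in> pol x n\<close> \<open>g \<in> pol x n\<close>]
          polylinear_form_product[OF \<open>polylinear_form scale A V M\<close> \<open>polylinear_form scale B V M'\<close> AB]] .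
    then have "(\<lambda>s \<tau>. f s * g s * (M (restrict \<tau> A) * M' (restrict \<tau> B))) \<in> pforms (A \<union> B)"
      by (simp add: Int_absorb1 del: restrict_apply)
    from forms_add[OF add.IH this] show ?case
      by (simp add: algebra_simps del: restrict_apply)
  qed (use forms.zero in simp)
  from forms_add[OF add.IH this] show ?case
    by (simp add: algebra_simps del: restrict_apply)
qed (use forms.zero in simp)

lemma forms_value_pol: "a \<in> pforms A \<Longrightarrow> (\<lambda>s. a s \<tau>) \<in> pol x n"
  by (induction rule: forms.induct) (auto intro!: pol_closed)

lemma forms_linear_mult:
  assumes "Vector_Spaces.linear scale (*) l" "a \<in> pforms A" "i \<notin> A"
  shows "(\<lambda>s \<tau>. l (\<tau> i) * a s \<tau>) \<in> pforms (insert i A)"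
  using forms_mult[OF forms_linear_functional[OF assms(1) pol.const] assms(2), of i] assms(3) by simp

text \<open>
  The derivation acts on the coefficients.
\<close>

lemma forms_derivative:
  assumes "a \<in> pforms A" "\<And>l. l < n \<Longrightarrow> \<xi> l \<in> pol x n"
  shows "\<exists>a'. a' \<in> pforms A \<and> (\<forall>\<tau>. (\<lambda>s. a s \<tau>, \<lambda>s. a' s \<tau>) \<in> tangent_pairs x \<xi> n)"
  using assms(1)
proof induction
  case zero
  show ?case
    by (intro exI[of _ "\<lambda>_ _. 0"]) (simp add: forms.zero tangent_pairs.const)
next
  case (add a f M)
  then obtain a' where a': "a' \<in> pforms A" "\<And>\<tau>. (\<lambda>s. a s \<tau>, \<lambda>s. a' s \<tau>) \<in> tangent_pairs x \<xi> n"
    by blast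
  obtain f' where f': "(f, f') \<in> tangent_pairs x \<xi> n"
    using tangent_pairs_exist[OF add.hyps(2)] by blast
  have "f' \<in> pol x n"
    using tangent_pairs_pol_snd[OF f' order_refl assms(2)] .
  from forms.add[OF a'(1) this add.hyps(3)]
  have "(\<lambda>s \<tau>. a' s \<tau> + f' s * M (restrict \<tau> A)) \<in> pforms A" .
  moreover have "(\<lambda>s. a s \<tau> + f s * M (restrict \<tau> A), \<lambda>s. a' s \<tau> + f' s * M (restrict \<tau> A)) \<in> tangent_pairs x \<xi> n" for \<tau>
    using tangent_pairs.add[OF a'(2) tangent_pairs.mult[OF f' tangent_pairs.const[of "M (restrict \<tau> A)"]]] by simp
  ultimately show ?case
    by blast
qed


section \<open>Sums of split products\<close>

inductive split_sum :: "nat set \<Rightarrow> nat \<Rightarrow> ('p \<Rightarrow> (nat \<Rightarrow> 'v) \<Rightarrow> 'k) \<Rightarrow> bool" for A where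
  zero: "split_sum A 0 (\<lambda>_ _. 0)"
| add: "split_sum A c \<Phi> \<Longrightarrow> a \<in> pforms I \<Longrightarrow> b \<in> pforms J \<Longrightarrow> I \<noteq> {} \<Longrightarrow> J \<noteq> {} \<Longrightarrow> I \<inter> J = {} \<Longrightarrow>
    I \<union> J = A \<Longrightarrow> split_sum A (Suc c) (\<lambda>s \<tau>. \<Phi> s \<tau> + a s \<tau> * b s \<tau>)"

lemma split_sum_forms: "split_sum A c \<Phi> \<Longrightarrow> \<Phi> \<in> pforms A"
proof (induction rule: split_sum.induct)
  case (add c \<Phi> a I b J)
  then show ?case
    using forms_mult[of a I b J] by (intro forms_add) auto
qed (rule forms.zero)

lemma split_sum_plus:
  assumes "split_sum A c \<Phi>" "split_sum A c' \<Phi>'"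
  shows "split_sum A (c + c') (\<lambda>s \<tau>. \<Phi> s \<tau> + \<Phi>' s \<tau>)"
  using assms(2)
proof induction
  case (add c' \<Phi>' a I b J)
  then show ?case
    using split_sum.add[OF add.IH add.hyps(2-7)] by (simp add: add.assoc)
qed (use assms(1) in simp)

lemma split_sum_products:
  assumes "finite K" "\<And>m. m \<in> K \<Longrightarrow> a m \<in> pforms I" "\<And>m. m \<in> K \<Longrightarrow> b m \<in> pforms J"
    and "I \<noteq> {}" "J \<noteq> {}" "I \<inter> J = {}" "I \<union> J = A"
  shows "split_sum A (card K) (\<lambda>s \<tau>. \<Sum>m\<in>K. a m s \<tau> * b m s \<tau>)"
  using assms(1-3)
proof (induction K rule: finite_induct)
  case (insert m K)
  then show ?case
    using split_sum.add[of A "card K" "\<lambda>s \<tau>. \<Sum>m\<in>K. a m s \<tau> * b m s \<tau>" "a m" I "b m" J] assms(4-7)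
    by (simp add: add.commute)
qed (simp add: split_sum.zero)

text \<open>
  The Leibniz rule for a sum of split products, with one derivation \<open>\<xi> m\<close> for each \<open>m\<close> and weight
  \<open>coord m (\<tau> i)\<close> in the new slot \<open>i\<close>. The combination \<open>h * \<Phi>' - h' * \<Phi>\<close> is the numerator of the derivative
  of \<open>\<Phi> / h\<close>. It is expanded so that from \<open>a * b\<close> only two products arise,
  \<open>(h * a' - h' * a) * b\<close> and \<open>(h * a) * b'\<close>; the sum over \<open>m\<close> goes into the factor that receives the
  slot \<open>i\<close>.
\<close>

lemma split_sum_derivative:
  assumes \<Phi>: "split_sum A c \<Phi>" and i: "i \<notin> A" and K: "finite K" and h: "h \<in> pol x n"
    and K_pol: "\<And>m l. m \<in> K \<Longrightarrow> \<xi> m l \<in> pol x n" "\<And>m. m \<in> K \<Longrightarrow> h' m \<in> pol x n"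
    and lin: "\<And>m. m \<in> K \<Longrightarrow> Vector_Spaces.linear scale (*) (coord m)"
  shows "\<exists>\<Phi>'. (\<forall>m\<in>K. \<forall>\<tau>. (\<lambda>s. \<Phi> s \<tau>, \<lambda>s. \<Phi>' m s \<tau>) \<in> tangent_pairs x (\<xi> m) n) \<and>
    split_sum (insert i A) (2 * c) (\<lambda>s \<tau>. \<Sum>m\<in>K. coord m (\<tau> i) * (h s * \<Phi>' m s \<tau> - h' m s * \<Phi> s \<tau>))"
  using \<Phi>
proof induction
  case zero
  show ?case
    by (intro exI[of _ "\<lambda>_ _ _. 0"]) (simp add: split_sum.zero tangent_pairs.const)
next
  case (add c \<Phi> a I b J)
  then obtain \<Phi>' where \<Phi>': "\<And>m \<tau>. m \<in> K \<Longrightarrow> (\<lambda>s. \<Phi> s \<tau>, \<lambda>s. \<Phi>' m s \<tau>) \<in> tangent_pairs x (\<xi> m) n"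
    and split: "split_sum (insert i A) (2 * c) (\<lambda>s \<tau>. \<Sum>m\<in>K. coord m (\<tau> i) * (h s * \<Phi>' m s \<tau> - h' m s * \<Phi> s \<tau>))"
    by blast
  have "\<forall>m\<in>K. \<exists>a'. a' \<in> pforms I \<and> (\<forall>\<tau>. (\<lambda>s. a s \<tau>, \<lambda>s. a' s \<tau>) \<in> tangent_pairs x (\<xi> m) n)"
    using forms_derivative[OF add.hyps(2)] K_pol(1) by blast
  from bchoice[OF this] obtain a' where a': "\<And>m. m \<in> K \<Longrightarrow> a' m \<in> pforms I"
    "\<And>m \<tau>. m \<in> K \<Longrightarrow> (\<lambda>s. a s \<tau>, \<lambda>s. a' m s \<tau>) \<in> tangent_pairs x (\<xi> m) n"
    by blast
  have "\<forall>m\<in>K. \<exists>b'. b' \<in> pforms J \<and> (\<forall>\<tau>. (\<lambda>s. b s \<tau>, \<lambda>s. b' s \<tau>) \<in> tangent_pairs x (\<xi> m) n)"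
    using forms_derivative[OF add.hyps(3)] K_pol(1) by blast
  from bchoice[OF this] obtain b' where b': "\<And>m. m \<in> K \<Longrightarrow> b' m \<in> pforms J"
    "\<And>m \<tau>. m \<in> K \<Longrightarrow> (\<lambda>s. b s \<tau>, \<lambda>s. b' m s \<tau>) \<in> tangent_pairs x (\<xi> m) n"
    by blast
  have i': "i \<notin> I" "i \<notin> J"
    using i add.hyps(7) by auto
  define a1 where "a1 = (\<lambda>s \<tau>. \<Sum>m\<in>K. coord m (\<tau> i) * (h s * a' m s \<tau> - h' m s * a s \<tau>))"
  define b1 where "b1 = (\<lambda>s \<tau>. \<Sum>m\<in>K. coord m (\<tau> i) * b' m s \<tau>)"
  have a1: "a1 \<in> pforms (insert i I)"
    unfolding a1_def
    by (intro forms_sum forms_linear_mult lin forms_diff forms_scale h K_pol a' add.hyps i')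
  have b1: "b1 \<in> pforms (insert i J)"
    unfolding b1_def by (intro forms_sum forms_linear_mult lin b' i')
  have ha: "(\<lambda>s \<tau>. h s * a s \<tau>) \<in> pforms I"
    by (intro forms_scale h add.hyps)
  have "split_sum (insert i A) (Suc (2 * c)) (\<lambda>s \<tau>.
      (\<Sum>m\<in>K. coord m (\<tau> i) * (h s * \<Phi>' m s \<tau> - h' m s * \<Phi> s \<tau>)) + a1 s \<tau> * b s \<tau>)"
    by (rule split_sum.add[OF split a1 add.hyps(3)]) (use i' add.hyps in auto)
  from split_sum.add[OF this ha b1]
  have "split_sum (insert i A) (Suc (Suc (2 * c))) (\<lambda>s \<tau>.
      (\<Sum>m\<in>K. coord m (\<tau> i) * (h s * \<Phi>' m s \<tau> - h' m s * \<Phi> s \<tau>)) + a1 s \<tau> * b s \<tau> + h s * a s \<tau> * b1 s \<tau>)"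
    using i' add.hyps by auto
  also have "(\<lambda>s \<tau>. (\<Sum>m\<in>K. coord m (\<tau> i) * (h s * \<Phi>' m s \<tau> - h' m s * \<Phi> s \<tau>)) + a1 s \<tau> * b s \<tau> + h s * a s \<tau> * b1 s \<tau>) =
     (\<lambda>s \<tau>. \<Sum>m\<in>K. coord m (\<tau> i) * (h s * (\<Phi>' m s \<tau> + (a' m s \<tau> * b s \<tau> + a s \<tau> * b' m s \<tau>)) - h' m s * (\<Phi> s \<tau> + a s \<tau> * b s \<tau>)))"
    unfolding a1_def b1_def sum_distrib_left sum_distrib_right sum.distrib[symmetric]
    by (intro ext sum.cong) (auto simp: algebra_simps)
  finally have "split_sum (insert i A) (2 * Suc c) \<dots>"
    by simp
  moreover have "(\<lambda>s. \<Phi> s \<tau> + a s \<tau> * b s \<tau>, \<lambda>s. \<Phi>' m s \<tau> + (a' m s \<tau> * b s \<tau> + a s \<tau> * b' m s \<tau>)) \<in> tangent_pairs x (\<xi> m) n"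
    if "m \<in> K" for m \<tau>
    by (intro tangent_pairs.add tangent_pairs.mult \<Phi>' a' b' that)
  ultimately show ?case
    by (intro exI[of _ "\<lambda>m s \<tau>. \<Phi>' m s \<tau> + (a' m s \<tau> * b s \<tau> + a s \<tau> * b' m s \<tau>)"] conjI ballI allI)
qed

text \<open>
  Products that are zero have no Schmidt rank one and are dropped.
\<close>

lemma split_sum_rank_one_terms:
  assumes "split_sum {1..d} c \<Phi>"
  shows "\<exists>r Q. r \<le> c \<and> (\<forall>i<r. schmidt_rank_one scale d V (Q i)) \<and>
    (\<forall>v\<in>PiE {1..d} V. \<kappa> * \<Phi> s v = (\<Sum>i<r. Q i v))"
  using assms
proof induction
  case zero
  show ?case
    by (intro exI[of _ 0]) simp
next
  case (add c \<Phi> a I b J)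
  then obtain r Q where Q: "r \<le> c" "\<And>i. i < r \<Longrightarrow> schmidt_rank_one scale d V (Q i)"
    "\<And>v. v \<in> PiE {1..d} V \<Longrightarrow> \<kappa> * \<Phi> s v = (\<Sum>i<r. Q i v)"
    by blast
  show ?case
  proof (cases "\<exists>v\<in>PiE {1..d} V. \<kappa> * (a s v * b s v) \<noteq> 0")
    case False
    have "\<kappa> * (\<Phi> s v + a s v * b s v) = (\<Sum>i<r. Q i v)" if "v \<in> PiE {1..d} V" for v
    proof -
      have "\<kappa> * (a s v * b s v) = 0"
        using False that by blast
      then show ?thesis
        using Q(3)[OF that] by (simp only: distrib_left) simp
    qed
    then show ?thesis
      using Q(1,2) le_SucI by blast
  next
    case True
    have "polylinear_form scale I V (\<lambda>v. \<kappa> * a s v)" "polylinear_form scale J V (b s)"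
      using add.hyps by (auto intro: polylinear_form_cmult forms_polylinear)
    moreover have "\<kappa> * (a s v * b s v) = \<kappa> * a s (restrict v I) * b s (restrict v J)" for v
      using forms_restrict[OF add.hyps(2)] forms_restrict[OF add.hyps(3)] by simp
    ultimately have one: "schmidt_rank_one scale d V (\<lambda>v. \<kappa> * (a s v * b s v))"
      unfolding schmidt_rank_one_def using True add.hyps(4-7) by blast
    define Q' where "Q' = Q(r := (\<lambda>v. \<kappa> * (a s v * b s v)))"
    have "schmidt_rank_one scale d V (Q' i)" if "i < Suc r" for i
      using that one Q(2) by (auto simp: Q'_def less_Suc_eq)
    moreover have "\<kappa> * (\<Phi> s v + a s v * b s v) = (\<Sum>i<Suc r. Q' i v)" if "v \<in> PiE {1..d} V" for v
      using Q(3)[OF that] by (simp add: Q'_def distrib_left)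
    ultimately show ?thesis
      using Q(1) by (metis Suc_le_mono)
  qed
qed

end

end

section \<open>Decomposition at a generic point of the degeneracy locus\<close>

text \<open>
  Coordinates with index below \<open>n0\<close> are parameters on which the coefficients of \<open>P\<close> depend, those from
  \<open>n0\<close> to \<open>n1\<close> belong to the slots \<open>2..d-1\<close>, and those from \<open>n1\<close> to \<open>N\<close> to the slot \<open>d\<close>. A point \<open>s\<close> has
  the coordinates \<open>x n s\<close> with respect to the basis vectors \<open>e n\<close> of the slots. The generic point lies
  in the degeneracy locus of \<open>P\<close>.
\<close>

locale generic_point = polylinear_forms scale V + ultrafilter U
  for scale :: "'k::field \<Rightarrow> 'v::ab_group_add \<Rightarrow> 'v" and V :: "nat \<Rightarrow> 'v set"
    and U :: "(nat \<Rightarrow> 'v) filter" +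
  fixes d n0 n1 N :: nat and slot :: "nat \<Rightarrow> nat" and e :: "nat \<Rightarrow> 'v" and coord :: "nat \<Rightarrow> 'v \<Rightarrow> 'k"
    and x :: "nat \<Rightarrow> (nat \<Rightarrow> 'v) \<Rightarrow> 'k" and P :: "(nat \<Rightarrow> 'v) \<Rightarrow> (nat \<Rightarrow> 'v) \<Rightarrow> 'k"
  assumes d: "2 \<le> d"
    and n_le: "n0 \<le> n1" "n1 \<le> N"
    and slot_base: "n \<in> {n0..<n1} \<Longrightarrow> slot n \<in> {2..<d}"
    and slot_fibre: "n \<in> {n1..<N} \<Longrightarrow> slot n = d"
    and e_mem: "n \<in> {n0..<N} \<Longrightarrow> e n \<in> V (slot n)"
    and linear_functional: "n \<in> {n0..<N} \<Longrightarrow> Vector_Spaces.linear scale (*) (coord n)"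
    and V_subspace: "i \<in> {1..d} \<Longrightarrow> subspace (V i)"
    and coordinates: "i \<in> {2..d} \<Longrightarrow> v \<in> V i \<Longrightarrow>
      v = (\<Sum>n | n \<in> {n0..<N} \<and> slot n = i. scale (coord n v) (e n))"
    and x_coordinate: "n \<in> {n0..<N} \<Longrightarrow> x n s = coord n (s (slot n))"
    and P_form: "P \<in> forms (pol x n0) {1..d}"
    and degenerate: "eventually (\<lambda>s. s \<in> PiE {2..d} V \<and> (\<forall>y\<in>V 1. P s (s(1 := y)) = 0)) U"
begin

definition slot_indices :: "nat \<Rightarrow> nat set" where
  "slot_indices i = {n. n \<in> {n0..<N} \<and> slot n = i}"

lemma finite_slot_indices: "finite (slot_indices i)"
  by (simp add: slot_indices_def)

lemma slot_indices_base:
  assumes "i < d"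
  shows "slot_indices i = {n. n \<in> {n0..<n1} \<and> slot n = i}"
proof -
  have "n < n1" if "n < N" "slot n = i" for n
    using that assms slot_fibre[of n] by (cases "n < n1") auto
  then show ?thesis
    using n_le by (auto simp: slot_indices_def)
qed

lemma slot_indices_fibre: "slot_indices d = {n1..<N}"
proof
  have "n1 \<le> n" if "n0 \<le> n" "slot n = d" for n
    using that slot_base[of n] by (cases "n < n1") auto
  then show "slot_indices d \<subseteq> {n1..<N}"
    by (auto simp: slot_indices_def)
  show "{n1..<N} \<subseteq> slot_indices d"
  proof
    fix n assume n: "n \<in> {n1..<N}"
    then show "n \<in> slot_indices d"
      using slot_fibre[OF n] n_le(1) by (simp add: slot_indices_def)
  qed
qed

lemma e_slot_indices: "n \<in> slot_indices i \<Longrightarrow> e n \<in> V i"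
  using e_mem by (auto simp: slot_indices_def)

lemma forms_coordinates:
  assumes a: "a \<in> forms R A" and i: "i \<in> A" "i \<in> {2..d}" and \<tau>: "\<And>j. j \<in> A \<Longrightarrow> \<tau> j \<in> V j"
  shows "a s \<tau> = (\<Sum>n\<in>slot_indices i. coord n (\<tau> i) * a s (\<tau>(i := e n)))"
proof -
  have "\<tau> i = (\<Sum>n\<in>slot_indices i. scale (coord n (\<tau> i)) (e n))"
    unfolding slot_indices_def by (rule coordinates) (use i \<tau> in auto)
  then have "a s \<tau> = a s (\<tau>(i := \<Sum>n\<in>slot_indices i. scale (coord n (\<tau> i)) (e n)))"
    by (metis fun_upd_triv)
  also have "\<dots> = (\<Sum>n\<in>slot_indices i. coord n (\<tau> i) * a s (\<tau>(i := e n)))"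
    using i(2) by (intro forms_expand[OF a \<tau> i(1) V_subspace] e_slot_indices) auto
  finally show ?thesis .
qed

text \<open>
  Puts the component \<open>s i\<close> of the point into the slot \<open>i\<close>, written as a linear combination of basis
  vectors to show that the coefficients are polynomials.
\<close>

definition substitute :: "nat \<Rightarrow> ((nat \<Rightarrow> 'v) \<Rightarrow> (nat \<Rightarrow> 'v) \<Rightarrow> 'k) \<Rightarrow> (nat \<Rightarrow> 'v) \<Rightarrow> (nat \<Rightarrow> 'v) \<Rightarrow> 'k" where
  "substitute i Q = (\<lambda>s \<tau>. \<Sum>n\<in>slot_indices i. x n s * Q s (\<tau>(i := e n)))"

lemma substitute_form:
  assumes "Q \<in> forms (pol x n1) A" "i \<in> A" "i < d"
  shows "substitute i Q \<in> forms (pol x n1) (A - {i})"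
  unfolding substitute_def
proof (intro forms_sum forms_scale forms_fix_slot assms)
  fix n assume n: "n \<in> slot_indices i"
  then show "x n \<in> pol x n1"
    using slot_indices_base[OF assms(3)] by (intro pol.var) auto
  show "e n \<in> V i"
    using n by (rule e_slot_indices)
qed

primrec substitute_last :: "nat \<Rightarrow> (nat \<Rightarrow> 'v) \<Rightarrow> (nat \<Rightarrow> 'v) \<Rightarrow> 'k" where
  "substitute_last 0 = P"
| "substitute_last (Suc j) = substitute (d - 1 - j) (substitute_last j)"

text \<open>
  The form \<open>P\<close> with the slots between \<open>t\<close> and \<open>d\<close> filled by the point (\<open>partial_value\<close>). The slots
  \<open>1, \<dots>, t\<close> and \<open>d\<close> remain free.
\<close>

definition partial :: "nat \<Rightarrow> (nat \<Rightarrow> 'v) \<Rightarrow> (nat \<Rightarrow> 'v) \<Rightarrow> 'k" where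
  "partial t = substitute_last (d - 1 - t)"

definition slots :: "nat \<Rightarrow> nat set" where
  "slots t = insert d {1..t}"

lemma partial_top: "partial (d - 1) = P"
  by (simp add: partial_def)

lemma partial_Suc: "Suc t < d \<Longrightarrow> partial t = substitute (Suc t) (partial (Suc t))"
proof -
  assume "Suc t < d"
  then have "d - 1 - t = Suc (d - 1 - Suc t)" "d - 1 - (d - 1 - Suc t) = Suc t"
    by auto
  then show ?thesis
    unfolding partial_def by simp
qed

lemma slots_Suc: "Suc t < d \<Longrightarrow> slots (Suc t) - {Suc t} = slots t" "slots (Suc t) = insert (Suc t) (slots t)"
  by (auto simp: slots_def)

lemma slots_top: "slots (d - 1) = {1..d}"
  using d by (auto simp: slots_def)

lemma P_form_base: "P \<in> forms (pol x n1) {1..d}"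
  using forms_mono[OF P_form] pol_mono[OF _ n_le(1)] by blast

lemma partial_form:
  assumes "t \<le> d - 1"
  shows "partial t \<in> forms (pol x n1) (slots t)"
  using assms
proof (induction rule: inc_induct)
  case base
  show ?case
    using P_form_base by (simp only: partial_top slots_top)
next
  case (step t)
  then have "Suc t < d"
    by simp
  then show ?case
    using substitute_form[OF step.IH, of "Suc t"] slots_Suc[of t] by (simp add: partial_Suc)
qed

text \<open>
  \<open>Z n\<close> is the partial derivative of \<open>partial t\<close> with respect to the coordinate \<open>x n\<close>. Since \<open>P\<close> is linear
  in each slot, \<open>Z n\<close> is \<open>partial t\<close> with \<open>e n\<close> in the slot of \<open>n\<close>, and this is spelled out for the slot
  \<open>Suc t\<close>, the one to be freed next.
\<close>

definition gradient :: "nat \<Rightarrow> (nat \<Rightarrow> (nat \<Rightarrow> 'v) \<Rightarrow> (nat \<Rightarrow> 'v) \<Rightarrow> 'k) \<Rightarrow> bool" where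
  "gradient t Z \<longleftrightarrow>
    (\<forall>n. n \<in> {n0..<n1} \<longrightarrow> t < slot n \<longrightarrow> Z n \<in> forms (pol x n1) (slots t)) \<and>
    (\<forall>n. n \<in> {n0..<n1} \<longrightarrow> slot n = Suc t \<longrightarrow> Z n = (\<lambda>s \<tau>. partial (Suc t) s (\<tau>(Suc t := e n)))) \<and>
    (\<forall>\<xi> \<tau>. (\<forall>l<n0. \<xi> l = (\<lambda>_. 0)) \<longrightarrow>
      (\<lambda>s. partial t s \<tau>, \<lambda>s. \<Sum>n | n \<in> {n0..<n1} \<and> t < slot n. \<xi> n s * Z n s \<tau>) \<in> tangent_pairs x \<xi> n1)"

lemma gradient_exists:
  assumes "t \<le> d - 1"
  shows "\<exists>Z. gradient t Z"
  using assms
proof (induction rule: inc_induct)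
  case base
  have slot_le: "\<not> d - 1 < slot n" if "n \<in> {n0..<n1}" for n
    using slot_base[OF that] by auto
  then have "{n. n \<in> {n0..<n1} \<and> d - 1 < slot n} = {}"
    by blast
  then have "(\<lambda>s. P s \<tau>, \<lambda>s. \<Sum>n | n \<in> {n0..<n1} \<and> d - 1 < slot n. \<xi> n s * 0) \<in> tangent_pairs x \<xi> n1"
    if "\<forall>l<n0. \<xi> l = (\<lambda>_. 0)" for \<xi> \<tau>
    using tangent_pairs_constant[OF forms_value_pol[OF P_form] n_le(1)] that by simp
  then show ?case
    unfolding gradient_def partial_top
  proof (intro exI[of _ "\<lambda>_ _ _. 0"] conjI allI impI)
    fix n assume "n \<in> {n0..<n1}" "slot n = Suc (d - 1)"
    then have False
      using slot_le[of n] by simp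
    then show "(\<lambda>_ _. 0) = (\<lambda>s \<tau>. partial (Suc (d - 1)) s (\<tau>(Suc (d - 1) := e n)))" ..
  qed (rule forms.zero)
next
  case (step t)
  then have t: "Suc t < d"
    by simp
  from step.IH obtain Z where "gradient (Suc t) Z" ..
  then have Z:
    "\<And>n. n \<in> {n0..<n1} \<Longrightarrow> Suc t < slot n \<Longrightarrow> Z n \<in> forms (pol x n1) (slots (Suc t))"
    "\<And>\<xi> \<tau>. (\<forall>l<n0. \<xi> l = (\<lambda>_. 0)) \<Longrightarrow> (\<lambda>s. partial (Suc t) s \<tau>,
      \<lambda>s. \<Sum>n | n \<in> {n0..<n1} \<and> Suc t < slot n. \<xi> n s * Z n s \<tau>) \<in> tangent_pairs x \<xi> n1"
    unfolding gradient_def by simp_all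
  define Z' where "Z' n = (if slot n = Suc t then \<lambda>s \<tau>. partial (Suc t) s (\<tau>(Suc t := e n))
    else substitute (Suc t) (Z n))" for n
  have si: "slot_indices (Suc t) = {n. n \<in> {n0..<n1} \<and> slot n = Suc t}"
    by (rule slot_indices_base[OF t])
  have "Z' n \<in> forms (pol x n1) (slots t)" if n: "n \<in> {n0..<n1}" "t < slot n" for n
  proof (cases "slot n = Suc t")
    case True
    then have n_si: "n \<in> slot_indices (Suc t)"
      using n si by simp
    have "Suc t \<le> d - 1" "Suc t \<in> slots (Suc t)"
      using t by (auto simp: slots_def)
    from forms_fix_slot[OF partial_form[OF this(1)] this(2) e_slot_indices[OF n_si]] True show ?thesis
      unfolding slots_Suc(1)[OF t] by (simp add: Z'_def)
  next
    case False
    then show ?thesis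
      using substitute_form[OF Z(1), of n "Suc t"] n t slots_Suc[of t] by (simp add: Z'_def)
  qed
  moreover have "(\<lambda>s. partial t s \<tau>, \<lambda>s. \<Sum>n | n \<in> {n0..<n1} \<and> t < slot n. \<xi> n s * Z' n s \<tau>)
      \<in> tangent_pairs x \<xi> n1" if \<xi>: "\<forall>l<n0. \<xi> l = (\<lambda>_. 0)" for \<xi> \<tau>
  proof -
    define B where "B = {n. n \<in> {n0..<n1} \<and> Suc t < slot n}"
    have "(\<lambda>s. \<Sum>m\<in>slot_indices (Suc t). x m s * partial (Suc t) s (\<tau>(Suc t := e m)),
        \<lambda>s. \<Sum>m\<in>slot_indices (Suc t). \<xi> m s * partial (Suc t) s (\<tau>(Suc t := e m)) +
          x m s * (\<Sum>n\<in>B. \<xi> n s * Z n s (\<tau>(Suc t := e m)))) \<in> tangent_pairs x \<xi> n1"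
      unfolding B_def
      by (intro tangent_pairs_sum tangent_pairs.mult tangent_pairs.var Z(2) \<xi>) (simp add: si)
    also have "(\<lambda>s. \<Sum>m\<in>slot_indices (Suc t). x m s * partial (Suc t) s (\<tau>(Suc t := e m))) =
        (\<lambda>s. partial t s \<tau>)"
      unfolding partial_Suc[OF t] by (simp add: substitute_def)
    also have "(\<lambda>s. \<Sum>m\<in>slot_indices (Suc t). \<xi> m s * partial (Suc t) s (\<tau>(Suc t := e m)) +
          x m s * (\<Sum>n\<in>B. \<xi> n s * Z n s (\<tau>(Suc t := e m)))) =
        (\<lambda>s. \<Sum>n | n \<in> {n0..<n1} \<and> t < slot n. \<xi> n s * Z' n s \<tau>)"
    proof
      fix s
      have split: "{n. n \<in> {n0..<n1} \<and> t < slot n} = slot_indices (Suc t) \<union> B"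
        "slot_indices (Suc t) \<inter> B = {}" "finite B"
        by (auto simp: si B_def)
      have "(\<Sum>n | n \<in> {n0..<n1} \<and> t < slot n. \<xi> n s * Z' n s \<tau>) =
          (\<Sum>n\<in>slot_indices (Suc t). \<xi> n s * Z' n s \<tau>) + (\<Sum>n\<in>B. \<xi> n s * Z' n s \<tau>)"
        unfolding split(1) by (rule sum.union_disjoint[OF finite_slot_indices split(3,2)])
      also have "(\<Sum>n\<in>slot_indices (Suc t). \<xi> n s * Z' n s \<tau>) =
          (\<Sum>m\<in>slot_indices (Suc t). \<xi> m s * partial (Suc t) s (\<tau>(Suc t := e m)))"
        by (intro sum.cong) (auto simp: Z'_def si)
      also have "(\<Sum>n\<in>B. \<xi> n s * Z' n s \<tau>) =
          (\<Sum>n\<in>B. \<Sum>m\<in>slot_indices (Suc t). x m s * (\<xi> n s * Z n s (\<tau>(Suc t := e m))))"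
        by (intro sum.cong) (auto simp: Z'_def B_def substitute_def sum_distrib_left mult_ac)
      also have "\<dots> = (\<Sum>m\<in>slot_indices (Suc t). x m s * (\<Sum>n\<in>B. \<xi> n s * Z n s (\<tau>(Suc t := e m))))"
        by (subst sum.swap) (simp add: sum_distrib_left)
      finally show "(\<Sum>m\<in>slot_indices (Suc t). \<xi> m s * partial (Suc t) s (\<tau>(Suc t := e m)) +
          x m s * (\<Sum>n\<in>B. \<xi> n s * Z n s (\<tau>(Suc t := e m)))) =
          (\<Sum>n | n \<in> {n0..<n1} \<and> t < slot n. \<xi> n s * Z' n s \<tau>)"
        by (simp add: sum.distrib del: fun_upd_apply)
    qed
    finally show ?thesis .
  qed
  moreover have "Z' n = (\<lambda>s \<tau>. partial (Suc t) s (\<tau>(Suc t := e n)))" if "slot n = Suc t" for n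
    using that by (simp add: Z'_def)
  ultimately show ?case
    unfolding gradient_def by (intro exI[of _ Z'] conjI allI impI)
qed

lemma partial_value:
  assumes "1 \<le> t" "t \<le> d - 1" and s: "s \<in> PiE {2..d} V" and \<tau>: "\<And>i. i \<in> slots t \<Longrightarrow> \<tau> i \<in> V i"
  shows "partial t s \<tau> = P s (\<lambda>i. if t < i \<and> i < d then s i else \<tau> i)"
  using assms(2,1) \<tau>
proof (induction arbitrary: \<tau> rule: inc_induct)
  case base
  have "(\<lambda>i. if d - 1 < i \<and> i < d then s i else \<tau> i) = \<tau>"
  proof
    fix i
    have "\<not> (d - 1 < i \<and> i < d)"
      by linarith
    then show "(if d - 1 < i \<and> i < d then s i else \<tau> i) = \<tau> i"
      by (rule if_not_P)
  qed
  then show ?case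
    by (simp only: partial_top)
next
  case (step t)
  then have t: "Suc t < d" "Suc t \<in> {2..d}"
    by auto
  define \<tau>' where "\<tau>' = \<tau>(Suc t := s (Suc t))"
  have \<tau>': "\<tau>' i \<in> V i" if "i \<in> slots (Suc t)" for i
    using that step.prems(2) s t by (auto simp: \<tau>'_def slots_Suc(2) PiE_iff)
  have "partial t s \<tau> = (\<Sum>n\<in>slot_indices (Suc t). coord n (\<tau>' (Suc t)) * partial (Suc t) s (\<tau>'(Suc t := e n)))"
    unfolding partial_Suc[OF t(1)] substitute_def
    by (intro sum.cong) (auto simp: x_coordinate slot_indices_def \<tau>'_def)
  also have "\<dots> = partial (Suc t) s \<tau>'"
    using t by (intro forms_coordinates[OF partial_form, symmetric] \<tau>') (auto simp: slots_def)
  also have "\<dots> = P s (\<lambda>i. if Suc t < i \<and> i < d then s i else \<tau>' i)"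
    using step.prems by (intro step.IH \<tau>') auto
  also have "(\<lambda>i. if Suc t < i \<and> i < d then s i else \<tau>' i) = (\<lambda>i. if t < i \<and> i < d then s i else \<tau> i)"
    using t by (auto simp: \<tau>'_def fun_eq_iff)
  finally show ?case .
qed

text \<open>
  Gaussian elimination on the columns \<open>Q(\<cdot>, e n)\<close>, from the last to the first. If column \<open>k\<close> is nonzero
  in some row \<open>\<tau>0\<close>, then the vanishing of that row at the generic point is a linear relation for \<open>x k\<close>
  over the preceding coordinates, so \<open>x k\<close> is algebraic and pays for the product that clears the
  column.
\<close>

lemma elimination:
  assumes "n1 \<le> k" "k \<le> N" "Q \<in> forms (pol x n1) {1, d}"
    and "\<And>n \<tau>. n \<in> {k..<N} \<Longrightarrow> \<tau> \<in> PiE {1..d} V \<Longrightarrow> null (\<lambda>s. Q s (\<tau>(d := e n)))"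
    and "\<And>\<tau>. \<tau> \<in> PiE {1..d} V \<Longrightarrow> null (\<lambda>s. \<Sum>n\<in>{n1..<k}. x n s * Q s (\<tau>(d := e n)))"
  shows "\<exists>h \<Phi> c. h \<in> pol x n1 \<and> \<not> null h \<and> split_sum x n1 {1, d} c \<Phi> \<and>
    c \<le> card {n \<in> {n1..<k}. algebraic x n} \<and> (\<forall>\<tau>\<in>PiE {1..d} V. null (\<lambda>s. h s * Q s \<tau> - \<Phi> s \<tau>))"
  using assms
proof (induction k arbitrary: Q rule: dec_induct)
  case base
  have "null (\<lambda>s. Q s \<tau>)" if \<tau>: "\<tau> \<in> PiE {1..d} V" for \<tau>
  proof -
    have eq: "Q s \<tau> = (\<Sum>n\<in>{n1..<N}. coord n (\<tau> d) * Q s (\<tau>(d := e n)))" for s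
      unfolding slot_indices_fibre[symmetric]
      by (rule forms_coordinates[OF base(2)]) (use \<tau> d in auto)
    show ?thesis
      unfolding eq by (intro null_sum null_mult_left base(3)[OF _ \<tau>])
  qed
  then show ?case
    by (intro exI[of _ "\<lambda>_. 1"] exI[of _ "\<lambda>_ _. 0"] exI[of _ 0]) (simp add: split_sum.zero pol.const)
next
  case (step k)
  have card_split: "card {n \<in> {n1..<Suc k}. algebraic x n} =
      card {n \<in> {n1..<k}. algebraic x n} + (if algebraic x k then 1 else 0)"
  proof -
    have "{n \<in> {n1..<Suc k}. algebraic x n} =
      (if algebraic x k then insert k {n \<in> {n1..<k}. algebraic x n} else {n \<in> {n1..<k}. algebraic x n})"
      using step.hyps by (auto simp: less_Suc_eq)
    then show ?thesis by simp
  qed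
  have kN: "k \<in> {n1..<N}"
    using step by simp
  have ek: "e k \<in> V d"
    using kN slot_indices_fibre by (intro e_slot_indices) simp
  have rel: "null (\<lambda>s. (\<Sum>n\<in>{n1..<k}. x n s * Q s (\<tau>(d := e n))) + x k s * Q s (\<tau>(d := e k)))"
    if "\<tau> \<in> PiE {1..d} V" for \<tau>
    using step.prems(4)[OF that] step.hyps by (simp del: fun_upd_apply)
  show ?case
  proof (cases "\<forall>\<tau>\<in>PiE {1..d} V. null (\<lambda>s. Q s (\<tau>(d := e k)))")
    case True
    have later: "null (\<lambda>s. Q s (\<tau>(d := e n)))" if "n \<in> {k..<N}" "\<tau> \<in> PiE {1..d} V" for n \<tau>
      using True step.prems(3)[of n] that by (cases "n = k") (auto simp del: fun_upd_apply)
    have rel': "null (\<lambda>s. \<Sum>n\<in>{n1..<k}. x n s * Q s (\<tau>(d := e n)))" if "\<tau> \<in> PiE {1..d} V" for \<tau>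
      using rel[OF that] bspec[OF True that] unfolding null_def by eventually_elim simp
    from step.IH[OF _ step.prems(2) later rel'] kN
    obtain h \<Phi> c where "h \<in> pol x n1" "\<not> null h" "split_sum x n1 {1, d} c \<Phi>"
      "c \<le> card {n \<in> {n1..<k}. algebraic x n}" "\<forall>\<tau>\<in>PiE {1..d} V. null (\<lambda>s. h s * Q s \<tau> - \<Phi> s \<tau>)"
      by fastforce
    then show ?thesis
      using card_split by (intro exI[of _ h] exI[of _ \<Phi>] exI[of _ c]) auto
  next
    case False
    then obtain \<tau>0 where \<tau>0: "\<tau>0 \<in> PiE {1..d} V" "\<not> null (\<lambda>s. Q s (\<tau>0(d := e k)))"
      by blast
    define u where "u = (\<lambda>s. Q s (\<tau>0(d := e k)))"
    define a where "a = (\<lambda>s \<tau>. Q s (\<tau>(d := e k)))"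
    define b where "b = (\<lambda>s \<tau>. Q s (\<tau>(1 := \<tau>0 1)))"
    have u: "u \<in> pol x n1"
      unfolding u_def using step.prems(2) by (rule forms_value_pol)
    have \<tau>01: "\<tau>0 1 \<in> V 1"
      using \<tau>0(1) d by auto
    have set1: "{1, d} - {d} = {1}" and set2: "{1, d} - {1} = {d}"
      using d by auto
    have a: "a \<in> forms (pol x n1) {1}"
      unfolding a_def using forms_fix_slot[OF step.prems(2) _ ek] set1 by (simp del: fun_upd_apply)
    have b: "b \<in> forms (pol x n1) {d}"
      unfolding b_def using forms_fix_slot[OF step.prems(2) _ \<tau>01] set2 by (simp del: fun_upd_apply)
    have b_e: "b s (\<tau>(d := w)) = Q s (\<tau>0(d := w))" for s \<tau> w
      unfolding b_def by (rule forms_cong[OF step.prems(2)]) (use d in auto)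
    have a_e: "a s (\<tau>(d := w)) = a s \<tau>" for s \<tau> w
      by (simp add: a_def)
    have alg: "algebraic x k"
      unfolding algebraic_def
    proof (intro exI conjI allI impI)
      let ?F = "\<lambda>i::nat. if i = 0 then (\<lambda>s. \<Sum>n\<in>{n1..<k}. x n s * Q s (\<tau>0(d := e n))) else u"
      show "?F i \<in> pol x k" for i
        using step.hyps pol_mono[OF u] pol_mono[OF forms_value_pol[OF step.prems(2)], of k]
        by (auto intro!: pol_closed)
      show "\<not> null (?F 1)"
        using \<tau>0(2) by (simp add: u_def)
      show "null (\<lambda>s. \<Sum>i\<le>1. ?F i s * x k s ^ i)"
        using rel[OF \<tau>0(1)] by (simp add: u_def mult.commute)
    qed
    \<comment> \<open>Subtracting a multiple of the row \<open>\<tau>0\<close> clears column \<open>k\<close>.\<close>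
    define Q' where "Q' = (\<lambda>s \<tau>. u s * Q s \<tau> - a s \<tau> * b s \<tau>)"
    have "(\<lambda>s \<tau>. a s \<tau> * b s \<tau>) \<in> forms (pol x n1) ({1} \<union> {d})"
      by (rule forms_mult[OF a b]) (use d in auto)
    then have Q': "Q' \<in> forms (pol x n1) {1, d}"
      unfolding Q'_def by (intro forms_diff forms_scale u step.prems) (simp add: insert_commute)
    have Q'_e: "Q' s (\<tau>(d := e n)) = u s * Q s (\<tau>(d := e n)) - a s \<tau> * Q s (\<tau>0(d := e n))" for s \<tau> n
      by (simp add: Q'_def b_e a_e)
    have later: "null (\<lambda>s. Q' s (\<tau>(d := e n)))" if n: "n \<in> {k..<N}" "\<tau> \<in> PiE {1..d} V" for n \<tau>
    proof (cases "n = k")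
      case True
      then show ?thesis
        unfolding Q'_e by (simp add: a_def u_def mult.commute)
    next
      case False
      then have "null (\<lambda>s. Q s (\<tau>(d := e n)))" "null (\<lambda>s. Q s (\<tau>0(d := e n)))"
        using n \<tau>0(1) step.prems(3) by (auto simp del: fun_upd_apply)
      then show ?thesis
        unfolding Q'_e by (intro null_diff null_mult_left)
    qed
    have rel': "null (\<lambda>s. \<Sum>n\<in>{n1..<k}. x n s * Q' s (\<tau>(d := e n)))" if \<tau>: "\<tau> \<in> PiE {1..d} V" for \<tau>
      using rel[OF \<tau>] rel[OF \<tau>0(1)] unfolding null_def
    proof eventually_elim
      case (elim s)
      have "(\<Sum>n\<in>{n1..<k}. x n s * Q' s (\<tau>(d := e n))) =
          u s * (\<Sum>n\<in>{n1..<k}. x n s * Q s (\<tau>(d := e n))) -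
          a s \<tau> * (\<Sum>n\<in>{n1..<k}. x n s * Q s (\<tau>0(d := e n)))"
        unfolding Q'_e sum_distrib_left sum_subtractf[symmetric]
        by (intro sum.cong) (auto simp: algebra_simps)
      also have "\<dots> = u s * (- (x k s * a s \<tau>)) - a s \<tau> * (- (x k s * u s))"
        using elim by (simp add: add_eq_0_iff a_def u_def)
      finally show ?case
        by (simp add: mult_ac)
    qed
    from step.IH[OF _ Q' later rel'] kN
    obtain h \<Phi> c where h: "h \<in> pol x n1" "\<not> null h" "split_sum x n1 {1, d} c \<Phi>"
      "c \<le> card {n \<in> {n1..<k}. algebraic x n}" "\<And>\<tau>. \<tau> \<in> PiE {1..d} V \<Longrightarrow> null (\<lambda>s. h s * Q' s \<tau> - \<Phi> s \<tau>)"
      by fastforce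
    have ha: "(\<lambda>s \<tau>. h s * a s \<tau>) \<in> forms (pol x n1) {1}"
      by (intro forms_scale h a)
    have "split_sum x n1 {1, d} (Suc c) (\<lambda>s \<tau>. \<Phi> s \<tau> + h s * a s \<tau> * b s \<tau>)"
      by (rule split_sum.add[OF h(3) ha b]) (use d in auto)
    moreover have "null (\<lambda>s. h s * u s * Q s \<tau> - (\<Phi> s \<tau> + h s * a s \<tau> * b s \<tau>))" if "\<tau> \<in> PiE {1..d} V" for \<tau>
      using h(5)[OF that] by (simp add: Q'_def algebra_simps)
    moreover have "(\<lambda>s. h s * u s) \<in> pol x n1" "\<not> null (\<lambda>s. h s * u s)"
      using h(1,2) u \<tau>0(2) by (auto simp: null_mult_iff u_def intro: pol.mult)
    moreover have "Suc c \<le> card {n \<in> {n1..<Suc k}. algebraic x n}"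
      using h(4) card_split alg by simp
    ultimately show ?thesis
      by blast
  qed
qed

text \<open>
  Differentiate \<open>h * partial t = \<Phi>\<close> along the fields \<open>\<xi> m\<close> for the coordinates \<open>m\<close> of the slot
  \<open>i = Suc t\<close> outside \<open>J\<close>, and add up with the weights \<open>coord m (\<tau> i)\<close>. The field \<open>\<xi> m\<close> moves \<open>x m\<close> by \<open>\<Delta>\<close>,
  which contributes \<open>partial i\<close> times \<open>\<Delta>\<close>, apart from the coordinates of slot \<open>i\<close> in \<open>J\<close>; otherwise it
  moves only coordinates \<open>n\<close> in \<open>J\<close>, each of which contributes \<open>Z n\<close> with a factor depending on \<open>\<tau> i\<close>
  alone.
\<close>

lemma differentiation:
  assumes frame: "frame x n1 n0 n1 J \<Delta> \<xi>" "J \<subseteq> {n0..<n1}" and t: "1 \<le> t" "Suc t < d"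
    and h: "h \<in> pol x n1" "\<not> null h" and \<Phi>: "split_sum x n1 (slots t) c \<Phi>"
    and eq: "\<And>\<tau>. \<tau> \<in> PiE {1..d} V \<Longrightarrow> null (\<lambda>s. h s * partial t s \<tau> - \<Phi> s \<tau>)"
  shows "\<exists>h \<Phi> c'. h \<in> pol x n1 \<and> \<not> null h \<and> split_sum x n1 (slots (Suc t)) c' \<Phi> \<and>
    c' \<le> 2 * c + card J \<and> (\<forall>\<tau>\<in>PiE {1..d} V. null (\<lambda>s. h s * partial (Suc t) s \<tau> - \<Phi> s \<tau>))"
proof -
  define i where "i = Suc t"
  have i: "i \<notin> slots t" "i \<in> {2..d}" "i < d" "insert i (slots t) = slots i"
    using t by (auto simp: i_def slots_def)
  define B where "B = {n. n \<in> {n0..<n1} \<and> t < slot n}"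
  define K where "K = slot_indices i - J"
  have si: "slot_indices i = {n. n \<in> {n0..<n1} \<and> slot n = i}"
    by (rule slot_indices_base[OF i(3)])
  have finB: "finite B" and finK: "finite K"
    by (auto simp: B_def K_def finite_slot_indices)
  have siB: "slot_indices i \<subseteq> B"
    unfolding si B_def by (auto simp: i_def)
  have \<Delta>: "\<Delta> \<in> pol x n1" "\<not> null \<Delta>"
    using frame by (auto simp: frame_def)
  have K: "m \<in> {n0..<n1} - J" if "m \<in> K" for m
    using that by (auto simp: K_def si)
  have \<xi>: "tangent_field x (\<xi> m) n1" "\<And>l. \<xi> m l \<in> pol x n1" "\<forall>l<n0. \<xi> m l = (\<lambda>_. 0)"
    "\<And>l. l \<in> {n0..<n1} - J \<Longrightarrow> \<xi> m l = (if l = m then \<Delta> else (\<lambda>_. 0))" if "m \<in> K" for m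
    using frame(1) K[OF that] unfolding frame_def by blast+
  have lin: "Vector_Spaces.linear scale (*) (coord n)" if "n \<in> {n0..<n1}" for n
    using that n_le by (intro linear_functional) auto
  have "\<forall>m. \<exists>h'. (h, h') \<in> tangent_pairs x (\<xi> m) n1"
    using tangent_pairs_exist[OF h(1)] by blast
  from choice[OF this] obtain h' where h': "\<And>m. (h, h' m) \<in> tangent_pairs x (\<xi> m) n1"
    by blast
  have h'_pol: "h' m \<in> pol x n1" if "m \<in> K" for m
    using tangent_pairs_pol_snd[OF h' order_refl] \<xi>(2)[OF that] by blast
  have "\<exists>\<Phi>'. (\<forall>m\<in>K. \<forall>\<tau>. (\<lambda>s. \<Phi> s \<tau>, \<lambda>s. \<Phi>' m s \<tau>) \<in> tangent_pairs x (\<xi> m) n1) \<and>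
    split_sum x n1 (insert i (slots t)) (2 * c)
      (\<lambda>s \<tau>. \<Sum>m\<in>K. coord m (\<tau> i) * (h s * \<Phi>' m s \<tau> - h' m s * \<Phi> s \<tau>))"
    by (rule split_sum_derivative[OF \<Phi> i(1) finK h(1) \<xi>(2) h'_pol lin]) (use K in auto)
  then obtain \<Phi>' where \<Phi>': "\<And>m \<tau>. m \<in> K \<Longrightarrow> (\<lambda>s. \<Phi> s \<tau>, \<lambda>s. \<Phi>' m s \<tau>) \<in> tangent_pairs x (\<xi> m) n1"
    and split: "split_sum x n1 (slots i) (2 * c)
      (\<lambda>s \<tau>. \<Sum>m\<in>K. coord m (\<tau> i) * (h s * \<Phi>' m s \<tau> - h' m s * \<Phi> s \<tau>))"
    using i(4) by auto
  have "t \<le> d - 1"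
    using t by simp
  then obtain Z where "gradient t Z"
    using gradient_exists by blast
  moreover have "n \<in> {n0..<n1} \<and> slot n = Suc t" if "n \<in> slot_indices i" for n
    using that si i_def by auto
  ultimately have Z: "\<And>n. n \<in> B \<Longrightarrow> Z n \<in> forms (pol x n1) (slots t)"
    "\<And>n. n \<in> slot_indices i \<Longrightarrow> Z n = (\<lambda>s \<tau>. partial i s (\<tau>(i := e n)))"
    "\<And>\<xi> \<tau>. (\<forall>l<n0. \<xi> l = (\<lambda>_. 0)) \<Longrightarrow>
      (\<lambda>s. partial t s \<tau>, \<lambda>s. \<Sum>n\<in>B. \<xi> n s * Z n s \<tau>) \<in> tangent_pairs x \<xi> n1"
    unfolding gradient_def B_def i_def by simp_all
  define J' where "J' = B \<inter> J"
  have finJ': "finite J'"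
    using finB by (simp add: J'_def)
  \<comment> \<open>\<open>\<gamma> n\<close> collects both kinds of corrections for the coordinate \<open>n\<close> in \<open>J\<close>: the direction \<open>e n\<close> missing
    among the fields, and the motion of \<open>x n\<close> under the fields.\<close>
  define \<gamma> where "\<gamma> n = (\<lambda>s \<tau>. (if n \<in> slot_indices i then \<Delta> s * coord n (\<tau> i) else 0) -
    (\<Sum>m\<in>K. coord m (\<tau> i) * \<xi> m n s))" for n
  define \<Psi> where "\<Psi> = (\<lambda>s \<tau>. (\<Sum>m\<in>K. coord m (\<tau> i) * (h s * \<Phi>' m s \<tau> - h' m s * \<Phi> s \<tau>)) +
    (\<Sum>n\<in>J'. \<gamma> n s \<tau> * (h s * h s * Z n s \<tau>)))"
  have lin_form: "(\<lambda>s \<tau>. f s * coord n (\<tau> i)) \<in> forms (pol x n1) {i}" if "f \<in> pol x n1" "n \<in> {n0..<n1}" for f n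
    by (rule forms_scale[OF that(1) forms_linear_functional[OF lin[OF that(2)] pol.const]])
  have \<gamma>: "\<gamma> n \<in> forms (pol x n1) {i}" for n
  proof -
    have "(\<lambda>s \<tau>. if n \<in> slot_indices i then \<Delta> s * coord n (\<tau> i) else 0) \<in> forms (pol x n1) {i}"
    proof (cases "n \<in> slot_indices i")
      case True
      then show ?thesis
        using lin_form[OF \<Delta>(1), of n] by (simp add: si)
    qed (simp add: forms.zero)
    moreover have "(\<lambda>s \<tau>. coord m (\<tau> i) * \<xi> m n s) \<in> forms (pol x n1) {i}" if "m \<in> K" for m
      using lin_form[OF \<xi>(2)[OF that], of m n] K[OF that] by (simp add: mult.commute)
    ultimately show ?thesis
      unfolding \<gamma>_def by (intro forms_diff forms_sum)
  qed
  have hhZ: "(\<lambda>s \<tau>. h s * h s * Z n s \<tau>) \<in> forms (pol x n1) (slots t)" if "n \<in> J'" for n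
    using that by (intro forms_scale pol.mult h Z) (auto simp: J'_def)
  have "split_sum x n1 (slots i) (card J') (\<lambda>s \<tau>. \<Sum>n\<in>J'. \<gamma> n s \<tau> * (h s * h s * Z n s \<tau>))"
    by (rule split_sum_products[OF finJ' \<gamma> hhZ]) (use i in \<open>auto simp: slots_def\<close>)
  from split_sum_plus[OF split this] have \<Psi>: "split_sum x n1 (slots i) (2 * c + card J') \<Psi>"
    unfolding \<Psi>_def .
  have "null (\<lambda>s. h s * h s * \<Delta> s * partial i s \<tau> - \<Psi> s \<tau>)" if \<tau>: "\<tau> \<in> PiE {1..d} V" for \<tau>
  proof -
    have deriv: "null (\<lambda>s. h' m s * partial t s \<tau> + h s * (\<Sum>n\<in>B. \<xi> m n s * Z n s \<tau>) - \<Phi>' m s \<tau>)" if "m \<in> K" for m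
      by (rule tangent_field_unique[OF \<xi>(1)[OF that] tangent_pairs.mult[OF h' Z(3)[OF \<xi>(3)[OF that]]] \<Phi>'[OF that] eq[OF \<tau>]])
    have DP: "(\<Sum>n\<in>B. \<xi> m n s * Z n s \<tau>) = \<Delta> s * Z m s \<tau> + (\<Sum>n\<in>J'. \<xi> m n s * Z n s \<tau>)" if m: "m \<in> K" for m s
    proof -
      have "(\<Sum>n\<in>B - J. \<xi> m n s * Z n s \<tau>) = (\<Sum>n\<in>{m}. \<Delta> s * Z n s \<tau>)"
      proof (rule sum.mono_neutral_cong_right)
        show "{m} \<subseteq> B - J"
          using m siB by (auto simp: K_def)
        show "\<forall>n\<in>B - J - {m}. \<xi> m n s * Z n s \<tau> = 0"
          using \<xi>(4)[OF m] by (auto simp: B_def)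
        show "\<xi> m n s * Z n s \<tau> = \<Delta> s * Z n s \<tau>" if "n \<in> {m}" for n
          using \<xi>(4)[OF m K[OF m]] that by simp
      qed (use finB in simp)
      moreover have "(\<Sum>n\<in>B. \<xi> m n s * Z n s \<tau>) = (\<Sum>n\<in>B - J. \<xi> m n s * Z n s \<tau>) + (\<Sum>n\<in>J'. \<xi> m n s * Z n s \<tau>)"
      proof -
        have "B = (B - J) \<union> J'"
          by (auto simp: J'_def)
        then show ?thesis
          using sum.union_disjoint[of "B - J" J' "\<lambda>n. \<xi> m n s * Z n s \<tau>"] finB finJ' by (auto simp: J'_def)
      qed
      ultimately show ?thesis
        by simp
    qed
    have Pi: "partial i s \<tau> = (\<Sum>n\<in>slot_indices i. coord n (\<tau> i) * Z n s \<tau>)" for s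
    proof -
      have "partial i s \<tau> = (\<Sum>n\<in>slot_indices i. coord n (\<tau> i) * partial i s (\<tau>(i := e n)))"
        by (rule forms_coordinates[OF partial_form]) (use i \<tau> t in \<open>auto simp: slots_def\<close>)
      then show ?thesis
        using Z(2) by simp
    qed
    have "eventually (\<lambda>s. \<forall>m\<in>K. h' m s * partial t s \<tau> + h s * (\<Sum>n\<in>B. \<xi> m n s * Z n s \<tau>) - \<Phi>' m s \<tau> = 0) U"
      using deriv finK by (simp add: null_def eventually_ball_finite_distrib)
    with eq[OF \<tau>] show ?thesis
      unfolding null_def
    proof eventually_elim
      case (elim s)
      define S where "S m = (\<Sum>n\<in>J'. \<xi> m n s * Z n s \<tau>)" for m
      have hP: "h s * partial t s \<tau> = \<Phi> s \<tau>"
        using elim(1) by simp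
      have step: "h s * h s * \<Delta> s * Z m s \<tau> = (h s * \<Phi>' m s \<tau> - h' m s * \<Phi> s \<tau>) - h s * h s * S m" if m: "m \<in> K" for m
      proof -
        have "\<Phi>' m s \<tau> = h' m s * partial t s \<tau> + h s * (\<Delta> s * Z m s \<tau> + S m)"
        proof -
          have "h' m s * partial t s \<tau> + h s * (\<Sum>n\<in>B. \<xi> m n s * Z n s \<tau>) - \<Phi>' m s \<tau> = 0"
            using elim(2) m by blast
          then show ?thesis
            unfolding DP[OF m] S_def by (simp only: right_minus_eq)
        qed
        then show ?thesis
          unfolding hP[symmetric] by (simp add: algebra_simps)
      qed
      have split_si: "slot_indices i = K \<union> (slot_indices i \<inter> J)"
        by (auto simp: K_def)
      have "h s * h s * \<Delta> s * partial i s \<tau> = (\<Sum>n\<in>slot_indices i. coord n (\<tau> i) * (h s * h s * \<Delta> s * Z n s \<tau>))"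
        unfolding Pi by (simp add: sum_distrib_left mult_ac)
      also have "\<dots> = (\<Sum>m\<in>K. coord m (\<tau> i) * (h s * h s * \<Delta> s * Z m s \<tau>)) +
          (\<Sum>n\<in>slot_indices i \<inter> J. coord n (\<tau> i) * (h s * h s * \<Delta> s * Z n s \<tau>))"
        by (subst split_si, rule sum.union_disjoint) (auto simp: K_def finite_slot_indices)
      also have "(\<Sum>m\<in>K. coord m (\<tau> i) * (h s * h s * \<Delta> s * Z m s \<tau>)) =
          (\<Sum>m\<in>K. coord m (\<tau> i) * (h s * \<Phi>' m s \<tau> - h' m s * \<Phi> s \<tau>)) -
          (\<Sum>m\<in>K. coord m (\<tau> i) * (h s * h s * S m))"
        unfolding sum_subtractf[symmetric]
        by (intro sum.cong refl) (simp only: step right_diff_distrib)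
      also have "(\<Sum>m\<in>K. coord m (\<tau> i) * (h s * h s * S m)) =
          (\<Sum>n\<in>J'. (\<Sum>m\<in>K. coord m (\<tau> i) * \<xi> m n s) * (h s * h s * Z n s \<tau>))"
        unfolding S_def sum_distrib_left sum_distrib_right
        by (subst sum.swap) (simp add: mult_ac)
      also have "(\<Sum>n\<in>slot_indices i \<inter> J. coord n (\<tau> i) * (h s * h s * \<Delta> s * Z n s \<tau>)) =
          (\<Sum>n\<in>J'. (if n \<in> slot_indices i then \<Delta> s * coord n (\<tau> i) else 0) * (h s * h s * Z n s \<tau>))"
        using siB finJ' by (intro sum.mono_neutral_cong_left) (auto simp: J'_def)
      finally show ?case
        by (simp add: \<Psi>_def \<gamma>_def left_diff_distrib sum_subtractf)
    qed
  qed
  moreover have "card J' \<le> card J"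
    using frame(2) by (intro card_mono) (auto simp: J'_def intro: finite_subset)
  moreover have "(\<lambda>s. h s * h s * \<Delta> s) \<in> pol x n1" "\<not> null (\<lambda>s. h s * h s * \<Delta> s)"
    using h \<Delta> by (auto simp: null_mult_iff intro!: pol.mult)
  ultimately show ?thesis
    using \<Psi> unfolding i_def[symmetric]
    by (intro exI[of _ "\<lambda>s. h s * h s * \<Delta> s"] exI[of _ \<Psi>] exI[of _ "2 * c + card J'"]) auto
qed

lemma elimination_start:
  "\<exists>h \<Phi> c. h \<in> pol x n1 \<and> \<not> null h \<and> split_sum x n1 (slots 1) c \<Phi> \<and>
    c \<le> card {n \<in> {n1..<N}. algebraic x n} \<and> (\<forall>\<tau>\<in>PiE {1..d} V. null (\<lambda>s. h s * partial 1 s \<tau> - \<Phi> s \<tau>))"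
proof -
  have slots1: "slots 1 = {1, d}"
    using d by (auto simp: slots_def)
  have form: "partial 1 \<in> forms (pol x n1) {1, d}"
    using partial_form[of 1] d slots1 by simp
  have "null (\<lambda>s. \<Sum>n\<in>{n1..<N}. x n s * partial 1 s (\<tau>(d := e n)))" if \<tau>: "\<tau> \<in> PiE {1..d} V" for \<tau>
    using degenerate unfolding null_def
  proof eventually_elim
    case (elim s)
    define \<tau>' where "\<tau>' = \<tau>(d := s d)"
    have \<tau>': "\<tau>' j \<in> V j" if "j \<in> {1, d}" for j
      using that \<tau> elim d by (auto simp: \<tau>'_def PiE_iff)
    have "(\<Sum>n\<in>{n1..<N}. x n s * partial 1 s (\<tau>(d := e n))) =
        (\<Sum>n\<in>slot_indices d. coord n (\<tau>' d) * partial 1 s (\<tau>'(d := e n)))"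
      unfolding slot_indices_fibre
      using n_le slot_fibre by (intro sum.cong) (auto simp: x_coordinate \<tau>'_def)
    also have "\<dots> = partial 1 s \<tau>'"
      by (rule forms_coordinates[OF form, symmetric]) (use d \<tau>' in auto)
    also have "\<dots> = P s (\<lambda>i. if 1 < i \<and> i < d then s i else \<tau>' i)"
      using elim \<tau>' slots1 d by (intro partial_value) auto
    also have "(\<lambda>i. if 1 < i \<and> i < d then s i else \<tau>' i) = s(1 := \<tau> 1)"
      using elim \<tau> d by (auto simp: \<tau>'_def fun_eq_iff PiE_iff extensional_def)
    also have "P s (s(1 := \<tau> 1)) = 0"
      using elim \<tau> d by (auto simp: PiE_iff)
    finally show ?case .
  qed
  then show ?thesis
    unfolding slots1 by (intro elimination[OF n_le(2) order_refl form]) auto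
qed

text \<open>
  The number of products \<open>c\<close> satisfies \<open>c + card J \<le> 2 ^ t * (b + card J)\<close>, which is preserved by the
  step from \<open>c\<close> to \<open>2 * c + card J\<close>.
\<close>

theorem generic_decomposition:
  "\<exists>h \<Phi> c. h \<in> pol x n1 \<and> \<not> null h \<and> split_sum x n1 {1..d} c \<Phi> \<and>
    c \<le> 2 ^ (d - 2) * card {n \<in> {n0..<N}. algebraic x n} \<and>
    (\<forall>\<tau>\<in>PiE {1..d} V. null (\<lambda>s. h s * P s \<tau> - \<Phi> s \<tau>))"
proof -
  define b where "b = card {n \<in> {n1..<N}. algebraic x n}"
  from frame_exists[OF n_le(1), of x]
  obtain J \<Delta> \<xi> where J: "J \<subseteq> {n0..<n1}" "card J \<le> card {i \<in> {n0..<n1}. algebraic x i}"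
    and frame: "frame x n1 n0 n1 J \<Delta> \<xi>"
    by (elim exE conjE) (rule that)
  have "\<exists>h \<Phi> c. h \<in> pol x n1 \<and> \<not> null h \<and> split_sum x n1 (slots (Suc t)) c \<Phi> \<and>
      c + card J \<le> 2 ^ t * (b + card J) \<and>
      (\<forall>\<tau>\<in>PiE {1..d} V. null (\<lambda>s. h s * partial (Suc t) s \<tau> - \<Phi> s \<tau>))" if "Suc t \<le> d - 1" for t
    using that
  proof (induction t)
    case 0
    then show ?case
      using elimination_start unfolding b_def[symmetric] by fastforce
  next
    case (Suc t)
    then obtain h \<Phi> c where h: "h \<in> pol x n1" "\<not> null h" "split_sum x n1 (slots (Suc t)) c \<Phi>"
      "c + card J \<le> 2 ^ t * (b + card J)"
      "\<And>\<tau>. \<tau> \<in> PiE {1..d} V \<Longrightarrow> null (\<lambda>s. h s * partial (Suc t) s \<tau> - \<Phi> s \<tau>)"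
      by auto
    have "1 \<le> Suc t" "Suc (Suc t) < d"
      using Suc.prems by auto
    from differentiation[OF frame J(1) this h(1-3,5)] obtain h' \<Phi>' c' where
      "h' \<in> pol x n1" "\<not> null h'" "split_sum x n1 (slots (Suc (Suc t))) c' \<Phi>'"
      "c' \<le> 2 * c + card J" "\<forall>\<tau>\<in>PiE {1..d} V. null (\<lambda>s. h' s * partial (Suc (Suc t)) s \<tau> - \<Phi>' s \<tau>)"
      by blast
    moreover from this(4) h(4) have "c' + card J \<le> 2 ^ Suc t * (b + card J)"
      by simp
    ultimately show ?case
      by blast
  qed
  from this[of "d - 2"] obtain h \<Phi> c where
    h: "h \<in> pol x n1" "\<not> null h" "split_sum x n1 (slots (d - 1)) c \<Phi>"
      "c + card J \<le> 2 ^ (d - 2) * (b + card J)"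
      "\<forall>\<tau>\<in>PiE {1..d} V. null (\<lambda>s. h s * partial (d - 1) s \<tau> - \<Phi> s \<tau>)"
    using d by (auto simp: Suc_diff_Suc numeral_2_eq_2)
  define A where "A = {n \<in> {n0..<n1}. algebraic x n}"
  define B where "B = {n \<in> {n1..<N}. algebraic x n}"
  have "finite A" "finite B" "A \<inter> B = {}"
    by (auto simp: A_def B_def)
  moreover have "{n \<in> {n0..<N}. algebraic x n} = A \<union> B"
    unfolding A_def B_def using n_le by (auto simp: not_less)
  ultimately have "card {n \<in> {n0..<N}. algebraic x n} = card A + b"
    by (simp add: card_Un_disjoint b_def B_def)
  then have "b + card J \<le> card {n \<in> {n0..<N}. algebraic x n}"
    using J(2) by (simp add: A_def)
  then have "2 ^ (d - 2) * (b + card J) \<le> 2 ^ (d - 2) * card {n \<in> {n0..<N}. algebraic x n}"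
    by (rule mult_le_mono2)
  then have "c \<le> 2 ^ (d - 2) * card {n \<in> {n0..<N}. algebraic x n}"
    using h(4) by linarith
  with h show ?thesis
    unfolding slots_top partial_top by blast
qed

end

section \<open>Chains of primes and algebraic independence\<close>

text \<open>
  Prime ideals of a ring of functions, as sets of functions on the whole type. Restriction to the
  locus is built into the ideal, which contains the functions vanishing there.
\<close>

definition prime_of_functions :: "('p \<Rightarrow> 'k::field) set \<Rightarrow> ('p \<Rightarrow> 'k) set \<Rightarrow> bool" where
  "prime_of_functions F \<pp> \<longleftrightarrow>
    (\<forall>f\<in>\<pp>. \<forall>g\<in>\<pp>. (\<lambda>s. f s + g s) \<in> \<pp>) \<and>
    (\<forall>f\<in>\<pp>. \<forall>g\<in>F. (\<lambda>s. g s * f s) \<in> \<pp>) \<and>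
    (\<forall>f\<in>F. \<forall>g\<in>F. (\<lambda>s. f s * g s) \<in> \<pp> \<longrightarrow> f \<in> \<pp> \<or> g \<in> \<pp>) \<and>
    (\<lambda>_. 1) \<notin> \<pp>"

definition function_ring :: "('p \<Rightarrow> 'k::field) set \<Rightarrow> bool" where
  "function_ring F \<longleftrightarrow> (\<forall>c. (\<lambda>_. c) \<in> F) \<and>
    (\<forall>f\<in>F. \<forall>g\<in>F. (\<lambda>s. f s + g s) \<in> F \<and> (\<lambda>s. f s * g s) \<in> F)"

lemma function_ring_closed:
  assumes "function_ring F"
  shows "(\<lambda>_. c) \<in> F"
    and "f \<in> F \<Longrightarrow> g \<in> F \<Longrightarrow> (\<lambda>s. f s + g s) \<in> F"
    and "f \<in> F \<Longrightarrow> g \<in> F \<Longrightarrow> (\<lambda>s. f s * g s) \<in> F"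
  using assms by (auto simp: function_ring_def)

lemma function_ring_sum:
  "function_ring F \<Longrightarrow> (\<And>i. i \<in> I \<Longrightarrow> f i \<in> F) \<Longrightarrow> (\<lambda>s. \<Sum>i\<in>I. f i s) \<in> F"
  by (induction I rule: infinite_finite_induct) (auto intro: function_ring_closed)

lemma function_ring_power:
  "function_ring F \<Longrightarrow> f \<in> F \<Longrightarrow> (\<lambda>s. f s ^ j) \<in> F"
  by (induction j) (auto intro: function_ring_closed)

lemma function_ring_monomial:
  assumes F: "function_ring F" and "\<And>i. j \<le> i \<Longrightarrow> i < j + length \<alpha> \<Longrightarrow> y i \<in> F"
  shows "monomial_at y j \<alpha> \<in> F"
  using assms(2)
proof (induction \<alpha> arbitrary: j)
  case Nil
  have "monomial_at y j [] = (\<lambda>_. 1)"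
    by (rule ext) simp
  then show ?case
    using function_ring_closed(1)[OF F] by simp
next
  case (Cons a \<alpha>)
  have "monomial_at y j (a # \<alpha>) = (\<lambda>s. y j s ^ a * monomial_at y (Suc j) \<alpha> s)"
    by (rule ext) simp
  also have "\<dots> \<in> F"
    using Cons by (intro function_ring_closed(3)[OF F] function_ring_power[OF F] Cons.IH) auto
  finally show ?case .
qed

lemma prime_of_functionsD:
  assumes "prime_of_functions F \<pp>"
  shows "f \<in> \<pp> \<Longrightarrow> g \<in> \<pp> \<Longrightarrow> (\<lambda>s. f s + g s) \<in> \<pp>"
    and "f \<in> \<pp> \<Longrightarrow> g \<in> F \<Longrightarrow> (\<lambda>s. g s * f s) \<in> \<pp>"
    and "f \<in> F \<Longrightarrow> g \<in> F \<Longrightarrow> (\<lambda>s. f s * g s) \<in> \<pp> \<Longrightarrow> f \<in> \<pp> \<or> g \<in> \<pp>"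
    and "(\<lambda>_. 1) \<notin> \<pp>"
  using assms unfolding prime_of_functions_def by blast+

lemma exponents_Suc:
  "(\<Sum>\<alpha>\<in>exponents (Suc k) K. G \<alpha>) = (\<Sum>a<K. \<Sum>\<alpha>\<in>exponents k K. G (a # \<alpha>))"
proof -
  have "(\<Sum>\<alpha>\<in>exponents (Suc k) K. G \<alpha>) = (\<Sum>(a, \<alpha>)\<in>{..<K} \<times> exponents k K. G (a # \<alpha>))"
    by (rule sum.reindex_bij_witness[of _ "\<lambda>(a, \<alpha>). a # \<alpha>" "\<lambda>\<alpha>. (hd \<alpha>, tl \<alpha>)"])
      (auto simp: exponents_def length_Suc_conv)
  then show ?thesis
    by (simp add: sum.cartesian_product)
qed

text \<open>
  Divide \<open>\<Sum>a. y ^ a * g a\<close> by \<open>y ^ b\<close>, which is allowed modulo \<open>\<pp>\<close>; the terms that still contain \<open>y\<close> then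
  vanish modulo \<open>\<qq>\<close>.
\<close>

lemma prime_leading_coefficient:
  assumes F: "function_ring F" and \<pp>: "prime_of_functions F \<pp>" and \<qq>: "prime_of_functions F \<qq>"
    and sub: "\<pp> \<subseteq> \<qq>" and y: "y \<in> F" "y \<in> \<qq>" "y \<notin> \<pp>"
    and g: "\<And>a. g a \<in> F" and sum: "(\<lambda>s. \<Sum>a<K. y s ^ a * g a s) \<in> \<pp>"
    and low: "\<And>a. a < b \<Longrightarrow> g a = (\<lambda>_. 0)" and b: "b < K"
  shows "g b \<in> \<qq>"
proof -
  define H where "H = (\<lambda>s. \<Sum>a\<in>{Suc b..<K}. y s ^ (a - Suc b) * g a s)"
  have H: "H \<in> F"
    unfolding H_def by (intro function_ring_sum[OF F] function_ring_closed(3)[OF F] function_ring_power[OF F] y g)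
  have power: "(\<lambda>s. y s ^ a) \<notin> \<pp>" for a
  proof (induction a)
    case 0
    then show ?case
      using prime_of_functionsD(4)[OF \<pp>] by simp
  next
    case (Suc a)
    then show ?case
      using prime_of_functionsD(3)[OF \<pp> y(1) function_ring_power[OF F y(1), of a]] y(3) by auto
  qed
  have "(\<Sum>a<K. y s ^ a * g a s) = y s ^ b * (g b s + y s * H s)" for s
  proof -
    have "{..<K} = {..<b} \<union> ({b} \<union> {Suc b..<K})"
      using b by auto
    then have "(\<Sum>a<K. y s ^ a * g a s) =
        (\<Sum>a<b. y s ^ a * g a s) + (y s ^ b * g b s + (\<Sum>a\<in>{Suc b..<K}. y s ^ a * g a s))"
      by (simp only:) (subst sum.union_disjoint; force)+
    also have "(\<Sum>a<b. y s ^ a * g a s) = 0"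
      by (intro sum.neutral) (simp add: low)
    also have "(\<Sum>a\<in>{Suc b..<K}. y s ^ a * g a s) = y s ^ b * (y s * H s)"
      unfolding H_def sum_distrib_left
    proof (intro sum.cong refl)
      fix a assume "a \<in> {Suc b..<K}"
      then have "a = b + (1 + (a - Suc b))"
        by simp
      then have "y s ^ a = y s ^ b * (y s * y s ^ (a - Suc b))"
        by (metis power_add power_one_right)
      then show "y s ^ a * g a s = y s ^ b * (y s * (y s ^ (a - Suc b) * g a s))"
        by (simp add: mult.assoc)
    qed
    finally show ?thesis
      by (simp add: distrib_left)
  qed
  then have "(\<lambda>s. y s ^ b * (g b s + y s * H s)) \<in> \<pp>"
    using sum by simp
  then have "(\<lambda>s. g b s + y s * H s) \<in> \<pp>"
    using prime_of_functionsD(3)[OF \<pp> function_ring_power[OF F y(1), of b], of "\<lambda>s. g b s + y s * H s"]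
      power[of b] function_ring_closed(2)[OF F g function_ring_closed(3)[OF F y(1) H], of b] by blast
  then have 1: "(\<lambda>s. g b s + y s * H s) \<in> \<qq>"
    using sub by blast
  have "(\<lambda>s. - H s) \<in> F"
    using function_ring_closed(3)[OF F function_ring_closed(1)[OF F, of "-1"] H] by simp
  from prime_of_functionsD(2)[OF \<qq> y(2) this] have "(\<lambda>s. - H s * y s) \<in> \<qq>" .
  from prime_of_functionsD(1)[OF \<qq> 1 this] show ?thesis
    by (simp add: mult.commute)
qed

text \<open>
  A polynomial relation modulo \<open>\<pp> j\<close>, ordered by powers of \<open>y j\<close>, gives for its lowest power a relation
  among the later \<open>y i\<close> modulo \<open>\<pp> (Suc j)\<close>.
\<close>

lemma chain_independent:
  assumes F: "function_ring F" and \<pp>: "\<And>i. i \<le> m \<Longrightarrow> prime_of_functions F (\<pp> i)"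
    and sub: "\<And>i. i < m \<Longrightarrow> \<pp> i \<subseteq> \<pp> (Suc i)"
    and y: "\<And>i. i < m \<Longrightarrow> y i \<in> F \<and> y i \<in> \<pp> (Suc i) \<and> y i \<notin> \<pp> i"
  shows "j + k = m \<Longrightarrow> (\<lambda>s. \<Sum>\<alpha>\<in>exponents k K. c \<alpha> * monomial_at y j \<alpha> s) \<in> \<pp> j \<Longrightarrow>
    \<alpha> \<in> exponents k K \<Longrightarrow> c \<alpha> = 0"
proof (induction k arbitrary: j c \<alpha>)
  case 0
  have "exponents 0 K = {[]}"
    by (auto simp: exponents_def)
  then have c: "(\<lambda>_. c []) \<in> \<pp> j" and \<alpha>: "\<alpha> = []"
    using 0 by auto
  have "c [] = 0"
  proof (rule ccontr)
    assume "c [] \<noteq> 0"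
    then show False
      using prime_of_functionsD(2)[OF \<pp> c function_ring_closed(1)[OF F], of "inverse (c [])"]
        prime_of_functionsD(4)[OF \<pp>] 0(1) by simp
  qed
  then show ?case
    using \<alpha> by simp
next
  case (Suc k)
  define g where "g a = (\<lambda>s. \<Sum>\<alpha>\<in>exponents k K. c (a # \<alpha>) * monomial_at y (Suc j) \<alpha> s)" for a
  have j: "j < m" "Suc j + k = m"
    using Suc.prems(1) by auto
  have g: "g a \<in> F" for a
    unfolding g_def
  proof (intro function_ring_sum[OF F] function_ring_closed(3)[OF F] function_ring_closed(1)[OF F])
    fix \<alpha> assume "\<alpha> \<in> exponents k K"
    then show "monomial_at y (Suc j) \<alpha> \<in> F"
      using y Suc.prems(1) by (intro function_ring_monomial[OF F]) (auto simp: exponents_def)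
  qed
  have "(\<lambda>s. \<Sum>\<alpha>\<in>exponents (Suc k) K. c \<alpha> * monomial_at y j \<alpha> s) = (\<lambda>s. \<Sum>a<K. y j s ^ a * g a s)"
    by (simp add: exponents_Suc g_def sum_distrib_left mult_ac)
  then have sum: "(\<lambda>s. \<Sum>a<K. y j s ^ a * g a s) \<in> \<pp> j"
    using Suc.prems(2) by simp
  have zero: "\<forall>\<alpha>\<in>exponents k K. c (a # \<alpha>) = 0" if "a < K" for a
    using that
  proof (induction a rule: less_induct)
    case (less b)
    have "g a = (\<lambda>_. 0)" if "a < b" for a
      using less.IH[OF that] less.prems that unfolding g_def by (intro ext sum.neutral) auto
    from prime_leading_coefficient[OF F \<pp> \<pp> sub _ _ _ g sum this less.prems] y[OF j(1)] j
    have "g b \<in> \<pp> (Suc j)"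
      by simp
    then show ?case
      using Suc.IH[OF j(2), of "\<lambda>\<alpha>. c (b # \<alpha>)"] unfolding g_def by blast
  qed
  obtain a \<alpha>' where "\<alpha> = a # \<alpha>'" "a < K" "\<alpha>' \<in> exponents k K"
    using Suc.prems(3) by (auto simp: exponents_def length_Suc_conv)
  then show ?case
    using zero by blast
qed

lemma function_ring_poly_functions: "function_ring (poly_functions scale A)"
  by (auto simp: function_ring_def intro: poly_functions.intros)

lemma primeideal_closure_ring:
  assumes "primeideal I (closure_ring scale A S)"
  shows "prime_of_functions (poly_functions scale A) {f \<in> poly_functions scale A. restrict f S \<in> I}"
    and "f \<in> poly_functions scale A \<Longrightarrow> (\<And>s. s \<in> S \<Longrightarrow> f s = 0) \<Longrightarrow> restrict f S \<in> I"
    and "I \<subseteq> (\<lambda>f. restrict f S) ` poly_functions scale A"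
proof -
  let ?R = "closure_ring scale A S" and ?F = "poly_functions scale A"
  interpret primeideal I ?R by fact
  have carrier: "restrict f S \<in> carrier ?R" if "f \<in> ?F" for f
    using that by (simp add: closure_ring_def)
  have add: "restrict f S \<oplus>\<^bsub>?R\<^esub> restrict g S = restrict (\<lambda>s. f s + g s) S" for f g
    by (auto simp: closure_ring_def restrict_def)
  have mult: "restrict f S \<otimes>\<^bsub>?R\<^esub> restrict g S = restrict (\<lambda>s. f s * g s) S" for f g
    by (auto simp: closure_ring_def restrict_def)
  have zero: "\<zero>\<^bsub>?R\<^esub> = restrict (\<lambda>_. 0) S" and one: "\<one>\<^bsub>?R\<^esub> = restrict (\<lambda>_. 1) S"
    by (simp_all add: closure_ring_def)
  show sub: "I \<subseteq> (\<lambda>f. restrict f S) ` ?F"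
    using a_subset by (simp add: closure_ring_def)
  show "restrict f S \<in> I" if "f \<in> ?F" "\<And>s. s \<in> S \<Longrightarrow> f s = 0"
  proof -
    have "restrict f S = \<zero>\<^bsub>?R\<^esub>"
      unfolding zero using that(2) by (auto simp: restrict_def)
    then show ?thesis
      by (metis additive_subgroup.zero_closed additive_subgroup_axioms)
  qed
  show "prime_of_functions ?F {f \<in> ?F. restrict f S \<in> I}"
    unfolding prime_of_functions_def
  proof (intro conjI ballI impI)
    fix f g assume "f \<in> {f \<in> ?F. restrict f S \<in> I}" "g \<in> {f \<in> ?F. restrict f S \<in> I}"
    then show "(\<lambda>s. f s + g s) \<in> {f \<in> ?F. restrict f S \<in> I}"
      using additive_subgroup.a_closed[OF additive_subgroup_axioms, of "restrict f S" "restrict g S"]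
      by (auto simp: add intro: poly_functions.add)
  next
    fix f g assume "f \<in> {f \<in> ?F. restrict f S \<in> I}" "g \<in> ?F"
    then show "(\<lambda>s. g s * f s) \<in> {f \<in> ?F. restrict f S \<in> I}"
      using I_l_closed[OF _ carrier, of "restrict f S" g] by (auto simp: mult intro: poly_functions.mult)
  next
    fix f g assume "f \<in> ?F" "g \<in> ?F" "(\<lambda>s. f s * g s) \<in> {f \<in> ?F. restrict f S \<in> I}"
    then show "f \<in> {f \<in> ?F. restrict f S \<in> I} \<or> g \<in> {f \<in> ?F. restrict f S \<in> I}"
      using I_prime[OF carrier carrier, of f g] by (auto simp: mult)
  next
    show "(\<lambda>_. 1) \<notin> {f \<in> ?F. restrict f S \<in> I}"
    proof
      assume "(\<lambda>_. 1) \<in> {f \<in> ?F. restrict f S \<in> I}"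
      then have "\<one>\<^bsub>?R\<^esub> \<in> I"
        by (simp add: one)
      then show False
        using one_imp_carrier I_notcarr by simp
    qed
  qed
qed

text \<open>
  A product of functions outside \<open>\<pp>\<close> is outside \<open>\<pp>\<close>, hence nonzero somewhere on \<open>S\<close>; this is the finite
  intersection property. The functions vanishing at the ultrafilter form a prime inside \<open>\<pp>\<close>, possibly
  a smaller one.
\<close>

lemma prime_ultrafilter:
  assumes F: "function_ring F" and \<pp>: "prime_of_functions F \<pp>"
    and vanish: "\<And>f. f \<in> F \<Longrightarrow> (\<And>s. s \<in> S \<Longrightarrow> f s = 0) \<Longrightarrow> f \<in> \<pp>"
  obtains U where "ultrafilter U" "eventually (\<lambda>s. s \<in> S) U"
    "\<And>f. f \<in> F \<Longrightarrow> f \<notin> \<pp> \<Longrightarrow> eventually (\<lambda>s. f s \<noteq> 0) U"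
proof -
  define \<A> where "\<A> = (\<lambda>f. {s \<in> S. f s \<noteq> 0}) ` (F - \<pp>)"
  have one: "(\<lambda>_. 1) \<in> F - \<pp>"
    using function_ring_closed(1)[OF F] prime_of_functionsD(4)[OF \<pp>] by blast
  have "\<exists>f\<in>F - \<pp>. {s \<in> S. f s \<noteq> 0} \<subseteq> \<Inter>G" if "finite G" "G \<subseteq> \<A>" for G
    using that
  proof (induction G rule: finite_induct)
    case empty
    then show ?case
      using one by blast
  next
    case (insert A G)
    then obtain f g where f: "f \<in> F - \<pp>" "{s \<in> S. f s \<noteq> 0} \<subseteq> \<Inter>G" and g: "g \<in> F - \<pp>" "A = {s \<in> S. g s \<noteq> 0}"
      by (auto simp: \<A>_def)
    have "(\<lambda>s. f s * g s) \<in> F - \<pp>"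
      using f(1) g(1) function_ring_closed(3)[OF F, of f g] prime_of_functionsD(3)[OF \<pp>, of f g] by blast
    then show ?case
      using f(2) g(2) by (intro bexI[of _ "\<lambda>s. f s * g s"]) auto
  qed
  then have inter: "\<exists>f\<in>F - \<pp>. {s \<in> S. f s \<noteq> 0} \<subseteq> \<Inter>G" if "finite G" "G \<subseteq> \<A>" for G
    using that by simp
  have nonempty: "{s \<in> S. f s \<noteq> 0} \<noteq> {}" if "f \<in> F - \<pp>" for f
    using that vanish[of f] by blast
  show thesis
  proof (rule ultrafilter_exists[of \<A>])
    fix G assume "finite G" "G \<subseteq> \<A>"
    from inter[OF this] obtain f where "f \<in> F - \<pp>" "{s \<in> S. f s \<noteq> 0} \<subseteq> \<Inter>G" ..
    then show "\<Inter>G \<noteq> {}"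
      using nonempty[of f] by auto
  next
    fix U assume U: "ultrafilter U" "\<And>A. A \<in> \<A> \<Longrightarrow> eventually (\<lambda>s. s \<in> A) U"
    have ev: "eventually (\<lambda>s. s \<in> S \<and> f s \<noteq> 0) U" if "f \<in> F - \<pp>" for f
      using U(2)[of "{s \<in> S. f s \<noteq> 0}"] that by (auto simp: \<A>_def)
    show thesis
    proof (rule that[OF U(1)])
      show "eventually (\<lambda>s. s \<in> S) U"
        using ev[OF one] by (rule eventually_mono) simp
      show "eventually (\<lambda>s. f s \<noteq> 0) U" if "f \<in> F" "f \<notin> \<pp>" for f
        using ev[of f] that by (auto elim: eventually_mono)
    qed
  qed
qed

definition (in ultrafilter) independent_functions :: "('p \<Rightarrow> 'k::field) set \<Rightarrow> nat \<Rightarrow> (nat \<Rightarrow> 'p \<Rightarrow> 'k) \<Rightarrow> bool" where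
  "independent_functions F m y \<longleftrightarrow> (\<forall>i<m. y i \<in> F) \<and>
    (\<forall>K c. null (\<lambda>s. \<Sum>\<alpha>\<in>exponents m K. c \<alpha> * monomial_at y 0 \<alpha> s) \<longrightarrow> (\<forall>\<alpha>\<in>exponents m K. c \<alpha> = 0))"

lemma (in ultrafilter) independent_functions_0: "independent_functions F 0 y"
proof -
  have "exponents 0 K = {[]}" for K
    by (auto simp: exponents_def)
  then show ?thesis
    using proper by (auto simp: independent_functions_def null_def)
qed

theorem chain_generic_ultrafilter:
  assumes "\<And>i. i \<le> m \<Longrightarrow> primeideal (p i) (closure_ring scale A S)"
    and "\<And>i. i < m \<Longrightarrow> p i \<subset> p (Suc i)"
  obtains U y where "ultrafilter U" "eventually (\<lambda>s. s \<in> S) U"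
    "ultrafilter.independent_functions U (poly_functions scale A) m y"
proof -
  let ?F = "poly_functions scale A"
  define \<pp> where "\<pp> i = {f \<in> ?F. restrict f S \<in> p i}" for i
  have \<pp>: "prime_of_functions ?F (\<pp> i)" if "i \<le> m" for i
    unfolding \<pp>_def by (rule primeideal_closure_ring(1)[OF assms(1)[OF that]])
  have sub: "\<pp> i \<subseteq> \<pp> (Suc i)" if "i < m" for i
    using assms(2)[OF that] by (auto simp: \<pp>_def)
  have "\<forall>i. \<exists>y. i < m \<longrightarrow> y \<in> ?F \<and> y \<in> \<pp> (Suc i) \<and> y \<notin> \<pp> i"
  proof (intro allI)
    fix i
    show "\<exists>y. i < m \<longrightarrow> y \<in> ?F \<and> y \<in> \<pp> (Suc i) \<and> y \<notin> \<pp> i"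
    proof (cases "i < m")
      case True
      then obtain q where "q \<in> p (Suc i)" "q \<notin> p i"
        using assms(2) by blast
      moreover from this(1) obtain y where "y \<in> ?F" "q = restrict y S"
        using primeideal_closure_ring(3)[OF assms(1)[of "Suc i"]] True by auto
      ultimately show ?thesis
        by (auto simp: \<pp>_def)
    qed simp
  qed
  from choice[OF this] obtain y where y: "\<And>i. i < m \<Longrightarrow> y i \<in> ?F \<and> y i \<in> \<pp> (Suc i) \<and> y i \<notin> \<pp> i"
    by blast
  have vanish: "f \<in> \<pp> 0" if "f \<in> ?F" "\<And>s. s \<in> S \<Longrightarrow> f s = 0" for f
    using primeideal_closure_ring(2)[OF assms(1)[of 0]] that by (auto simp: \<pp>_def)
  obtain U where U: "ultrafilter U" "eventually (\<lambda>s. s \<in> S) U"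
    "\<And>f. f \<in> ?F \<Longrightarrow> f \<notin> \<pp> 0 \<Longrightarrow> eventually (\<lambda>s. f s \<noteq> 0) U"
    by (rule prime_ultrafilter[OF function_ring_poly_functions \<pp>[of 0] vanish]) auto
  interpret ultrafilter U by fact
  have "c \<alpha> = 0" if null: "null (\<lambda>s. \<Sum>\<alpha>\<in>exponents m K. c \<alpha> * monomial_at y 0 \<alpha> s)" and \<alpha>: "\<alpha> \<in> exponents m K" for K c \<alpha>
  proof (rule chain_independent[of ?F m \<pp> y 0 m c K \<alpha>])
    have "(\<lambda>s. \<Sum>\<alpha>\<in>exponents m K. c \<alpha> * monomial_at y 0 \<alpha> s) \<in> ?F"
    proof (intro function_ring_sum[OF function_ring_poly_functions] poly_functions.mult poly_functions.const)
      fix \<beta> assume "\<beta> \<in> exponents m K"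
      then show "monomial_at y 0 \<beta> \<in> ?F"
        using y by (intro function_ring_monomial[OF function_ring_poly_functions]) (auto simp: exponents_def)
    qed
    then show "(\<lambda>s. \<Sum>\<alpha>\<in>exponents m K. c \<alpha> * monomial_at y 0 \<alpha> s) \<in> \<pp> 0"
      using U(3) null not_null_iff by blast
  qed (use function_ring_poly_functions \<pp> sub y \<alpha> in auto)
  then have "independent_functions ?F m y"
    using y by (auto simp: independent_functions_def)
  with U show thesis
    using that by blast
qed

context generic_point
begin

lemma poly_function_in_pol:
  assumes "f \<in> poly_functions scale {2..d}"
  shows "\<exists>g\<in>pol x N. \<forall>p\<in>PiE {2..d} V. f p = g p"
  using assms
proof induction
  case (const c)
  then show ?case
    by (intro bexI[of _ "\<lambda>_. c"]) (auto intro: pol.const)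
next
  case (linear a l)
  interpret l: Vector_Spaces.linear scale "(*)" l by fact
  have "l (p a) = (\<Sum>n\<in>slot_indices a. x n p * l (e n))" if p: "p \<in> PiE {2..d} V" for p
  proof -
    have "p a = (\<Sum>n\<in>slot_indices a. scale (coord n (p a)) (e n))"
      unfolding slot_indices_def by (rule coordinates) (use p linear in auto)
    then have "l (p a) = l (\<Sum>n\<in>slot_indices a. scale (coord n (p a)) (e n))"
      by (rule arg_cong)
    also have "\<dots> = (\<Sum>n\<in>slot_indices a. coord n (p a) * l (e n))"
      by (simp add: l.sum l.scale)
    also have "\<dots> = (\<Sum>n\<in>slot_indices a. x n p * l (e n))"
      by (intro sum.cong) (auto simp: x_coordinate slot_indices_def)
    finally show ?thesis .
  qed
  moreover have "(\<lambda>p. \<Sum>n\<in>slot_indices a. x n p * l (e n)) \<in> pol x N"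
    by (intro pol_closed) (auto simp: slot_indices_def)
  ultimately show ?case
    by (intro bexI[of _ "\<lambda>p. \<Sum>n\<in>slot_indices a. x n p * l (e n)"]) auto
next
  case (add f g)
  from add.IH(1) obtain f' where "f' \<in> pol x N" "\<forall>p\<in>PiE {2..d} V. f p = f' p" ..
  moreover from add.IH(2) obtain g' where "g' \<in> pol x N" "\<forall>p\<in>PiE {2..d} V. g p = g' p" ..
  ultimately show ?case
    by (intro bexI[of _ "\<lambda>p. f' p + g' p"]) (auto intro: pol.add)
next
  case (mult f g)
  from mult.IH(1) obtain f' where "f' \<in> pol x N" "\<forall>p\<in>PiE {2..d} V. f p = f' p" ..
  moreover from mult.IH(2) obtain g' where "g' \<in> pol x N" "\<forall>p\<in>PiE {2..d} V. g p = g' p" ..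
  ultimately show ?case
    by (intro bexI[of _ "\<lambda>p. f' p * g' p"]) (auto intro: pol.mult)
qed

text \<open>
  The \<open>m\<close> independent functions are polynomials in the coordinates, so at least \<open>m\<close> coordinates are
  transcendental.
\<close>

lemma algebraic_count:
  assumes "independent_functions (poly_functions scale {2..d}) m y"
  shows "m + card {n \<in> {n0..<N}. algebraic x n} \<le> N"
proof -
  have "\<forall>i. \<exists>g. i < m \<longrightarrow> g \<in> pol x N \<and> (\<forall>p\<in>PiE {2..d} V. y i p = g p)"
  proof
    fix i
    show "\<exists>g. i < m \<longrightarrow> g \<in> pol x N \<and> (\<forall>p\<in>PiE {2..d} V. y i p = g p)"
    proof (cases "i < m")
      case True
      then have "y i \<in> poly_functions scale {2..d}"
        using assms by (simp add: independent_functions_def)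
      from poly_function_in_pol[OF this] obtain g where "g \<in> pol x N" "\<forall>p\<in>PiE {2..d} V. y i p = g p" ..
      then show ?thesis
        by (intro exI[of _ g]) simp
    qed simp
  qed
  from choice[OF this] obtain z where z: "\<And>i. i < m \<Longrightarrow> z i \<in> pol x N" "\<And>i p. i < m \<Longrightarrow> p \<in> PiE {2..d} V \<Longrightarrow> y i p = z i p"
    by blast
  have "m \<le> card {i \<in> {..<N}. \<not> algebraic x i}"
  proof (rule independent_card_le[OF z(1)])
    fix K c \<alpha> assume z_null: "null (\<lambda>s. \<Sum>\<alpha>\<in>exponents m K. c \<alpha> * monomial_at z 0 \<alpha> s)"
      and \<alpha>: "\<alpha> \<in> exponents m K"
    have "null (\<lambda>s. \<Sum>\<alpha>\<in>exponents m K. c \<alpha> * monomial_at y 0 \<alpha> s)"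
      using z_null degenerate unfolding null_def
    proof eventually_elim
      case (elim s)
      have "monomial_at y 0 \<alpha> s = monomial_at z 0 \<alpha> s" if "\<alpha> \<in> exponents m K" for \<alpha>
        using z(2) elim(2) that by (intro monomial_at_cong) (auto simp: exponents_def)
      then show ?case
        using elim(1) by simp
    qed
    then show "c \<alpha> = 0"
      using assms \<alpha> unfolding independent_functions_def by blast
  qed
  moreover have "card {i \<in> {..<N}. \<not> algebraic x i} + card {n \<in> {n0..<N}. algebraic x n} \<le> card {..<N}"
  proof -
    have "card ({i \<in> {..<N}. \<not> algebraic x i} \<union> {n \<in> {n0..<N}. algebraic x n}) \<le> card {..<N}"
      by (rule card_mono) auto
    moreover have "card ({i \<in> {..<N}. \<not> algebraic x i} \<union> {n \<in> {n0..<N}. algebraic x n}) =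
        card {i \<in> {..<N}. \<not> algebraic x i} + card {n \<in> {n0..<N}. algebraic x n}"
      by (rule card_Un_disjoint) auto
    ultimately show ?thesis
      by (simp only:)
  qed
  ultimately show ?thesis
    by simp
qed

text \<open>
  Each identity of \<open>generic_decomposition\<close> holds at the generic point for one \<open>\<tau>\<close>. A rational point
  satisfies finitely many of them, and tuples of basis vectors suffice.
\<close>

lemma specialise:
  assumes basis: "\<And>i. i \<in> {1..d} \<Longrightarrow> finite (B i) \<and> span (B i) = V i" and E: "eventually E U"
  shows "\<exists>p. E p \<and> schmidt_rank scale d V (P p) \<le> 2 ^ (d - 2) * card {n \<in> {n0..<N}. algebraic x n}"
proof -
  from generic_decomposition obtain h \<Phi> c where h: "\<not> null h" "split_sum x n1 {1..d} c \<Phi>"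
    "c \<le> 2 ^ (d - 2) * card {n \<in> {n0..<N}. algebraic x n}"
    "\<And>\<tau>. \<tau> \<in> PiE {1..d} V \<Longrightarrow> null (\<lambda>s. h s * P s \<tau> - \<Phi> s \<tau>)"
    by blast
  have fin: "finite (PiE {1..d} B)"
    using basis by (intro finite_PiE) auto
  have BV: "PiE {1..d} B \<subseteq> PiE {1..d} V"
    using basis span_superset by (intro PiE_mono) blast
  have "eventually (\<lambda>s. \<forall>\<tau>\<in>PiE {1..d} B. h s * P s \<tau> - \<Phi> s \<tau> = 0) U"
    using h(4) BV fin by (auto simp: null_def eventually_ball_finite_distrib)
  moreover have "eventually (\<lambda>s. h s \<noteq> 0) U"
    using h(1) by (simp add: not_null_iff)
  ultimately have "eventually (\<lambda>s. (\<forall>\<tau>\<in>PiE {1..d} B. h s * P s \<tau> - \<Phi> s \<tau> = 0) \<and> h s \<noteq> 0 \<and> E s) U"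
    using E by eventually_elim blast
  from eventually_ex[OF this] obtain p where
    p: "\<And>\<tau>. \<tau> \<in> PiE {1..d} B \<Longrightarrow> h p * P p \<tau> - \<Phi> p \<tau> = 0" "h p \<noteq> 0" "E p"
    by blast
  have "polylinear_form scale {1..d} V (\<lambda>\<tau>. h p * P p \<tau> + (-1) * \<Phi> p \<tau>)"
    by (intro polylinear_form_add polylinear_form_cmult forms_polylinear[OF P_form]
        forms_polylinear[OF split_sum_forms[OF h(2)]])
  from polylinear_form_vanishes_on_basis[OF this, of B] have eq: "h p * P p \<tau> = \<Phi> p \<tau>" if "\<tau> \<in> PiE {1..d} V" for \<tau>
    using that p(1) basis V_subspace by simp
  from split_sum_rank_one_terms[OF h(2), of "inverse (h p)" p] obtain r Q where
    Q: "r \<le> c" "\<forall>i<r. schmidt_rank_one scale d V (Q i)"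
    "\<forall>v\<in>PiE {1..d} V. inverse (h p) * \<Phi> p v = (\<Sum>i<r. Q i v)"
    by blast
  have "P p v = (\<Sum>i<r. Q i v)" if "v \<in> PiE {1..d} V" for v
  proof -
    have "P p v = inverse (h p) * (h p * P p v)"
      using p(2) by simp
    also have "\<dots> = inverse (h p) * \<Phi> p v"
      by (simp only: eq[OF that])
    also have "\<dots> = (\<Sum>i<r. Q i v)"
      using Q(3) that by blast
    finally show ?thesis .
  qed
  then have "schmidt_rank scale d V (P p) \<le> r"
    unfolding schmidt_rank_def using Q(2) by (intro Least_le) blast
  then show ?thesis
    using p(3) Q(1) h(3) by (meson order_trans)
qed

end

section \<open>Coordinates\<close>

text \<open>
  Concatenates bases of \<open>V 2, \<dots>, V d\<close>, with the basis of \<open>V d\<close> at the end, and extends the dual bases to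
  functionals on the ambient space.
\<close>

lemma coordinate_system:
  fixes scale :: "'k::field \<Rightarrow> 'v::ab_group_add \<Rightarrow> 'v" and V :: "nat \<Rightarrow> 'v set"
  assumes vs: "vector_space scale" and V: "\<And>i. i \<in> {1..d} \<Longrightarrow> fin_dim_subspace scale (V i)" and d: "2 \<le> d"
  obtains n1 N slot e coord where
    "n0 \<le> n1" "n1 \<le> N"
    "\<And>n. n \<in> {n0..<n1} \<Longrightarrow> slot n \<in> {2..<d}"
    "\<And>n. n \<in> {n1..<N} \<Longrightarrow> slot n = d"
    "\<And>n. n \<in> {n0..<N} \<Longrightarrow> e n \<in> V (slot n)"
    "\<And>n. n \<in> {n0..<N} \<Longrightarrow> Vector_Spaces.linear scale (*) (coord n)"
    "\<And>i v. i \<in> {2..d} \<Longrightarrow> v \<in> V i \<Longrightarrow> v = (\<Sum>n | n \<in> {n0..<N} \<and> slot n = i. scale (coord n v) (e n))"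
    "N = n0 + (\<Sum>i\<in>{2..d}. vector_space.dim scale (V i))"
proof -
  interpret vector_space scale by fact
  interpret field_space: vector_space "(*) :: 'k \<Rightarrow> 'k \<Rightarrow> 'k"
    by standard (auto simp: algebra_simps)
  interpret pair: vector_space_pair scale "(*) :: 'k \<Rightarrow> 'k \<Rightarrow> 'k"
    by standard
  have "\<forall>i. \<exists>B. i \<in> {2..d} \<longrightarrow> finite B \<and> B \<subseteq> V i \<and> independent B \<and> span B = V i \<and> card B = dim (V i)"
  proof
    fix i
    show "\<exists>B. i \<in> {2..d} \<longrightarrow> finite B \<and> B \<subseteq> V i \<and> independent B \<and> span B = V i \<and> card B = dim (V i)"
    proof (cases "i \<in> {2..d}")
      case True
      then have "fin_dim_subspace scale (V i)"
        by (intro V) auto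
      then obtain C where C: "subspace (V i)" "finite C" "span C = V i"
        by (auto simp: fin_dim_subspace_def)
      obtain B where B: "B \<subseteq> V i" "independent B" "V i \<subseteq> span B" "card B = dim (V i)"
        by (rule basis_exists)
      have "finite B"
        using independent_span_bound[OF C(2) B(2)] B(1) C(3) by simp
      moreover have "span B = V i"
        using span_minimal[OF B(1) C(1)] B(3) by (rule subset_antisym)
      ultimately show ?thesis
        using B by blast
    qed blast
  qed
  from choice[OF this] obtain B where "\<forall>i. i \<in> {2..d} \<longrightarrow> finite (B i) \<and> B i \<subseteq> V i \<and> independent (B i) \<and>
      span (B i) = V i \<and> card (B i) = dim (V i)" ..
  then have B: "\<And>i. i \<in> {2..d} \<Longrightarrow> finite (B i)" "\<And>i. i \<in> {2..d} \<Longrightarrow> B i \<subseteq> V i"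
    "\<And>i. i \<in> {2..d} \<Longrightarrow> independent (B i)" "\<And>i. i \<in> {2..d} \<Longrightarrow> span (B i) = V i"
    "\<And>i. i \<in> {2..d} \<Longrightarrow> card (B i) = dim (V i)"
    by simp_all
  have "\<forall>q. \<exists>g. fst q \<in> {2..d} \<longrightarrow> Vector_Spaces.linear scale (*) g \<and> (\<forall>b\<in>B (fst q). g b = (if b = snd q then 1 else 0))"
  proof
    fix q :: "nat \<times> 'v"
    show "\<exists>g. fst q \<in> {2..d} \<longrightarrow> Vector_Spaces.linear scale (*) g \<and> (\<forall>b\<in>B (fst q). g b = (if b = snd q then 1 else 0))"
    proof (cases "fst q \<in> {2..d}")
      case True
      from pair.linear_independent_extend[OF B(3)[OF this], of "\<lambda>b. if b = snd q then 1 else 0"]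
      obtain g where "Vector_Spaces.linear scale (*) g \<and> (\<forall>b\<in>B (fst q). g b = (if b = snd q then 1 else 0))" ..
      then show ?thesis
        by blast
    qed blast
  qed
  from choice[OF this] obtain g where "\<forall>q. fst q \<in> {2..d} \<longrightarrow> Vector_Spaces.linear scale (*) (g q) \<and> (\<forall>b\<in>B (fst q). g q b = (if b = snd q then 1 else 0))" ..
  then have g: "\<And>q. fst q \<in> {2..d} \<Longrightarrow> Vector_Spaces.linear scale (*) (g q)"
    "\<And>q b. fst q \<in> {2..d} \<Longrightarrow> b \<in> B (fst q) \<Longrightarrow> g q b = (if b = snd q then 1 else 0)"
    by blast+
  define E1 where "E1 = Sigma {2..<d} B"
  define E2 where "E2 = Sigma {d} B"
  have fin: "finite E1" "finite E2"
    unfolding E1_def E2_def using B(1) d by (auto intro!: finite_SigmaI)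
  obtain L1 L2 where L: "set L1 = E1" "distinct L1" "set L2 = E2" "distinct L2"
    using fin finite_distinct_list by metis
  define L where "L = L1 @ L2"
  have E: "E1 \<union> E2 = Sigma {2..d} B" "E1 \<inter> E2 = {}"
    using d by (auto simp: E1_def E2_def)
  have dist: "distinct L" and set_L: "set L = Sigma {2..d} B"
    using L E by (auto simp: L_def)
  define n1 where "n1 = n0 + length L1"
  define N where "N = n0 + length L"
  define slot where "slot n = fst (L ! (n - n0))" for n
  define e where "e n = snd (L ! (n - n0))" for n
  define coord where "coord n = g (L ! (n - n0))" for n
  have L_mem: "L ! (n - n0) \<in> Sigma {2..d} B" if "n \<in> {n0..<N}" for n
    using that nth_mem[of "n - n0" L] set_L by (auto simp: N_def)
  have slot: "slot n \<in> {2..d}" "e n \<in> B (slot n)" if "n \<in> {n0..<N}" for n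
    using L_mem[OF that] unfolding slot_def e_def by (cases "L ! (n - n0)"; simp)+
  show thesis
  proof (rule that[of n1 N slot e coord])
    show "n0 \<le> n1" "n1 \<le> N"
      by (simp_all add: n1_def N_def L_def)
    show "slot n \<in> {2..<d}" if "n \<in> {n0..<n1}" for n
    proof -
      have "n - n0 < length L1"
        using that by (auto simp: n1_def)
      then have "L ! (n - n0) \<in> E1"
        using nth_mem[of "n - n0" L1] L(1) by (simp add: L_def nth_append)
      then show ?thesis
        by (auto simp: slot_def E1_def)
    qed
    show "slot n = d" if "n \<in> {n1..<N}" for n
    proof -
      have "\<not> n - n0 < length L1" "n - n0 - length L1 < length L2"
        using that by (auto simp: n1_def N_def L_def)
      then have "L ! (n - n0) \<in> E2"
        using nth_mem[of "n - n0 - length L1" L2] L(3) by (simp add: L_def nth_append)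
      then show ?thesis
        by (auto simp: slot_def E2_def)
    qed
    show "e n \<in> V (slot n)" if "n \<in> {n0..<N}" for n
      using slot[OF that] B(2) by blast
    show "Vector_Spaces.linear scale (*) (coord n)" if "n \<in> {n0..<N}" for n
      unfolding coord_def using slot(1)[OF that] by (intro g(1)) (simp add: slot_def)
    show "N = n0 + (\<Sum>i\<in>{2..d}. dim (V i))"
    proof -
      have "length L = card (Sigma {2..d} B)"
        using distinct_card[OF dist] set_L by simp
      also have "\<dots> = (\<Sum>i\<in>{2..d}. card (B i))"
        using B(1) by (intro card_SigmaI) auto
      also have "\<dots> = (\<Sum>i\<in>{2..d}. dim (V i))"
        using B(5) by (intro sum.cong) auto
      finally show ?thesis
        by (simp add: N_def)
    qed
    show "v = (\<Sum>n | n \<in> {n0..<N} \<and> slot n = i. scale (coord n v) (e n))" if i: "i \<in> {2..d}" and v: "v \<in> V i" for i v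
    proof -
      have "v \<in> span (B i)"
        using B(4)[OF i] v by simp
      then obtain u where u: "v = (\<Sum>b\<in>B i. scale (u b) b)"
        using span_finite[OF B(1)[OF i]] by auto
      have gu: "g (i, b) v = u b" if b: "b \<in> B i" for b
      proof -
        interpret l: Vector_Spaces.linear scale "(*)" "g (i, b)"
          using g(1)[of "(i, b)"] i by simp
        have "g (i, b) v = (\<Sum>b'\<in>B i. u b' * g (i, b) b')"
          unfolding u by (simp add: l.sum l.scale)
        also have "\<dots> = (\<Sum>b'\<in>B i. if b' = b then u b else 0)"
          using g(2)[of "(i, b)"] i by (intro sum.cong) auto
        also have "\<dots> = u b"
          using b B(1)[OF i] by simp
        finally show ?thesis .
      qed
      have bij: "bij_betw e {n. n \<in> {n0..<N} \<and> slot n = i} (B i)"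
          unfolding bij_betw_def
        proof
          show "inj_on e {n. n \<in> {n0..<N} \<and> slot n = i}"
          proof (rule inj_onI)
            fix m n assume m: "m \<in> {n. n \<in> {n0..<N} \<and> slot n = i}" and n: "n \<in> {n. n \<in> {n0..<N} \<and> slot n = i}" and "e m = e n"
            then have "L ! (m - n0) = L ! (n - n0)"
              by (simp add: slot_def e_def prod_eq_iff)
            then have "m - n0 = n - n0"
              using m n dist by (subst (asm) nth_eq_iff_index_eq) (auto simp: N_def)
            moreover have "n0 \<le> m" "n0 \<le> n"
              using m n by auto
            ultimately show "m = n"
              by arith
          qed
          show "e ` {n. n \<in> {n0..<N} \<and> slot n = i} = B i"
          proof
            show "e ` {n. n \<in> {n0..<N} \<and> slot n = i} \<subseteq> B i"
              using slot(2) by auto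
            show "B i \<subseteq> e ` {n. n \<in> {n0..<N} \<and> slot n = i}"
            proof
              fix b assume "b \<in> B i"
              then have "(i, b) \<in> set L"
                using set_L i by simp
              then obtain j where j: "j < length L" "L ! j = (i, b)"
                by (auto simp: in_set_conv_nth)
              then have "b = e (n0 + j)" "n0 + j \<in> {n. n \<in> {n0..<N} \<and> slot n = i}"
                by (auto simp: e_def slot_def N_def)
              then show "b \<in> e ` {n. n \<in> {n0..<N} \<and> slot n = i}"
                by blast
            qed
          qed
        qed
      have "(\<Sum>n | n \<in> {n0..<N} \<and> slot n = i. scale (coord n v) (e n)) =
          (\<Sum>n | n \<in> {n0..<N} \<and> slot n = i. scale (g (i, e n) v) (e n))"
      proof (intro sum.cong refl)
        fix n assume "n \<in> {n. n \<in> {n0..<N} \<and> slot n = i}"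
        then have "L ! (n - n0) = (i, e n)"
          by (auto simp: slot_def e_def prod_eq_iff)
        then show "scale (coord n v) (e n) = scale (g (i, e n) v) (e n)"
          by (simp add: coord_def)
      qed
      also have "\<dots> = (\<Sum>b\<in>B i. scale (g (i, b) v) b)"
        by (rule sum.reindex_bij_betw[OF bij])
      also have "\<dots> = v"
        using gu by (simp add: u)
      finally show ?thesis ..
    qed
  qed
qed


section \<open>The rank bound\<close>

text \<open>
  The parameters of the generic point are the \<open>c p i\<close> with \<open>i \<noteq> i0\<close>. There are \<open>D + (r - 1)\<close> coordinates in
  total, and all parameters are counted as if they were transcendental.
\<close>

theorem rank_le_generic:
  fixes scale :: "'k::field \<Rightarrow> 'v::ab_group_add \<Rightarrow> 'v" and V :: "nat \<Rightarrow> 'v set"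
    and P :: "nat \<Rightarrow> (nat \<Rightarrow> 'v) \<Rightarrow> 'k" and c :: "(nat \<Rightarrow> 'v) \<Rightarrow> nat \<Rightarrow> 'k" and U :: "(nat \<Rightarrow> 'v) filter"
  assumes vs: "vector_space scale" and d: "2 \<le> d"
    and V: "\<And>i. i \<in> {1..d} \<Longrightarrow> fin_dim_subspace scale (V i)"
    and P: "\<And>i. i \<in> {1..r} \<Longrightarrow> polylinear_form scale {1..d} V (P i)"
    and U: "ultrafilter U"
    and degenerate: "eventually (\<lambda>p. p \<in> PiE {2..d} V \<and> (\<forall>y\<in>V 1. (\<Sum>i\<in>{1..r}. c p i * P i (p(1 := y))) = 0)) U"
    and i0: "i0 \<in> {1..r}" "\<And>p. c p i0 = 1"
    and y: "ultrafilter.independent_functions U (poly_functions scale {2..d}) m y"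
  defines "D \<equiv> \<Sum>i\<in>{2..d}. vector_space.dim scale (V i)"
  shows "m \<le> D + (r - 1) \<and>
    (\<exists>p. schmidt_rank scale d V (\<lambda>v. \<Sum>i\<in>{1..r}. c p i * P i v) \<le> 2 ^ (d - 2) * (D + (r - 1) - m))"
proof (rule coordinate_system[where V = V and ?n0.0 = "r - 1", OF vs V d], assumption)
  fix n1 N slot e coord
  define n0 where "n0 = r - 1"
  assume coords: "r - 1 \<le> n1" "n1 \<le> N"
    "\<And>n. n \<in> {r - 1..<n1} \<Longrightarrow> slot n \<in> {2..<d}"
    "\<And>n. n \<in> {n1..<N} \<Longrightarrow> slot n = d"
    "\<And>n. n \<in> {r - 1..<N} \<Longrightarrow> e n \<in> V (slot n)"
    "\<And>n. n \<in> {r - 1..<N} \<Longrightarrow> Vector_Spaces.linear scale (*) (coord n)"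
    "\<And>i v. i \<in> {2..d} \<Longrightarrow> v \<in> V i \<Longrightarrow> v = (\<Sum>n | n \<in> {r - 1..<N} \<and> slot n = i. scale (coord n v) (e n))"
    and N_dim: "N = r - 1 + (\<Sum>i\<in>{2..d}. vector_space.dim scale (V i))"
  note coords = coords[folded n0_def]
  have N: "N = n0 + D"
    using N_dim by (simp add: n0_def D_def)
  interpret vector_space scale by fact
  interpret polylinear_forms scale V by standard
  interpret ultrafilter U by fact
  have card: "card ({1..r} - {i0}) = n0"
    using i0(1) by (simp add: n0_def)
  obtain idx where idx: "bij_betw idx {0..<n0} ({1..r} - {i0})"
    using ex_bij_betw_nat_finite[of "{1..r} - {i0}"] card by auto
  define x where "x n p = (if n < n0 then c p (idx n) else coord n (p (slot n)))" for n p
  define Q where "Q = (\<lambda>p \<tau>. \<Sum>i\<in>{1..r}. c p i * P i (restrict \<tau> {1..d}))"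
  have c_pol: "(\<lambda>p. c p i) \<in> pol x n0" if "i \<in> {1..r}" for i
  proof (cases "i = i0")
    case True
    then show ?thesis
      using i0(2) pol.const[of 1 x n0] by simp
  next
    case False
    then have "i \<in> idx ` {0..<n0}"
      using idx that by (simp add: bij_betw_def)
    then obtain n where "n < n0" "idx n = i"
      by auto
    then have "(\<lambda>p. c p i) = x n"
      by (simp add: x_def fun_eq_iff)
    then show ?thesis
      using pol.var[OF \<open>n < n0\<close>, of x] by simp
  qed
  have Q_form: "Q \<in> forms (pol x n0) {1..d}"
    unfolding Q_def by (intro forms_sum forms_single c_pol P)
  have Q_eq: "Q p \<tau> = (\<Sum>i\<in>{1..r}. c p i * P i \<tau>)" if "\<tau> \<in> PiE {1..d} V" for p \<tau>
    using that unfolding Q_def by (simp add: PiE_restrict)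
  interpret generic_point scale V U d n0 n1 N slot e coord x Q
  proof (intro generic_point.intro generic_point_axioms.intro)
    show "subspace (V i)" if "i \<in> {1..d}" for i
      using V[OF that] by (simp add: fin_dim_subspace_def)
    show "x n s = coord n (s (slot n))" if "n \<in> {n0..<N}" for n s
      using that by (simp add: x_def)
    show "eventually (\<lambda>p. p \<in> PiE {2..d} V \<and> (\<forall>y\<in>V 1. Q p (p(1 := y)) = 0)) U"
      using degenerate
    proof eventually_elim
      case (elim p)
      have "p(1 := y) \<in> PiE {1..d} V" if "y \<in> V 1" for y
        using elim that d by (auto simp: PiE_iff extensional_def)
      then show ?case
        using elim Q_eq by auto
    qed
  qed (fact d coords Q_form polylinear_forms_axioms ultrafilter_axioms)+
  have count: "m + card {n \<in> {n0..<N}. algebraic x n} \<le> N"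
    by (rule algebraic_count[OF y])
  have "\<forall>i. \<exists>B. i \<in> {1..d} \<longrightarrow> finite B \<and> span B = V i"
    using V by (auto simp: fin_dim_subspace_def)
  from choice[OF this] obtain B where "\<And>i. i \<in> {1..d} \<Longrightarrow> finite (B i) \<and> span (B i) = V i"
    by blast
  from specialise[OF this, of "\<lambda>_. True"] obtain p where
    p: "schmidt_rank scale d V (Q p) \<le> 2 ^ (d - 2) * card {n \<in> {n0..<N}. algebraic x n}"
    by auto
  have "schmidt_rank scale d V (\<lambda>v. \<Sum>i\<in>{1..r}. c p i * P i v) = schmidt_rank scale d V (Q p)"
    unfolding schmidt_rank_def using Q_eq by simp
  also note p
  also have "2 ^ (d - 2) * card {n \<in> {n0..<N}. algebraic x n} \<le> 2 ^ (d - 2) * (D + (r - 1) - m)"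
    using count by (intro mult_le_mono2) (simp add: N n0_def)
  finally have "\<exists>p. schmidt_rank scale d V (\<lambda>v. \<Sum>i\<in>{1..r}. c p i * P i v) \<le> 2 ^ (d - 2) * (D + (r - 1) - m)"
    by blast
  moreover have "m \<le> D + (r - 1)"
    using count by (simp add: N n0_def)
  ultimately show ?thesis
    by blast
qed

text \<open>
  Turns bounds for all chains of primes into a bound by the codimension. Chains have bounded length,
  so the Krull dimension is attained. The point \<open>p0\<close> takes care of a ring without primes, where the
  supremum is \<open>0\<close>.
\<close>

lemma codim_closure_bound:
  fixes scale :: "'k::field \<Rightarrow> 'v::ab_group_add \<Rightarrow> 'v" and S :: "(nat \<Rightarrow> 'v) set"
  assumes S: "p0 \<in> S"
    and bound: "\<And>U m y. ultrafilter U \<Longrightarrow> eventually (\<lambda>p. p \<in> S) U \<Longrightarrow>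
      ultrafilter.independent_functions U (poly_functions scale A) m y \<Longrightarrow>
      m \<le> (\<Sum>a\<in>A. vector_space.dim scale (V a)) + k \<and>
      \<rho> \<le> C * ((\<Sum>a\<in>A. vector_space.dim scale (V a)) + k - m)"
  shows "enat \<rho> \<le> enat C * (codim_closure scale A V S + enat k)"
proof -
  define D where "D = (\<Sum>a\<in>A. vector_space.dim scale (V a))"
  define chain where "chain n \<longleftrightarrow> (\<exists>p :: nat \<Rightarrow> ((nat \<Rightarrow> 'v) \<Rightarrow> 'k) set.
     (\<forall>i\<le>n. primeideal (p i) (closure_ring scale A S)) \<and> (\<forall>i<n. p i \<subset> p (Suc i)))" for n
  have zero: "\<rho> \<le> C * (D + k)"
  proof -
    interpret ultrafilter "principal {p0}"
      by (rule ultrafilter_principal)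
    show ?thesis
      using bound[OF ultrafilter_principal[of p0] _ independent_functions_0] S
      by (simp add: eventually_principal D_def)
  qed
  have chain_bound: "n \<le> D + k \<and> \<rho> \<le> C * (D + k - n)" if "chain n" for n
  proof -
    from that obtain p where p: "\<And>i. i \<le> n \<Longrightarrow> primeideal (p i) (closure_ring scale A S)"
      "\<And>i. i < n \<Longrightarrow> p i \<subset> p (Suc i)"
      by (auto simp: chain_def)
    show ?thesis
    proof (rule chain_generic_ultrafilter[of n p scale A S])
      fix U y assume "ultrafilter U" "eventually (\<lambda>p. p \<in> S) U"
        "ultrafilter.independent_functions U (poly_functions scale A) n y"
      then show "n \<le> D + k \<and> \<rho> \<le> C * (D + k - n)"
        unfolding D_def by (rule bound)
    qed (use p in auto)
  qed
  obtain n where n: "krull_dim (closure_ring scale A S) = enat n" "n \<le> D + k \<and> \<rho> \<le> C * (D + k - n)"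
  proof (cases "\<exists>n. chain n")
    case True
    define n where "n = (GREATEST n. chain n)"
    have n: "chain n" and max: "\<And>l. chain l \<Longrightarrow> l \<le> n"
      unfolding n_def using True chain_bound
      by (blast intro: GreatestI_ex_nat Greatest_le_nat)+
    have "krull_dim (closure_ring scale A S) = Sup (enat ` {n. chain n})"
      unfolding krull_dim_def chain_def by (rule arg_cong[where f = Sup]) blast
    also have "\<dots> = enat n"
      using n max by (intro antisym Sup_least Sup_upper) auto
    finally show thesis
      using that chain_bound[OF n] by blast
  next
    case False
    then have "krull_dim (closure_ring scale A S) = Sup {}"
      unfolding krull_dim_def chain_def by (intro arg_cong[where f = Sup]) blast
    then show thesis
      using that[of 0] zero by (simp add: bot_enat_def zero_enat_def)
  qed
  have "\<rho> \<le> C * (D + k - n)"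
    using n(2) by simp
  also have "\<dots> \<le> C * (D - n + k)"
    by (intro mult_le_mono2) simp
  finally show ?thesis
    unfolding codim_closure_def n(1) D_def[symmetric] by simp
qed

text \<open>
  The coefficients \<open>c i\<close> are \<open>r\<close> unknowns, and a basis of the image gives fewer than \<open>r\<close> equations.
\<close>

lemma rank_deficient_relation:
  fixes f :: "nat \<Rightarrow> 'v \<Rightarrow> 'k::field"
  assumes "vector_space.dim (\<lambda>(c :: 'k) (f :: nat \<Rightarrow> 'k) i. c * f i)
      ((\<lambda>x i. if i \<in> {1..r} then f i x else 0) ` X) < r"
  obtains c where "\<exists>i\<in>{1..r}. c i \<noteq> 0" "\<forall>x\<in>X. (\<Sum>i\<in>{1..r}. c i * f i x) = 0"
proof -
  interpret vector_space "\<lambda>(c :: 'k) (f :: nat \<Rightarrow> 'k) i. c * f i"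
    by standard (auto simp: fun_eq_iff algebra_simps plus_fun_def)
  define T where "T = (\<lambda>x i. if i \<in> {1..r} then f i x else 0) ` X"
  define unit where "unit = (\<lambda>(j :: nat) (i :: nat). if i = j then 1 else 0 :: 'k)"
  have T_span: "t \<in> span (unit ` {1..r})" if "t \<in> T" for t
  proof -
    have "t = (\<Sum>j\<in>{1..r}. (\<lambda>i. t j * unit j i))"
    proof
      fix i
      have "(\<Sum>j\<in>{1..r}. (\<lambda>i. t j * unit j i)) i = (\<Sum>j\<in>{1..r}. t j * unit j i)"
        by (induction rule: infinite_finite_induct) auto
      also have "\<dots> = (\<Sum>j\<in>{1..r}. if j = i then t j else 0)"
        by (intro sum.cong) (auto simp: unit_def)
      also have "\<dots> = t i"
        using that by (auto simp: T_def)
      finally show "t i = (\<Sum>j\<in>{1..r}. (\<lambda>i. t j * unit j i)) i" ..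
    qed
    moreover have "(\<Sum>j\<in>{1..r}. (\<lambda>i. t j * unit j i)) \<in> span (unit ` {1..r})"
      by (intro span_sum span_scale span_base) auto
    ultimately show ?thesis
      by simp
  qed
  obtain B where B: "B \<subseteq> T" "independent B" "T \<subseteq> span B" "card B = dim T"
    by (rule basis_exists)
  have finB: "finite B"
    using independent_span_bound[of "unit ` {1..r}" B] B T_span by auto
  have "card B < card {1..r}"
    using assms B(4) by (simp add: T_def)
  obtain b where b: "bij_betw b {0..<card B} B"
    using ex_bij_betw_nat_finite[OF finB] by blast
  from homogeneous_system_nontrivial[OF _ \<open>card B < card {1..r}\<close>, of "\<lambda>i j. b j i"]
  obtain c where c: "\<exists>i\<in>{1..r}. c i \<noteq> 0" "\<forall>j<card B. (\<Sum>i\<in>{1..r}. c i * b j i) = 0"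
    by auto
  have B_zero: "(\<Sum>i\<in>{1..r}. c i * t i) = 0" if "t \<in> B" for t
  proof -
    have "t \<in> b ` {0..<card B}"
      using that b by (simp add: bij_betw_def)
    then obtain j where "j < card B" "t = b j"
      by auto
    then show ?thesis
      using c(2) by simp
  qed
  have "subspace {t. (\<Sum>i\<in>{1..r}. c i * t i) = 0}"
    by (auto simp: subspace_def sum.distrib algebra_simps plus_fun_def zero_fun_def
        simp flip: sum_distrib_left)
  then have "span B \<subseteq> {t. (\<Sum>i\<in>{1..r}. c i * t i) = 0}"
    using B_zero by (intro span_minimal) auto
  then have T_zero: "(\<Sum>i\<in>{1..r}. c i * t i) = 0" if "t \<in> T" for t
    using B(3) that by blast
  have "(\<Sum>i\<in>{1..r}. c i * f i x) = 0" if "x \<in> X" for x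
  proof -
    have "(\<Sum>i\<in>{1..r}. c i * f i x) = (\<Sum>i\<in>{1..r}. c i * (if i \<in> {1..r} then f i x else 0))"
      by (intro sum.cong) auto
    also have "\<dots> = 0"
      by (rule T_zero) (use that in \<open>auto simp: T_def\<close>)
    finally show ?thesis .
  qed
  with c(1) show thesis
    using that by blast
qed

text \<open>
  Each nonempty proper subset \<open>I\<close> gives the one-element collection \<open>[I]\<close>. The set of all collections is
  finite, since disjoint nonempty sets are distinct; otherwise \<open>theta\<close> would be \<open>0\<close>.
\<close>

lemma power_le_C_const: "2 ^ (d - 2) \<le> C_const d"
proof -
  define n where "n = d - 2"
  define \<I> where "\<I> = {Is :: nat set list. Is \<noteq> [] \<and> (\<forall>I\<in>set Is. I \<noteq> {} \<and> I \<subseteq> {1..n}) \<and>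
    sorted_wrt disjnt Is \<and> \<Union>(set Is) \<subset> {1..n}}"
  have "distinct Is" if "Is \<in> \<I>" for Is
  proof -
    have "\<forall>I\<in>set Is. I \<noteq> {}" "sorted_wrt disjnt Is"
      using that by (auto simp: \<I>_def)
    then show ?thesis
      by (induction Is) (auto simp: disjnt_def)
  qed
  then have "\<I> \<subseteq> {Is. set Is \<subseteq> Pow {1..n} \<and> length Is \<le> 2 ^ n}"
  proof safe
    fix Is assume Is: "Is \<in> \<I>"
    assume dist: "\<And>Is. Is \<in> \<I> \<Longrightarrow> distinct Is"
    show "length Is \<le> 2 ^ n"
    proof -
      have "length Is = card (set Is)"
        using distinct_card[OF dist[OF Is]] by simp
      also have "\<dots> \<le> card (Pow {1..n})"
        using Is by (intro card_mono) (auto simp: \<I>_def)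
      finally show ?thesis
        by (simp add: card_Pow)
    qed
  qed (auto simp: \<I>_def)
  then have fin: "finite \<I>"
    by (rule finite_subset) (rule finite_lists_length_le, simp)
  have "(\<lambda>I. [I]) ` (Pow {1..n} - {{}, {1..n}}) \<subseteq> \<I>"
    by (auto simp: \<I>_def)
  then have "card ((\<lambda>I. [I]) ` (Pow {1..n} - {{}, {1..n}})) \<le> card \<I>"
    by (rule card_mono[OF fin])
  also have "card ((\<lambda>I. [I]) ` (Pow {1..n} - {{}, {1..n}})) = card (Pow {1..n} - {{}, {1..n}})"
    by (rule card_image) (simp add: inj_on_def)
  finally have "card (Pow {1..n} - {{}, {1..n}}) \<le> theta n"
    by (simp add: theta_def \<I>_def)
  moreover have "card (Pow {1..n}) - card {{}, {1..n}} \<le> card (Pow {1..n} - {{}, {1..n}})"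
    by (rule diff_card_le_card_Diff) simp
  moreover have "card {{}, {1..n}} \<le> 2"
    using card_insert_le_m1[of 2 "{{1..n}}" "{}"] by simp
  moreover have "card (Pow {1..n}) = 2 ^ n"
    by (simp add: card_Pow)
  ultimately have "2 ^ n \<le> 2 + theta n"
    by linarith
  then show ?thesis
    by (simp add: C_const_def n_def)
qed

theorem theorem1p2:
  fixes scale :: "'k::field \<Rightarrow> 'v::ab_group_add \<Rightarrow> 'v"
    and d :: nat
    and V :: "nat \<Rightarrow> 'v set"
  assumes "vector_space scale"
    and "d \<ge> 2"
    and "\<And>a. a \<in> {1..d} \<Longrightarrow> fin_dim_subspace scale (V a)"
  shows "(\<forall>P :: (nat \<Rightarrow> 'v) \<Rightarrow> 'k. polylinear_form scale {1..d} V P \<longrightarrow>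
            enat (schmidt_rank scale d V P)
              \<le> enat (C_const d) * codim_closure scale {2..d} V (Z_form d V P)) \<and>
         (algebraically_closed_field TYPE('k) \<longrightarrow>
           (\<forall>s \<ge> 1. \<forall>P :: nat \<Rightarrow> (nat \<Rightarrow> 'v) \<Rightarrow> 'k.
             (\<forall>i \<in> {1..s}. polylinear_form scale {1..d} V (P i)) \<longrightarrow>
             enat (schmidt_rank_coll scale d V s P)
               \<le> enat (C_const d) *
                   (codim_closure scale {2..d} V (Z_coll d V s P) + enat (s - 1))))"
proof (intro conjI allI impI)
  let ?D = "\<Sum>i\<in>{2..d}. vector_space.dim scale (V i)"
  interpret polylinear_forms scale V
    using assms(1) by (simp add: polylinear_forms_def)
  have zero_mem: "0 \<in> V i" if "i \<in> {1..d}" for i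
    using assms(3)[OF that] subspace_0 by (auto simp: fin_dim_subspace_def)
  have origin: "(\<lambda>i\<in>{2..d}. 0) \<in> PiE {2..d} V"
    using zero_mem by auto
  {
    fix P :: "(nat \<Rightarrow> 'v) \<Rightarrow> 'k"
    assume P: "polylinear_form scale {1..d} V P"
    show "enat (schmidt_rank scale d V P) \<le> enat (C_const d) * codim_closure scale {2..d} V (Z_form d V P)"
    proof -
      have bound: "m \<le> ?D + 0 \<and> schmidt_rank scale d V P \<le> 2 ^ (d - 2) * (?D + 0 - m)"
        if U: "ultrafilter U" "eventually (\<lambda>p. p \<in> Z_form d V P) U"
          "ultrafilter.independent_functions U (poly_functions scale {2..d}) m y" for U m y
      proof -
        have "eventually (\<lambda>p. p \<in> PiE {2..d} V \<and> (\<forall>y\<in>V 1. (\<Sum>i\<in>{1..1::nat}. 1 * P (p(1 := y))) = 0)) U"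
          using U(2) by (rule eventually_mono) (simp add: Z_form_def)
        from rank_le_generic[where P = "\<lambda>_. P" and c = "\<lambda>_ _. 1" and r = 1 and ?i0.0 = 1,
            OF assms P U(1) this _ _ U(3)]
        show ?thesis
          by simp
      qed
      have "(\<lambda>i\<in>{2..d}. 0) \<in> Z_form d V P"
        unfolding Z_form_def
      proof (intro CollectI conjI ballI origin)
        fix y assume y: "y \<in> V 1"
        let ?v = "(\<lambda>i\<in>{2..d}. 0)(1 := y)"
        have v: "?v \<in> PiE {1..d} V"
          using origin y assms(2) by (auto simp: PiE_iff extensional_def)
        show "P ?v = 0"
          by (rule polylinear_form_zero_slot[OF P v, of d]) (use assms(2) zero_mem[of d] in auto)
      qed
      then have "enat (schmidt_rank scale d V P) \<le> enat (2 ^ (d - 2)) *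
          (codim_closure scale {2..d} V (Z_form d V P) + enat 0)"
        using bound by (rule codim_closure_bound)
      also have "\<dots> \<le> enat (C_const d) * codim_closure scale {2..d} V (Z_form d V P)"
        using power_le_C_const[of d] by (simp add: mult_right_mono zero_enat_def[symmetric])
      finally show ?thesis .
    qed
  next
    fix r :: nat and P :: "nat \<Rightarrow> (nat \<Rightarrow> 'v) \<Rightarrow> 'k"
    assume r: "1 \<le> r" and P: "\<forall>i\<in>{1..r}. polylinear_form scale {1..d} V (P i)"
    show "enat (schmidt_rank_coll scale d V r P)
        \<le> enat (C_const d) * (codim_closure scale {2..d} V (Z_coll d V r P) + enat (r - 1))"
    proof -
      have bound: "m \<le> ?D + (r - 1) \<and> schmidt_rank_coll scale d V r P \<le> 2 ^ (d - 2) * (?D + (r - 1) - m)"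
        if U: "ultrafilter U" "eventually (\<lambda>p. p \<in> Z_coll d V r P) U"
          "ultrafilter.independent_functions U (poly_functions scale {2..d}) m y" for U m y
      proof -
        interpret ultrafilter U by fact
        have "\<forall>p. \<exists>c. p \<in> Z_coll d V r P \<longrightarrow> (\<exists>i\<in>{1..r}. c i \<noteq> 0) \<and> (\<forall>y\<in>V 1. (\<Sum>i\<in>{1..r}. c i * P i (p(1 := y))) = 0)"
        proof
          fix p
          show "\<exists>c. p \<in> Z_coll d V r P \<longrightarrow> (\<exists>i\<in>{1..r}. c i \<noteq> 0) \<and> (\<forall>y\<in>V 1. (\<Sum>i\<in>{1..r}. c i * P i (p(1 := y))) = 0)"
          proof (cases "p \<in> Z_coll d V r P")
            case True
            then have "vector_space.dim (\<lambda>(c :: 'k) (f :: nat \<Rightarrow> 'k) i. c * f i)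
                ((\<lambda>y i. if i \<in> {1..r} then P i (p(1 := y)) else 0) ` V 1) < r"
              by (simp add: Z_coll_def)
            from rank_deficient_relation[OF this] show ?thesis
              by metis
          qed simp
        qed
        from choice[OF this] obtain c where c: "\<And>p. p \<in> Z_coll d V r P \<Longrightarrow> \<exists>i\<in>{1..r}. c p i \<noteq> 0"
          "\<And>p y. p \<in> Z_coll d V r P \<Longrightarrow> y \<in> V 1 \<Longrightarrow> (\<Sum>i\<in>{1..r}. c p i * P i (p(1 := y))) = 0"
          by blast
        have "eventually (\<lambda>p. \<exists>i\<in>{1..r}. c p i \<noteq> 0) U"
          using U(2) by (rule eventually_mono) (rule c(1))
        \<comment> \<open>Finitely many indices are available, so the same one works on a large set of points.\<close>
        from eventually_bex_finite[OF _ this] obtain j where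
          j: "j \<in> {1..r}" "eventually (\<lambda>p. c p j \<noteq> 0) U"
          by auto
        define c' where "c' p i = (if i = j then 1 else c p i / c p j)" for p i
        have deg: "eventually (\<lambda>p. p \<in> PiE {2..d} V \<and> (\<forall>y\<in>V 1. (\<Sum>i\<in>{1..r}. c' p i * P i (p(1 := y))) = 0)) U"
          using U(2) j(2)
        proof eventually_elim
          case (elim p)
          have "(\<Sum>i\<in>{1..r}. c' p i * P i (p(1 := y))) = 0" if y: "y \<in> V 1" for y
          proof -
            have "(\<Sum>i\<in>{1..r}. c' p i * P i (p(1 := y))) = (\<Sum>i\<in>{1..r}. c p i * P i (p(1 := y)) / c p j)"
              using elim(2) by (intro sum.cong) (auto simp: c'_def)
            also have "\<dots> = (\<Sum>i\<in>{1..r}. c p i * P i (p(1 := y))) / c p j"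
              by (simp only: sum_divide_distrib)
            also have "\<dots> = 0"
              by (simp only: c(2)[OF elim(1) y]) simp
            finally show ?thesis .
          qed
          then show ?case
            using elim(1) by (simp add: Z_coll_def)
        qed
        have main: "m \<le> ?D + (r - 1) \<and>
            (\<exists>p. schmidt_rank scale d V (\<lambda>v. \<Sum>i\<in>{1..r}. c' p i * P i v) \<le> 2 ^ (d - 2) * (?D + (r - 1) - m))"
          by (rule rank_le_generic[where P = P and c = c' and r = r, OF assms _ U(1) deg j(1) _ U(3)])
            (use P in \<open>auto simp: c'_def\<close>)
        then obtain p where p: "schmidt_rank scale d V (\<lambda>v. \<Sum>i\<in>{1..r}. c' p i * P i v) \<le> 2 ^ (d - 2) * (?D + (r - 1) - m)"
          by blast
        have "schmidt_rank_coll scale d V r P \<le> schmidt_rank scale d V (\<lambda>v. \<Sum>i\<in>{1..r}. c' p i * P i v)"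
          unfolding schmidt_rank_coll_def
          by (rule cINF_lower) (use j(1) in \<open>auto simp: c'_def intro!: bexI[of _ j]\<close>)
        with p main show ?thesis
          by simp
      qed
      have "(\<lambda>i\<in>{2..d}. 0) \<in> Z_coll d V r P"
        unfolding Z_coll_def
      proof (intro CollectI conjI origin)
        interpret fun_space: vector_space "\<lambda>(c :: 'k) (f :: nat \<Rightarrow> 'k) i. c * f i"
          by standard (auto simp: fun_eq_iff algebra_simps plus_fun_def)
        have "P i ((\<lambda>i\<in>{2..d}. 0)(1 := y)) = 0" if i: "i \<in> {1..r}" and y: "y \<in> V 1" for i y
        proof -
          let ?v = "(\<lambda>i\<in>{2..d}. 0)(1 := y)"
          have v: "?v \<in> PiE {1..d} V"
            using origin y assms(2) by (auto simp: PiE_iff extensional_def)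
          show ?thesis
            by (rule polylinear_form_zero_slot[OF bspec[OF P i] v, of d]) (use assms(2) zero_mem[of d] in auto)
        qed
        then have "(\<lambda>y i. if i \<in> {1..r} then P i ((\<lambda>i\<in>{2..d}. 0)(1 := y)) else 0) ` V 1 \<subseteq> {\<lambda>_. 0}"
          by auto
        then have "fun_space.dim ((\<lambda>y i. if i \<in> {1..r} then P i ((\<lambda>i\<in>{2..d}. 0)(1 := y)) else 0) ` V 1) \<le> card ({} :: (nat \<Rightarrow> 'k) set)"
          by (intro fun_space.dim_le_card) (auto simp: zero_fun_def)
        then show "fun_space.dim ((\<lambda>y i. if i \<in> {1..r} then P i ((\<lambda>i\<in>{2..d}. 0)(1 := y)) else 0) ` V 1) < r"
          using r by simp
      qed
      then have "enat (schmidt_rank_coll scale d V r P) \<le> enat (2 ^ (d - 2)) *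
          (codim_closure scale {2..d} V (Z_coll d V r P) + enat (r - 1))"
        using bound by (rule codim_closure_bound)
      also have "\<dots> \<le> enat (C_const d) * (codim_closure scale {2..d} V (Z_coll d V r P) + enat (r - 1))"
        using power_le_C_const[of d] by (intro mult_right_mono) auto
      finally show ?thesis .
    qed
  }
qed

end
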